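(* Assume $\sigma>0$, $\int_{|x|\le1}|x|\nu(dx)<\infty$ and $d_+>0$. Then there exists a constant $C>0$ such that, for $t$ close enough to $T$, $$0\le b^{BS}(t)-b(t)\le C\sqrt{T-t}.$$
   Context: Let $X$ be a real Lévy process with characteristic triplet $(\sigma^2,\gamma,\nu)$ and Lévy–Itô decomposition $X_t=\gamma t+\sigma B_t+Y_t$, $B$ a standard Brownian motion; $(\mathcal F_t)$ the usual augmentation of its natural filtration. Fix $T>0$, $K>0$, $r>0$, $\delta\ge0$. Assume $\int_{|x|\ge1}e^x\nu(dx)<\infty$ and $\frac{\sigma^2}{2}+\gamma+\int(e^x-1-x\mathbf 1_{|x|\le1})\nu(dx)=0$. For $x\ge0$ let $S^x_t=xe^{(r-\delta)t+X_t}$; $P(t,x)=\sup_{\tau\in\mathcal T_{0,T-t}}\mathbb E[e^{-r\tau}(K-S^x_\tau)_+]$ (American put, $\mathcal T_{0,s}$ = stopping times in $[0,s]$), and $b(t)=\inf\{x\ge0:P(t,x)>(K-x)_+\}$ its critical price. Let $d_+=r-\delta-\int(e^y-1)_+\nu(dy)$. The associated Black–Scholes model is $S^{BS,x}_t=xe^{(r-\delta-\sigma^2/2)t+\sigma B_t}$, with American put price $P^{BS}(t,x)=\sup_{\tau\in\mathcal T_{0,T-t}}\mathbb E[e^{-r\tau}(K-S^{BS,x}_\tau)_+]$ and critical price $b^{BS}(t)=\inf\{x\ge0:P^{BS}(t,x)>(K-x)_+\}$. *)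

theory Defs
  imports "HOL-Probability.Probability"
begin

definition levy_process :: "'a measure \<Rightarrow> (real \<Rightarrow> 'a \<Rightarrow> real) \<Rightarrow> bool" where
  "levy_process M X \<longleftrightarrow>
     prob_space M \<and>
     (\<forall>s. X s \<in> borel_measurable M) \<and>
     (\<forall>\<omega>\<in>space M. X 0 \<omega> = 0) \<and>
     (\<forall>\<omega>\<in>space M. \<forall>s\<ge>0. continuous (at_right s) (\<lambda>u. X u \<omega>)) \<and>
     (\<forall>\<omega>\<in>space M. \<forall>s>0. \<exists>l. ((\<lambda>u. X u \<omega>) \<longlongrightarrow> l) (at_left s)) \<and>
     (\<forall>(t::nat \<Rightarrow> real) n. 0 \<le> t 0 \<and> mono t \<longrightarrow>
        prob_space.indep_vars M (\<lambda>_. borel) (\<lambda>i \<omega>. X (t (Suc i)) \<omega> - X (t i) \<omega>) {..<n}) \<and>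
     (\<forall>s\<ge>0. \<forall>h\<ge>0. distr M borel (\<lambda>\<omega>. X (s + h) \<omega> - X s \<omega>) = distr M borel (X h))"

definition levy_exponent :: "real \<Rightarrow> real \<Rightarrow> real measure \<Rightarrow> real \<Rightarrow> complex" where
  "levy_exponent \<sigma> \<gamma> \<nu> u =
     \<i> * complex_of_real (\<gamma> * u) - complex_of_real (\<sigma>\<^sup>2 * u\<^sup>2 / 2)
     + (CLINT y|\<nu>. iexp (u * y) - 1 - \<i> * complex_of_real (u * y * indicator {y. \<bar>y\<bar> \<le> 1} y))"

definition levy_measure :: "real measure \<Rightarrow> bool" where
  "levy_measure \<nu> \<longleftrightarrow> sets \<nu> = sets borel \<and> emeasure \<nu> {0} = 0
     \<and> integrable \<nu> (\<lambda>y. min 1 (y\<^sup>2))"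

definition levy_triplet :: "'a measure \<Rightarrow> (real \<Rightarrow> 'a \<Rightarrow> real) \<Rightarrow> real \<Rightarrow> real \<Rightarrow> real measure \<Rightarrow> bool" where
  "levy_triplet M X \<sigma> \<gamma> \<nu> \<longleftrightarrow> levy_process M X \<and> levy_measure \<nu> \<and>
     (\<forall>s\<ge>0. \<forall>u. char (distr M borel (X s)) u = exp (complex_of_real s * levy_exponent \<sigma> \<gamma> \<nu> u))"

definition nat_gen :: "'a measure \<Rightarrow> (real \<Rightarrow> 'a \<Rightarrow> real) \<Rightarrow> real \<Rightarrow> 'a set set" where
  "nat_gen M X u = {{\<omega>\<in>space M. X s \<omega> \<in> A} | s A. s \<in> {0..u} \<and> A \<in> sets borel}"

definition usual_filtration :: "'a measure \<Rightarrow> (real \<Rightarrow> 'a \<Rightarrow> real) \<Rightarrow> real \<Rightarrow> 'a measure" where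
  "usual_filtration M X t =
     sigma (space M) (\<Inter>u\<in>{t<..}. sets (sigma (space M) (nat_gen M X u \<union> null_sets (completion M))))"

definition american_put ::
  "'a measure \<Rightarrow> (real \<Rightarrow> 'a measure) \<Rightarrow> (real \<Rightarrow> real \<Rightarrow> 'a \<Rightarrow> real)
    \<Rightarrow> real \<Rightarrow> real \<Rightarrow> real \<Rightarrow> real \<Rightarrow> real \<Rightarrow> real" where
  "american_put M F S r K T t x =
     (SUP \<tau> \<in> {\<tau>. stopping_time F \<tau> \<and> (\<forall>\<omega>\<in>space M. 0 \<le> \<tau> \<omega> \<and> \<tau> \<omega> \<le> T - t)}.
        integral\<^sup>L (completion M) (\<lambda>\<omega>. exp (- r * \<tau> \<omega>) * max 0 (K - S x (\<tau> \<omega>) \<omega>)))"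

definition critical_price :: "(real \<Rightarrow> real \<Rightarrow> real) \<Rightarrow> real \<Rightarrow> real \<Rightarrow> real" where
  "critical_price P K t = Inf {x. 0 \<le> x \<and> P t x > max 0 (K - x)}"

definition brownian_motion :: "'a measure \<Rightarrow> (real \<Rightarrow> 'a measure) \<Rightarrow> (real \<Rightarrow> 'a \<Rightarrow> real) \<Rightarrow> bool" where
  "brownian_motion M F B \<longleftrightarrow>
     (\<forall>s. B s \<in> borel_measurable (F s)) \<and>
     (\<forall>\<omega>\<in>space M. B 0 \<omega> = 0) \<and>
     (\<forall>\<omega>\<in>space M. continuous_on {0..} (\<lambda>s. B s \<omega>)) \<and>
     (\<forall>s u. 0 \<le> s \<and> s < u \<longrightarrow>
        distr (completion M) borel (\<lambda>\<omega>. B u \<omega> - B s \<omega>) = density lborel (normal_density 0 (sqrt (u - s))) \<and>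
        (\<forall>A\<in>sets (F s). \<forall>D\<in>sets borel.
           measure (completion M) (A \<inter> {\<omega>\<in>space M. B u \<omega> - B s \<omega> \<in> D})
             = measure (completion M) A * measure (completion M) {\<omega>\<in>space M. B u \<omega> - B s \<omega> \<in> D}))"

end

theory Submission
  imports Defs
begin

text \<open>
  Both American puts are limits of Bermudan puts on the grids of mesh \<open>h = (T - t) / n\<close>, whose values are
  computed by iterating \<open>V \<mapsto> max ((K - x)\<^sub>+) (e\<^sup>-\<^sup>r\<^sup>h E V(x S\<^sub>h))\<close>. So only the one-step laws matter.
  As the jumps have finite variation, that of the Levy model is the law of \<open>S\<^sup>B\<^sup>S\<^sub>h \<cdot> Y\<close>, where \<open>Y > 0\<close> is
  independent of \<open>S\<^sup>B\<^sup>S\<^sub>h\<close>, has mean at most \<open>1\<close> and satisfies \<open>E \<bar>Y - 1\<bar> = O(h)\<close>; up to a shift, the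
  law of \<open>log Y\<close> is a weak limit of compound Poisson laws, along which moment bounds survive. Jensen's inequality for the convex decreasing \<open>V\<close>
  gives \<open>P\<^sup>B\<^sup>S \<le> P\<close>, hence \<open>b \<le> b\<^sup>B\<^sup>S\<close>, and the \<open>O(h)\<close> bound gives \<open>P \<le> P\<^sup>B\<^sup>S + C\<^sub>1 (T - t) x\<close>.

  For the upper bound on the gap let \<open>z + C \<surd>(T - t) < b\<^sup>B\<^sup>S(t)\<close> and consider the barrier
  \<open>W(v) = K - v + \<beta> ((v - z)\<^sub>+)\<^sup>2\<close>, frozen beyond a point \<open>x\<close> slightly below \<open>b\<^sup>B\<^sup>S(t)\<close>. If \<open>C\<close> is large, then
  \<open>W \<ge> K - v + C\<^sub>1 (T - t) K \<ge> P(t, v)\<close> at distance \<open>\<ge> C \<surd>(T - t)\<close> from \<open>z\<close>. Below that, waiting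
  for a time \<open>h\<close> costs \<open>(r - \<delta>) K h\<close>, while the upward jumps gain at most \<open>K h \<integral>(e\<^sup>y - 1)\<^sub>+ d\<nu>\<close> and the quadratic term
  \<open>O(\<beta> h)\<close>. As \<open>d\<^sub>+ > 0\<close>, a small \<open>\<beta>\<close> makes \<open>W\<close> a supersolution, so \<open>P(t, z) \<le> W(z) = K - z\<close>.
\<close>

section \<open>Bermudan puts\<close>

fun bermudan_put :: "real measure \<Rightarrow> real \<Rightarrow> real \<Rightarrow> nat \<Rightarrow> real \<Rightarrow> real" where
  "bermudan_put m d K 0 x = max 0 (K - x)"
| "bermudan_put m d K (Suc n) x =
     max (max 0 (K - x)) (d * (\<integral>y. bermudan_put m d K n (x * exp y) \<partial>m))"

lemma bermudan_put_ge_payoff: "max 0 (K - x) \<le> bermudan_put m d K n x"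
  by (cases n) auto

lemma bermudan_put_nonneg: "0 \<le> bermudan_put m d K n x"
  using bermudan_put_ge_payoff[of K x m d n] by simp

lemma convex_on_max:
  fixes f g :: "'a::real_vector \<Rightarrow> real"
  assumes "convex_on A f" "convex_on A g"
  shows "convex_on A (\<lambda>x. max (f x) (g x))"
proof (rule convex_onI)
  fix t :: real and x y assume t: "0 < t" "t < 1" and xy: "x \<in> A" "y \<in> A"
  have "\<phi> ((1 - t) *\<^sub>R x + t *\<^sub>R y) \<le> (1 - t) * max (f x) (g x) + t * max (f y) (g y)"
    if "\<phi> = f \<or> \<phi> = g" for \<phi> :: "'a \<Rightarrow> real"
  proof -
    have "\<phi> ((1 - t) *\<^sub>R x + t *\<^sub>R y) \<le> (1 - t) * \<phi> x + t * \<phi> y"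
      using that assms t xy by (intro convex_onD) auto
    also have "\<dots> \<le> (1 - t) * max (f x) (g x) + t * max (f y) (g y)"
      using that t by (intro add_mono mult_left_mono) auto
    finally show ?thesis .
  qed
  then show "max (f ((1 - t) *\<^sub>R x + t *\<^sub>R y)) (g ((1 - t) *\<^sub>R x + t *\<^sub>R y))
      \<le> (1 - t) * max (f x) (g x) + t * max (f y) (g y)" by auto
qed (use assms in \<open>auto simp: convex_on_def\<close>)

lemma lipschitz_on_max:
  fixes f g :: "'a::metric_space \<Rightarrow> real"
  assumes "C-lipschitz_on A f" "C-lipschitz_on A g"
  shows "C-lipschitz_on A (\<lambda>x. max (f x) (g x))"
proof (rule lipschitz_onI)
  fix x y assume "x \<in> A" "y \<in> A"
  then have "\<bar>f x - f y\<bar> \<le> C * dist x y" "\<bar>g x - g y\<bar> \<le> C * dist x y"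
    using assms by (auto dest: lipschitz_onD simp: dist_real_def)
  then show "dist (max (f x) (g x)) (max (f y) (g y)) \<le> C * dist x y"
    by (auto simp: dist_real_def max_def)
qed (use assms in \<open>auto intro: lipschitz_on_nonneg\<close>)

lemma convex_on_payoff: "convex_on {0..} (\<lambda>x. max 0 (K - x :: real))"
  by (intro convex_on_max convex_on_diff) (simp_all add: convex_on_const concave_on_ident)

lemma lipschitz_on_payoff: "1-lipschitz_on {0..} (\<lambda>x. max 0 (K - x :: real))"
  by (rule lipschitz_onI) (auto simp: dist_real_def)

lemma convex_on_expectation_exp:
  fixes f :: "real \<Rightarrow> real"
  assumes f: "convex_on {0..} f" and int: "\<And>x. 0 \<le> x \<Longrightarrow> integrable m (\<lambda>y. f (x * exp y))"
  shows "convex_on {0..} (\<lambda>x. \<integral>y. f (x * exp y) \<partial>m)"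
proof (rule convex_onI)
  fix t x z :: real assume t: "0 < t" "t < 1" and "x \<in> {0..}" "z \<in> {0..}"
  then have xz: "0 \<le> x" "0 \<le> z" "0 \<le> (1 - t) * x + t * z" by auto
  have "(\<integral>y. f (((1 - t) * x + t * z) * exp y) \<partial>m) \<le> (\<integral>y. (1 - t) * f (x * exp y) + t * f (z * exp y) \<partial>m)"
  proof (rule integral_mono)
    fix y
    have "f ((1 - t) *\<^sub>R (x * exp y) + t *\<^sub>R (z * exp y)) \<le> (1 - t) * f (x * exp y) + t * f (z * exp y)"
      using f t xz by (intro convex_onD) auto
    then show "f (((1 - t) * x + t * z) * exp y) \<le> (1 - t) * f (x * exp y) + t * f (z * exp y)"
      by (simp add: algebra_simps)
  qed (use int xz in auto)
  also have "\<dots> = (1 - t) * (\<integral>y. f (x * exp y) \<partial>m) + t * (\<integral>y. f (z * exp y) \<partial>m)"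
    using int xz by simp
  finally show "(\<integral>y. f (((1 - t) *\<^sub>R x + t *\<^sub>R z) * exp y) \<partial>m)
      \<le> (1 - t) * (\<integral>y. f (x * exp y) \<partial>m) + t * (\<integral>y. f (z * exp y) \<partial>m)" by simp
qed simp

lemma lipschitz_on_expectation_exp:
  fixes f :: "real \<Rightarrow> real"
  assumes f: "1-lipschitz_on {0..} f" and int: "\<And>x. 0 \<le> x \<Longrightarrow> integrable m (\<lambda>y. f (x * exp y))"
    and exp: "integrable m exp"
  shows "(integral\<^sup>L m exp)-lipschitz_on {0..} (\<lambda>x. \<integral>y. f (x * exp y) \<partial>m)"
proof (rule lipschitz_onI)
  fix a b :: real assume "a \<in> {0..}" "b \<in> {0..}"
  then have ab: "0 \<le> a" "0 \<le> b" by auto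
  have "\<bar>(\<integral>y. f (a * exp y) \<partial>m) - (\<integral>y. f (b * exp y) \<partial>m)\<bar> = \<bar>\<integral>y. f (a * exp y) - f (b * exp y) \<partial>m\<bar>"
    using int ab by simp
  also have "\<dots> \<le> (\<integral>y. \<bar>f (a * exp y) - f (b * exp y)\<bar> \<partial>m)" by (rule integral_abs_bound)
  also have "\<dots> \<le> (\<integral>y. \<bar>a - b\<bar> * exp y \<partial>m)"
  proof (rule integral_mono)
    fix y
    have "\<bar>f (a * exp y) - f (b * exp y)\<bar> \<le> \<bar>a * exp y - b * exp y\<bar>"
      using lipschitz_onD[OF f, of "a * exp y" "b * exp y"] ab by (simp add: dist_real_def)
    then show "\<bar>f (a * exp y) - f (b * exp y)\<bar> \<le> \<bar>a - b\<bar> * exp y"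
      by (simp add: left_diff_distrib[symmetric] abs_mult)
  qed (use int ab exp in auto)
  finally show "dist (\<integral>y. f (a * exp y) \<partial>m) (\<integral>y. f (b * exp y) \<partial>m) \<le> integral\<^sup>L m exp * dist a b"
    by (simp add: dist_real_def mult.commute)
qed (simp add: integral_nonneg)

locale bermudan_model = prob_space m for m :: "real measure" +
  fixes d K :: real
  assumes sets_law [measurable_cong]: "sets m = sets borel"
    and discount: "0 \<le> d" "d \<le> 1" and strike_nonneg: "0 \<le> K"
begin

abbreviation V :: "nat \<Rightarrow> real \<Rightarrow> real" where "V \<equiv> bermudan_put m d K"

lemma borel_measurable_bermudan_put [measurable]: "V n \<in> borel_measurable borel"
proof (induction n)
  case (Suc n)
  note [measurable] = Suc.IH
  have "(\<lambda>x. \<integral>y. V n (x * exp y) \<partial>m) \<in> borel_measurable borel" by measurable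
  then show ?case by simp
qed simp

lemma bermudan_put_le_strike: "0 \<le> x \<Longrightarrow> V n x \<le> K"
proof (induction n arbitrary: x)
  case 0
  then show ?case using strike_nonneg by simp
next
  case (Suc n)
  have "(\<integral>y. V n (x * exp y) \<partial>m) \<le> K"
    using Suc by (intro integral_le_const integrable_const_bound[where B=K])
      (auto simp: bermudan_put_nonneg abs_of_nonneg)
  then have "d * (\<integral>y. V n (x * exp y) \<partial>m) \<le> 1 * K"
    using discount by (intro mult_mono) (auto intro!: integral_nonneg simp: bermudan_put_nonneg)
  then show ?case using Suc.prems strike_nonneg by simp
qed

lemma abs_bermudan_put_le: "0 \<le> x \<Longrightarrow> \<bar>V n x\<bar> \<le> K"
  using bermudan_put_le_strike by (simp add: bermudan_put_nonneg)

lemma integrable_bermudan_put: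
  assumes "prob_space m'" "sets m' = sets borel" "0 \<le> x"
  shows "integrable m' (\<lambda>y. V n (x * exp y))"
proof -
  interpret m': prob_space m' by fact
  note [measurable_cong] = assms(2)
  show ?thesis
    using assms(3) by (intro m'.integrable_const_bound[where B=K] AE_I2) (auto intro!: abs_bermudan_put_le)
qed

lemmas integrable_continuation = integrable_bermudan_put[OF prob_space_axioms sets_law]

lemma bermudan_put_mono_exercise_dates:
  assumes "k \<le> n" "0 \<le> x"
  shows "V k x \<le> V n x"
proof (rule lift_Suc_mono_le[of "\<lambda>k. V k x", OF _ assms(1)])
  show "V n x \<le> V (Suc n) x" for n
    using assms(2)
  proof (induction n arbitrary: x)
    case (Suc n)
    have "d * (\<integral>y. V n (x * exp y) \<partial>m) \<le> d * (\<integral>y. V (Suc n) (x * exp y) \<partial>m)"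
      using Suc discount by (intro mult_left_mono integral_mono integrable_continuation) auto
    then show ?case
      unfolding bermudan_put.simps(2)[of m d K "Suc n"] bermudan_put.simps(2)[of m d K n]
      by (intro max.mono order_refl)
  qed simp
qed

lemma antimono_on_bermudan_put: "antimono_on {0..} (V n)"
proof (induction n)
  case 0
  show ?case by (auto intro: monotone_onI)
next
  case (Suc n)
  show ?case
  proof (rule monotone_onI)
    fix a b :: real assume ab: "a \<in> {0..}" "b \<in> {0..}" "a \<le> b"
    have "d * (\<integral>y. V n (b * exp y) \<partial>m) \<le> d * (\<integral>y. V n (a * exp y) \<partial>m)"
      using ab discount
      by (intro mult_left_mono integral_mono integrable_continuation monotone_onD[OF Suc.IH]) auto
    then show "V (Suc n) a \<ge> V (Suc n) b" using ab by auto
  qed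
qed

lemma convex_on_bermudan_put: "convex_on {0..} (V n)"
proof (induction n)
  case (Suc n)
  have "convex_on {0..} (\<lambda>x. d * (\<integral>y. V n (x * exp y) \<partial>m))"
    using discount by (intro convex_on_cmul convex_on_expectation_exp[OF Suc.IH] integrable_continuation) auto
  from convex_on_max[OF convex_on_payoff this] show ?case by simp
qed (simp add: convex_on_payoff)

lemma lipschitz_on_bermudan_put:
  assumes "integrable m exp" "d * integral\<^sup>L m exp \<le> 1"
  shows "1-lipschitz_on {0..} (V n)"
proof (induction n)
  case (Suc n)
  have "(d * integral\<^sup>L m exp)-lipschitz_on {0..} (\<lambda>x. d * (\<integral>y. V n (x * exp y) \<partial>m))"
    using lipschitz_on_cmult_real[OF lipschitz_on_expectation_exp[OF Suc.IH integrable_continuation assms(1)], of d]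
      discount by simp
  then have "1-lipschitz_on {0..} (\<lambda>x. d * (\<integral>y. V n (x * exp y) \<partial>m))"
    using assms(2) by (rule lipschitz_on_le)
  from lipschitz_on_max[OF lipschitz_on_payoff this] show ?case by simp
qed (simp add: lipschitz_on_payoff)

lemma bermudan_put_le_supersolution:
  assumes payoff: "\<And>w. 0 \<le> w \<Longrightarrow> max 0 (K - w) \<le> W w"
    and int: "\<And>w. 0 \<le> w \<Longrightarrow> integrable m (\<lambda>y. W (w * exp y))"
    and super: "\<And>w. 0 \<le> w \<Longrightarrow> w \<le> a \<Longrightarrow> d * (\<integral>y. W (w * exp y) \<partial>m) \<le> W w"
    and beyond: "\<And>w. a \<le> w \<Longrightarrow> V n w \<le> W w"
    and "k \<le> n" "0 \<le> w"
  shows "V k w \<le> W w"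
  using assms(5,6)
proof (induction k arbitrary: w)
  case 0
  then show ?case using payoff by simp
next
  case (Suc k)
  show ?case
  proof (cases "w \<le> a")
    case True
    have "d * (\<integral>y. V k (w * exp y) \<partial>m) \<le> d * (\<integral>y. W (w * exp y) \<partial>m)"
      using Suc discount by (intro mult_left_mono integral_mono integrable_continuation int) auto
    also have "\<dots> \<le> W w" by (rule super[OF Suc.prems(2) True])
    finally show ?thesis using payoff[OF Suc.prems(2)] by simp
  next
    case False
    have "V (Suc k) w \<le> V n w" using Suc.prems by (rule bermudan_put_mono_exercise_dates)
    also have "\<dots> \<le> W w" using False by (intro beyond) simp
    finally show ?thesis .
  qed
qed

end

lemma bermudan_put_mono_law:
  assumes "bermudan_model m d K" "bermudan_model m' d K"
    and step: "\<And>n x. 0 \<le> x \<Longrightarrow>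
      (\<integral>y. bermudan_put m d K n (x * exp y) \<partial>m) \<le> (\<integral>y. bermudan_put m d K n (x * exp y) \<partial>m')"
    and "0 \<le> x"
  shows "bermudan_put m d K n x \<le> bermudan_put m' d K n x"
  using \<open>0 \<le> x\<close>
proof (induction n arbitrary: x)
  case (Suc n)
  interpret m: bermudan_model m d K by fact
  interpret m': bermudan_model m' d K by fact
  have "(\<integral>y. m.V n (x * exp y) \<partial>m) \<le> (\<integral>y. m.V n (x * exp y) \<partial>m')" using Suc.prems by (rule step)
  also have "\<dots> \<le> (\<integral>y. m'.V n (x * exp y) \<partial>m')"
    using Suc by (intro integral_mono m'.integrable_continuation
        m.integrable_bermudan_put[OF m'.prob_space_axioms m'.sets_law]) auto
  finally have "d * (\<integral>y. m.V n (x * exp y) \<partial>m) \<le> d * (\<integral>y. m'.V n (x * exp y) \<partial>m')"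
    using m.discount by (intro mult_left_mono) auto
  then show ?case unfolding bermudan_put.simps by (intro max.mono order_refl)
qed simp

lemma bermudan_put_le_add_error:
  assumes "bermudan_model m d K" "bermudan_model m' d K"
    and mean: "integrable m' exp" "d * integral\<^sup>L m' exp \<le> 1" and "0 \<le> \<epsilon>"
    and step: "\<And>n x. 0 \<le> x \<Longrightarrow> d * (\<integral>y. bermudan_put m d K n (x * exp y) \<partial>m)
      \<le> d * (\<integral>y. bermudan_put m d K n (x * exp y) \<partial>m') + \<epsilon> * x"
    and "0 \<le> x"
  shows "bermudan_put m d K n x \<le> bermudan_put m' d K n x + real n * \<epsilon> * x"
  using \<open>0 \<le> x\<close>
proof (induction n arbitrary: x)
  case (Suc n)
  interpret m: bermudan_model m d K by fact
  interpret m': bermudan_model m' d K by fact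
  have "(\<integral>y. m.V n (x * exp y) \<partial>m') \<le> (\<integral>y. m'.V n (x * exp y) + real n * \<epsilon> * x * exp y \<partial>m')"
    using Suc mean
    by (intro integral_mono m.integrable_bermudan_put[OF m'.prob_space_axioms m'.sets_law]
        Bochner_Integration.integrable_add m'.integrable_continuation integrable_mult_right)
      (auto simp: mult.assoc)
  also have "\<dots> = (\<integral>y. m'.V n (x * exp y) \<partial>m') + real n * \<epsilon> * x * integral\<^sup>L m' exp"
    using mean m'.integrable_continuation[OF Suc.prems] by simp
  finally have "d * (\<integral>y. m.V n (x * exp y) \<partial>m')
      \<le> d * ((\<integral>y. m'.V n (x * exp y) \<partial>m') + real n * \<epsilon> * x * integral\<^sup>L m' exp)"
    using m.discount(1) by (rule mult_left_mono)
  also have "\<dots> = d * (\<integral>y. m'.V n (x * exp y) \<partial>m') + real n * \<epsilon> * x * (d * integral\<^sup>L m' exp)"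
    by (simp add: algebra_simps)
  also have "\<dots> \<le> d * (\<integral>y. m'.V n (x * exp y) \<partial>m') + real n * \<epsilon> * x * 1"
    using mean(2) \<open>0 \<le> \<epsilon>\<close> Suc.prems by (intro add_left_mono mult_left_mono) auto
  finally have "d * (\<integral>y. m.V n (x * exp y) \<partial>m) \<le> d * (\<integral>y. m'.V n (x * exp y) \<partial>m') + real (Suc n) * \<epsilon> * x"
    using step[OF Suc.prems, of n] by (simp add: algebra_simps)
  moreover have "0 \<le> real (Suc n) * \<epsilon> * x" using \<open>0 \<le> \<epsilon>\<close> Suc.prems by simp
  ultimately show ?case unfolding bermudan_put.simps by (auto simp: max_def)
qed simp

section \<open>Optimal exercise on a time grid\<close>

locale filtered_levy_process = prob_space N + filtration "space N" F
  for N :: "'a measure" and F :: "real \<Rightarrow> 'a measure" +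
  fixes L :: "real \<Rightarrow> 'a \<Rightarrow> real" and \<mu> :: "real \<Rightarrow> real measure"
  assumes subalg: "subalgebra N (F s)"
    and adapted: "0 \<le> s \<Longrightarrow> L s \<in> borel_measurable (F s)"
    and start_zero: "\<omega> \<in> space N \<Longrightarrow> L 0 \<omega> = 0"
    and right_cont: "\<omega> \<in> space N \<Longrightarrow> 0 \<le> s \<Longrightarrow> continuous (at_right s) (\<lambda>u. L u \<omega>)"
    and prob_space_increment: "0 < h \<Longrightarrow> prob_space (\<mu> h)"
    and sets_increment: "sets (\<mu> h) = sets borel"
    and increment: "0 \<le> s \<Longrightarrow> 0 < h \<Longrightarrow> A \<in> sets (F s) \<Longrightarrow> D \<in> sets borel \<Longrightarrow>
      measure N (A \<inter> {\<omega>\<in>space N. L (s + h) \<omega> - L s \<omega> \<in> D}) = measure N A * measure (\<mu> h) D"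
begin

lemma borel_measurable_process: "0 \<le> s \<Longrightarrow> L s \<in> borel_measurable N"
  using measurable_from_subalg[OF subalg adapted] by blast

lemma increment_measurable:
  "0 \<le> s \<Longrightarrow> 0 < h \<Longrightarrow> (\<lambda>\<omega>. L (s + h) \<omega> - L s \<omega>) \<in> borel_measurable N"
  by (intro borel_measurable_diff borel_measurable_process) auto

lemma pair_increment_measurable:
  assumes "0 \<le> s" "0 < h"
  shows "(\<lambda>\<omega>. (\<omega>, L (s + h) \<omega> - L s \<omega>)) \<in> measurable N (F s \<Otimes>\<^sub>M borel)"
  using measurable_from_subalg[OF subalg measurable_ident[of "F s"]] increment_measurable[OF assms]
  by (intro measurable_Pair) (simp_all add: id_def)

lemma joint_law_increment:
  assumes s: "0 \<le> s" and h: "0 < h"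
  shows "restr_to_subalg N (F s) \<Otimes>\<^sub>M \<mu> h = distr N (F s \<Otimes>\<^sub>M borel) (\<lambda>\<omega>. (\<omega>, L (s + h) \<omega> - L s \<omega>))"
proof (rule pair_measure_eqI)
  interpret \<mu>: prob_space "\<mu> h" using h by (rule prob_space_increment)
  interpret R: prob_space "restr_to_subalg N (F s)"
    by (rule prob_space_restr_to_subalg[OF subalg prob_space_axioms])
  show "sigma_finite_measure (restr_to_subalg N (F s))" "sigma_finite_measure (\<mu> h)" by unfold_locales
  show "sets (restr_to_subalg N (F s) \<Otimes>\<^sub>M \<mu> h)
      = sets (distr N (F s \<Otimes>\<^sub>M borel) (\<lambda>\<omega>. (\<omega>, L (s + h) \<omega> - L s \<omega>)))"
    by (simp add: sets_restr_to_subalg[OF subalg] sets_increment cong: sets_pair_measure_cong)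
  fix A D assume "A \<in> sets (restr_to_subalg N (F s))" "D \<in> sets (\<mu> h)"
  then have A: "A \<in> sets (F s)" and D: "D \<in> sets borel"
    by (auto simp: sets_restr_to_subalg[OF subalg] sets_increment)
  have "A \<subseteq> space N" using sets.sets_into_space[OF A] by (simp add: space_F)
  then have "(\<lambda>\<omega>. (\<omega>, L (s + h) \<omega> - L s \<omega>)) -` (A \<times> D) \<inter> space N
      = A \<inter> {\<omega>\<in>space N. L (s + h) \<omega> - L s \<omega> \<in> D}" by auto
  then have "emeasure (distr N (F s \<Otimes>\<^sub>M borel) (\<lambda>\<omega>. (\<omega>, L (s + h) \<omega> - L s \<omega>))) (A \<times> D)
      = ennreal (measure N A * measure (\<mu> h) D)"
    using A D increment[OF s h A D]
    by (subst emeasure_distr[OF pair_increment_measurable[OF s h]]) (auto simp: emeasure_eq_measure)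
  then show "emeasure (restr_to_subalg N (F s)) A * emeasure (\<mu> h) D
      = emeasure (distr N (F s \<Otimes>\<^sub>M borel) (\<lambda>\<omega>. (\<omega>, L (s + h) \<omega> - L s \<omega>))) (A \<times> D)"
    using A
    by (simp add: emeasure_restr_to_subalg[OF subalg] emeasure_eq_measure \<mu>.emeasure_eq_measure ennreal_mult)
qed

lemma markov_property:
  fixes \<phi> :: "real \<Rightarrow> real"
  assumes s: "0 \<le> s" and h: "0 < h" and A [measurable]: "A \<in> sets (F s)"
    and [measurable]: "\<phi> \<in> borel_measurable borel" and bound: "\<And>y. \<bar>\<phi> y\<bar> \<le> C"
  shows "(\<integral>\<omega>. indicator A \<omega> * \<phi> (L (s + h) \<omega>) \<partial>N)
    = (\<integral>\<omega>. indicator A \<omega> * (\<integral>y. \<phi> (L s \<omega> + y) \<partial>\<mu> h) \<partial>N)"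
proof -
  interpret \<mu>: prob_space "\<mu> h" using h by (rule prob_space_increment)
  interpret R: prob_space "restr_to_subalg N (F s)"
    by (rule prob_space_restr_to_subalg[OF subalg prob_space_axioms])
  interpret P: pair_prob_space "restr_to_subalg N (F s)" "\<mu> h" by unfold_locales
  note [measurable_cong] = sets_increment sets_restr_to_subalg[OF subalg]
  have [measurable]: "L s \<in> borel_measurable (F s)" using s by (rule adapted)
  define \<Phi> where "\<Phi> = (\<lambda>(\<omega>, y). indicator A \<omega> * \<phi> (L s \<omega> + y))"
  have [measurable]: "\<Phi> \<in> borel_measurable (F s \<Otimes>\<^sub>M borel)" unfolding \<Phi>_def by measurable
  have "0 \<le> C" using bound[of 0] by linarith
  then have int: "integrable (restr_to_subalg N (F s) \<Otimes>\<^sub>M \<mu> h) \<Phi>"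
    by (intro P.integrable_const_bound[where B=C])
      (auto simp: \<Phi>_def indicator_def bound split: prod.splits)
  have "(\<integral>\<omega>. indicator A \<omega> * \<phi> (L (s + h) \<omega>) \<partial>N) = (\<integral>\<omega>. \<Phi> (\<omega>, L (s + h) \<omega> - L s \<omega>) \<partial>N)"
    by (simp add: \<Phi>_def)
  also have "\<dots> = integral\<^sup>L (restr_to_subalg N (F s) \<Otimes>\<^sub>M \<mu> h) \<Phi>"
    unfolding joint_law_increment[OF s h]
    by (subst integral_distr[OF pair_increment_measurable[OF s h]]) auto
  also have "\<dots> = (\<integral>\<omega>. (\<integral>y. \<Phi> (\<omega>, y) \<partial>\<mu> h) \<partial>restr_to_subalg N (F s))"
    by (rule P.integral_fst'[OF int, symmetric])
  also have "\<dots> = (\<integral>\<omega>. (\<integral>y. \<Phi> (\<omega>, y) \<partial>\<mu> h) \<partial>N)"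
    by (rule integral_subalgebra2[OF subalg]) measurable
  finally show ?thesis by (simp add: \<Phi>_def)
qed

end

locale put_on_levy_process = filtered_levy_process +
  fixes r K x :: real
  assumes r_nonneg: "0 \<le> r" and K_nonneg: "0 \<le> K" and x_nonneg: "0 \<le> x"
begin

definition payoff :: "real \<Rightarrow> 'a \<Rightarrow> real" where
  "payoff s \<omega> = exp (- r * s) * max 0 (K - x * exp (L s \<omega>))"

lemma discount_mult_bounds:
  assumes "0 \<le> s" "0 \<le> p" "p \<le> K"
  shows "0 \<le> exp (- r * s) * p" "exp (- r * s) * p \<le> K"
proof -
  have "exp (- r * s) * p \<le> 1 * K" using assms r_nonneg by (intro mult_mono) auto
  then show "exp (- r * s) * p \<le> K" by simp
qed (use assms in auto)

lemma payoff_bounds: "0 \<le> s \<Longrightarrow> 0 \<le> payoff s \<omega>" "0 \<le> s \<Longrightarrow> payoff s \<omega> \<le> K"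
  unfolding payoff_def by (rule discount_mult_bounds; use K_nonneg x_nonneg in simp)+

lemma borel_measurable_payoff:
  assumes "0 \<le> s"
  shows "payoff s \<in> borel_measurable (F s)"
proof -
  have [measurable]: "L s \<in> borel_measurable (F s)" using assms by (rule adapted)
  show ?thesis unfolding payoff_def by measurable
qed

lemma bermudan_model_increment: "0 < h \<Longrightarrow> bermudan_model (\<mu> h) (exp (- r * h)) K"
  using prob_space_increment sets_increment r_nonneg K_nonneg
  by (intro bermudan_model.intro bermudan_model_axioms.intro) auto

end

locale exercise_grid = put_on_levy_process +
  fixes h :: real and n :: nat
  assumes h_pos: "0 < h"
begin

sublocale step: bermudan_model "\<mu> h" "exp (- r * h)" K
  using h_pos by (rule bermudan_model_increment)

sublocale grid: filtration "space N" "\<lambda>k::nat. F (real k * h)"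
  by unfold_locales (use h_pos in \<open>auto simp: space_F intro!: sets_F_mono mult_right_mono\<close>)

definition snell :: "nat \<Rightarrow> 'a \<Rightarrow> real" where
  "snell k \<omega> = exp (- r * (real k * h)) * step.V (n - k) (x * exp (L (real k * h) \<omega>))"

definition continuation :: "nat \<Rightarrow> 'a \<Rightarrow> real" where
  "continuation k \<omega> = exp (- r * (real k * h)) * (exp (- r * h) *
     (\<integral>y. step.V (n - Suc k) (x * exp (L (real k * h) \<omega>) * exp y) \<partial>\<mu> h))"

lemma snell_eq_max: "k < n \<Longrightarrow> snell k \<omega> = max (payoff (real k * h) \<omega>) (continuation k \<omega>)"
  using Suc_diff_Suc[of k n, symmetric]
  by (simp add: snell_def continuation_def payoff_def max_mult_distrib_left)

lemma snell_last: "snell n \<omega> = payoff (real n * h) \<omega>"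
  by (simp add: snell_def payoff_def)

lemma snell_0: "\<omega> \<in> space N \<Longrightarrow> snell 0 \<omega> = step.V n x"
  by (simp add: snell_def start_zero)

lemma payoff_le_snell: "payoff (real k * h) \<omega> \<le> snell k \<omega>"
  unfolding payoff_def snell_def by (intro mult_left_mono bermudan_put_ge_payoff) simp

lemma snell_bounds: "0 \<le> snell k \<omega>" "snell k \<omega> \<le> K"
  unfolding snell_def
  by (intro discount_mult_bounds bermudan_put_nonneg step.bermudan_put_le_strike; use h_pos x_nonneg in simp)+

lemma grid_time_measurable: "L (real k * h) \<in> borel_measurable (F (real k * h))"
  using h_pos by (intro adapted) auto

lemma borel_measurable_snell: "snell k \<in> borel_measurable (F (real k * h))"
proof -
  note [measurable] = grid_time_measurable
  show ?thesis unfolding snell_def by measurable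
qed

lemma borel_measurable_snell_N [measurable]: "snell k \<in> borel_measurable N"
  by (rule measurable_from_subalg[OF subalg borel_measurable_snell])

lemma borel_measurable_payoff_grid: "payoff (real k * h) \<in> borel_measurable (F (real k * h))"
  using h_pos by (intro borel_measurable_payoff) auto

lemma borel_measurable_payoff_grid_N [measurable]: "payoff (real k * h) \<in> borel_measurable N"
  by (rule measurable_from_subalg[OF subalg borel_measurable_payoff_grid])

lemma integral_snell_Suc:
  assumes "k < n" and A: "A \<in> sets (F (real k * h))"
  shows "(\<integral>\<omega>. indicator A \<omega> * snell (Suc k) \<omega> \<partial>N) = (\<integral>\<omega>. indicator A \<omega> * continuation k \<omega> \<partial>N)"
proof -
  let ?c = "exp (- r * (real k * h)) * exp (- r * h)"
  have time: "real (Suc k) * h = real k * h + h" by (simp add: algebra_simps)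
  have "\<bar>step.V (n - Suc k) (x * exp y)\<bar> \<le> K" for y
    using x_nonneg by (intro step.abs_bermudan_put_le) simp
  moreover have "(\<lambda>y. step.V (n - Suc k) (x * exp y)) \<in> borel_measurable borel" by measurable
  ultimately have "(\<integral>\<omega>. indicator A \<omega> * step.V (n - Suc k) (x * exp (L (real k * h + h) \<omega>)) \<partial>N)
    = (\<integral>\<omega>. indicator A \<omega> * (\<integral>y. step.V (n - Suc k) (x * exp (L (real k * h) \<omega> + y)) \<partial>\<mu> h) \<partial>N)"
    using h_pos by (intro markov_property[where C=K and \<phi>="\<lambda>y. step.V (n - Suc k) (x * exp y)"] A) auto
  then have "?c * (\<integral>\<omega>. indicator A \<omega> * step.V (n - Suc k) (x * exp (L (real k * h + h) \<omega>)) \<partial>N)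
    = ?c * (\<integral>\<omega>. indicator A \<omega> * (\<integral>y. step.V (n - Suc k) (x * exp (L (real k * h) \<omega>) * exp y) \<partial>\<mu> h) \<partial>N)"
    by (simp add: exp_add mult.assoc)
  moreover have "exp (- r * (real (Suc k) * h)) = ?c"
    unfolding time by (simp add: exp_add[symmetric] algebra_simps)
  ultimately show ?thesis
    unfolding snell_def continuation_def time integral_mult_right_zero[symmetric]
    by (simp add: ac_simps)
qed

lemma measurable_grid_stopping_time:
  "stopping_time (\<lambda>k. F (real k * h)) i \<Longrightarrow> i \<in> measurable N (count_space UNIV)"
  using measurable_stopping_time[of "\<lambda>k. F (real k * h)" i N] subalg
  by (simp add: subalgebra_def space_F measurable_cong_sets[OF refl sets_borel_eq_count_space])

lemma integrable_snell_at:
  assumes "i \<in> measurable N (count_space UNIV)"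
  shows "integrable N (\<lambda>\<omega>. snell (i \<omega>) \<omega>)"
  using measurable_compose_countable[OF borel_measurable_snell_N assms] snell_bounds
  by (intro integrable_const_bound[where B=K]) auto

lemma integrable_indicator_snell: "A \<in> sets N \<Longrightarrow> integrable N (\<lambda>\<omega>. indicator A \<omega> * snell k \<omega>)"
  using snell_bounds[of k]
  by (intro integrable_const_bound[where B=K]) (auto simp: indicator_def intro: order_trans)

lemma integral_stopped_snell_Suc:
  assumes i: "stopping_time (\<lambda>k. F (real k * h)) i" and "k < n"
  defines "A \<equiv> {\<omega>\<in>space N. k < i \<omega>}"
  shows "(\<integral>\<omega>. snell (min (i \<omega>) (Suc k)) \<omega> \<partial>N) = (\<integral>\<omega>. snell (min (i \<omega>) k) \<omega> \<partial>N)
    + ((\<integral>\<omega>. indicator A \<omega> * continuation k \<omega> \<partial>N) - (\<integral>\<omega>. indicator A \<omega> * snell k \<omega> \<partial>N))"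
proof -
  have A: "A \<in> sets (F (real k * h))"
    using stopping_timeD2[OF i, of k] by (simp add: A_def pred_def space_F)
  then have AN: "A \<in> sets N" using subalg by (auto simp: subalgebra_def)
  have [measurable]: "i \<in> measurable N (count_space UNIV)" by (rule measurable_grid_stopping_time[OF i])
  have "(\<integral>\<omega>. snell (min (i \<omega>) (Suc k)) \<omega> \<partial>N)
      = (\<integral>\<omega>. snell (min (i \<omega>) k) \<omega> + (indicator A \<omega> * snell (Suc k) \<omega> - indicator A \<omega> * snell k \<omega>) \<partial>N)"
    by (rule Bochner_Integration.integral_cong) (auto simp: A_def indicator_def min_def le_Suc_eq)
  also have "\<dots> = (\<integral>\<omega>. snell (min (i \<omega>) k) \<omega> \<partial>N)
      + ((\<integral>\<omega>. indicator A \<omega> * snell (Suc k) \<omega> \<partial>N) - (\<integral>\<omega>. indicator A \<omega> * snell k \<omega> \<partial>N))"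
    using integrable_snell_at[of "\<lambda>\<omega>. min (i \<omega>) k"] integrable_indicator_snell[OF AN] by simp
  finally show ?thesis unfolding integral_snell_Suc[OF \<open>k < n\<close> A] .
qed

lemma integral_stopped_snell:
  assumes i: "stopping_time (\<lambda>k. F (real k * h)) i" and "k \<le> n"
  shows "(\<integral>\<omega>. snell (min (i \<omega>) k) \<omega> \<partial>N) = step.V n x
    + (\<Sum>j<k. (\<integral>\<omega>. indicator {\<omega>\<in>space N. j < i \<omega>} \<omega> * continuation j \<omega> \<partial>N)
        - (\<integral>\<omega>. indicator {\<omega>\<in>space N. j < i \<omega>} \<omega> * snell j \<omega> \<partial>N))"
  using \<open>k \<le> n\<close>
proof (induction k)
  case 0
  show ?case by (simp add: snell_0 prob_space cong: Bochner_Integration.integral_cong)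
next
  case (Suc k)
  then show ?case using integral_stopped_snell_Suc[OF i, of k] by simp
qed

lemma expectation_exercise_le:
  assumes i: "stopping_time (\<lambda>k. F (real k * h)) i" and "\<And>\<omega>. \<omega> \<in> space N \<Longrightarrow> i \<omega> \<le> n"
  shows "(\<integral>\<omega>. payoff (real (i \<omega>) * h) \<omega> \<partial>N) \<le> step.V n x"
proof -
  note [measurable] = measurable_grid_stopping_time[OF i]
  have "(\<integral>\<omega>. payoff (real (i \<omega>) * h) \<omega> \<partial>N) \<le> (\<integral>\<omega>. snell (min (i \<omega>) n) \<omega> \<partial>N)"
    using assms(2) integrable_snell_at[of "\<lambda>\<omega>. min (i \<omega>) n"]
    by (intro integral_mono') (auto simp: min_absorb1 payoff_le_snell snell_bounds)
  also have "\<dots> \<le> step.V n x + 0"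
    unfolding integral_stopped_snell[OF i order_refl]
  proof (intro add_left_mono sum_nonpos)
    fix k assume "k \<in> {..<n}"
    then have "(\<integral>\<omega>. indicator {\<omega>\<in>space N. k < i \<omega>} \<omega> * continuation k \<omega> \<partial>N)
        \<le> (\<integral>\<omega>. indicator {\<omega>\<in>space N. k < i \<omega>} \<omega> * snell k \<omega> \<partial>N)"
      by (intro integral_mono' integrable_indicator_snell mult_left_mono mult_nonneg_nonneg snell_bounds)
        (auto simp: snell_eq_max)
    then show "(\<integral>\<omega>. indicator {\<omega>\<in>space N. k < i \<omega>} \<omega> * continuation k \<omega> \<partial>N)
        - (\<integral>\<omega>. indicator {\<omega>\<in>space N. k < i \<omega>} \<omega> * snell k \<omega> \<partial>N) \<le> 0" by simp
  qed
  finally show ?thesis by simp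
qed

lemma ex_optimal_exercise:
  "\<exists>i. stopping_time (\<lambda>k. F (real k * h)) i \<and> (\<forall>\<omega>. i \<omega> \<le> n) \<and>
     (\<integral>\<omega>. payoff (real (i \<omega>) * h) \<omega> \<partial>N) = step.V n x"
proof -
  define i where "i \<omega> = (LEAST k. snell k \<omega> = payoff (real k * h) \<omega>)" for \<omega>
  have exercise: "snell (i \<omega>) \<omega> = payoff (real (i \<omega>) * h) \<omega>" and before_end: "i \<omega> \<le> n" for \<omega>
    unfolding i_def by (rule LeastI Least_le, rule snell_last)+
  have wait: "snell k \<omega> = continuation k \<omega>" if "k < i \<omega>" for k \<omega>
    using that before_end[of \<omega>] not_less_Least[of k "\<lambda>k. snell k \<omega> = payoff (real k * h) \<omega>"] snell_eq_max[of k \<omega>]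
    by (auto simp: i_def max_def split: if_splits)
  have i: "stopping_time (\<lambda>k. F (real k * h)) i"
  proof (rule stopping_timeI)
    fix k
    have "Measurable.pred (F (real k * h)) (\<lambda>\<omega>. \<exists>l\<in>{..k}. snell l \<omega> = payoff (real l * h) \<omega>)"
    proof (intro pred_intros_finite)
      fix l assume "l \<in> {..k}"
      then have "sets (F (real l * h)) \<subseteq> sets (F (real k * h))" by (intro grid.sets_F_mono) simp
      then have "subalgebra (F (real k * h)) (F (real l * h))" by (simp add: subalgebra_def space_F)
      note [measurable] = measurable_from_subalg[OF this borel_measurable_snell]
        measurable_from_subalg[OF this borel_measurable_payoff_grid]
      show "Measurable.pred (F (real k * h)) (\<lambda>\<omega>. snell l \<omega> = payoff (real l * h) \<omega>)" by measurable
    qed simp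
    also have "(\<lambda>\<omega>. \<exists>l\<in>{..k}. snell l \<omega> = payoff (real l * h) \<omega>) = (\<lambda>\<omega>. i \<omega> \<le> k)"
      using exercise by (auto simp: fun_eq_iff i_def intro: Least_le le_trans)
    finally show "Measurable.pred (F (real k * h)) (\<lambda>\<omega>. i \<omega> \<le> k)" .
  qed
  have "(\<integral>\<omega>. indicator {\<omega>\<in>space N. k < i \<omega>} \<omega> * continuation k \<omega> \<partial>N)
      = (\<integral>\<omega>. indicator {\<omega>\<in>space N. k < i \<omega>} \<omega> * snell k \<omega> \<partial>N)" for k
    by (rule Bochner_Integration.integral_cong) (auto simp: indicator_def wait)
  then have "(\<integral>\<omega>. snell (min (i \<omega>) n) \<omega> \<partial>N) = step.V n x"
    by (simp add: integral_stopped_snell[OF i order_refl])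
  then show ?thesis using i before_end exercise by (intro exI[of _ i]) (auto simp: min_absorb1)
qed

end

section \<open>American puts as limits of Bermudan puts\<close>

definition bermudan_price :: "(real \<Rightarrow> real measure) \<Rightarrow> real \<Rightarrow> real \<Rightarrow> real \<Rightarrow> nat \<Rightarrow> real \<Rightarrow> real" where
  "bermudan_price \<mu> r K \<theta> n = bermudan_put (\<mu> (\<theta> / real n)) (exp (- r * (\<theta> / real n))) K n"

lemma nat_ceiling_divide_mult_bounds:
  fixes s h :: real
  assumes "0 \<le> s" "0 < h"
  shows "s \<le> real (nat \<lceil>s / h\<rceil>) * h" "real (nat \<lceil>s / h\<rceil>) * h \<le> s + h"
proof -
  have "s / h \<le> real (nat \<lceil>s / h\<rceil>)" by (rule real_nat_ceiling_ge)
  then show "s \<le> real (nat \<lceil>s / h\<rceil>) * h" by (simp only: pos_divide_le_eq[OF assms(2)])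
  have "0 \<le> s / h" using assms by simp
  then have "real (nat \<lceil>s / h\<rceil>) \<le> s / h + 1" by linarith
  then have "real (nat \<lceil>s / h\<rceil>) * h \<le> (s / h + 1) * h" using assms by (intro mult_right_mono) auto
  then show "real (nat \<lceil>s / h\<rceil>) * h \<le> s + h" using assms by (simp add: algebra_simps)
qed

context filtered_levy_process
begin

lemma stopping_time_grid_ceiling:
  assumes \<tau>: "stopping_time F \<tau>" and h: "0 < h"
  shows "stopping_time (\<lambda>k. F (real k * h)) (\<lambda>\<omega>. nat \<lceil>\<tau> \<omega> / h\<rceil>)"
proof (rule stopping_timeI)
  fix k
  have "nat \<lceil>\<tau> \<omega> / h\<rceil> \<le> k \<longleftrightarrow> \<tau> \<omega> \<le> real k * h" for \<omega>
    using h by (simp add: nat_ceiling_le_eq pos_divide_le_eq)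
  then show "Measurable.pred (F (real k * h)) (\<lambda>\<omega>. nat \<lceil>\<tau> \<omega> / h\<rceil> \<le> k)"
    using stopping_timeD[OF \<tau>] by simp
qed

lemma stopping_time_grid_mult:
  assumes i: "stopping_time (\<lambda>k. F (real k * h)) i" and h: "0 < h"
  shows "stopping_time F (\<lambda>\<omega>. real (i \<omega>) * h)"
proof (rule stopping_timeI)
  fix t
  show "Measurable.pred (F t) (\<lambda>\<omega>. real (i \<omega>) * h \<le> t)"
  proof (cases "0 \<le> t")
    case True
    define k where "k = nat \<lfloor>t / h\<rfloor>"
    have "real k \<le> t / h" using True h by (simp add: k_def)
    then have "real k * h \<le> t" using h by (simp add: field_simps)
    then have "sets (F (real k * h)) \<subseteq> sets (F t)" by (rule sets_F_mono)
    then have "Measurable.pred (F t) (\<lambda>\<omega>. i \<omega> \<le> k)"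
      using stopping_timeD[OF i, of k] by (auto simp: pred_def space_F)
    moreover have "real (i \<omega>) * h \<le> t \<longleftrightarrow> i \<omega> \<le> k" for \<omega>
      using True h by (simp add: k_def le_nat_iff le_floor_iff pos_le_divide_eq)
    ultimately show ?thesis by simp
  next
    case False
    then have "\<not> real (i \<omega>) * h \<le> t" for \<omega>
      using mult_nonneg_nonneg[of "real (i \<omega>)" h] h by linarith
    then show ?thesis by simp
  qed
qed

end

lemma continuous_at_right_tendsto_compose:
  fixes f :: "real \<Rightarrow> 'b::topological_space"
  assumes "continuous (at_right s) f" "t \<longlonglongrightarrow> s" "\<And>n. s \<le> t n"
  shows "(\<lambda>n. f (t n)) \<longlonglongrightarrow> f s"
proof -
  have "continuous (at s within {s..}) f" using assms(1) by (simp add: at_within_Ici_at_right)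
  then show ?thesis by (rule continuous_within_tendsto_compose') (use assms in auto)
qed

context put_on_levy_process
begin

lemma payoff_tendsto_from_right:
  assumes "\<omega> \<in> space N" "0 \<le> s" "t \<longlonglongrightarrow> s" "\<And>n. s \<le> t n"
  shows "(\<lambda>n. payoff (t n) \<omega>) \<longlonglongrightarrow> payoff s \<omega>"
  unfolding payoff_def
  using assms by (intro tendsto_intros continuous_at_right_tendsto_compose[of s "\<lambda>u. L u \<omega>"] right_cont)

context
  fixes \<tau> :: "'a \<Rightarrow> real" and h :: "nat \<Rightarrow> real"
  assumes \<tau>: "stopping_time F \<tau>" and \<tau>_nonneg: "\<And>\<omega>. \<omega> \<in> space N \<Longrightarrow> 0 \<le> \<tau> \<omega>"
    and mesh_pos: "\<And>n. 0 < h n" and mesh_tendsto: "h \<longlonglongrightarrow> 0"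
begin

definition grid_payoff :: "nat \<Rightarrow> 'a \<Rightarrow> real" where
  "grid_payoff n \<omega> = payoff (real (nat \<lceil>\<tau> \<omega> / h n\<rceil>) * h n) \<omega>"

lemma grid_payoff_tendsto:
  assumes \<omega>: "\<omega> \<in> space N"
  shows "(\<lambda>n. grid_payoff n \<omega>) \<longlonglongrightarrow> payoff (\<tau> \<omega>) \<omega>"
proof -
  note bounds = nat_ceiling_divide_mult_bounds[OF \<tau>_nonneg[OF \<omega>] mesh_pos]
  have upper: "(\<lambda>n. \<tau> \<omega> + h n) \<longlonglongrightarrow> \<tau> \<omega>" using tendsto_add[OF tendsto_const mesh_tendsto] by simp
  have "(\<lambda>n. real (nat \<lceil>\<tau> \<omega> / h n\<rceil>) * h n) \<longlonglongrightarrow> \<tau> \<omega>"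
    by (rule tendsto_sandwich[OF _ _ tendsto_const upper]) (simp_all only: bounds eventually_True)
  then show ?thesis
    unfolding grid_payoff_def by (rule payoff_tendsto_from_right[OF \<omega> \<tau>_nonneg[OF \<omega>]]) (rule bounds)
qed

lemma borel_measurable_grid_payoff: "grid_payoff n \<in> borel_measurable N"
proof -
  interpret exercise_grid N F L \<mu> r K x "h n" 0 by unfold_locales (rule mesh_pos)
  have "(\<lambda>\<omega>. nat \<lceil>\<tau> \<omega> / h n\<rceil>) \<in> measurable N (count_space UNIV)"
    by (rule measurable_grid_stopping_time[OF stopping_time_grid_ceiling[OF \<tau> mesh_pos]])
  from measurable_compose_countable[OF borel_measurable_payoff_grid_N this] show ?thesis
    by (simp add: grid_payoff_def[abs_def])
qed

lemma borel_measurable_payoff_at: "(\<lambda>\<omega>. payoff (\<tau> \<omega>) \<omega>) \<in> borel_measurable N"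
  using borel_measurable_grid_payoff grid_payoff_tendsto by (rule borel_measurable_LIMSEQ_metric)

lemma expectation_grid_payoff_tendsto:
  "(\<lambda>n. \<integral>\<omega>. grid_payoff n \<omega> \<partial>N) \<longlonglongrightarrow> (\<integral>\<omega>. payoff (\<tau> \<omega>) \<omega> \<partial>N)"
proof (rule integral_dominated_convergence[where w="\<lambda>_. K"])
  have "0 \<le> real (nat \<lceil>\<tau> \<omega> / h n\<rceil>) * h n" for n \<omega> using mesh_pos[of n] by simp
  then show "AE \<omega> in N. norm (grid_payoff n \<omega>) \<le> K" for n
    using payoff_bounds by (simp add: grid_payoff_def)
qed (use grid_payoff_tendsto borel_measurable_grid_payoff borel_measurable_payoff_at in auto)

lemma expectation_payoff_le_strike: "(\<integral>\<omega>. payoff (\<tau> \<omega>) \<omega> \<partial>N) \<le> K"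
  using payoff_bounds \<tau>_nonneg
  by (intro integral_le_const integrable_const_bound[where B=K] borel_measurable_payoff_at AE_I2) simp_all

lemma expectation_grid_payoff_le:
  assumes "\<And>\<omega>. \<omega> \<in> space N \<Longrightarrow> \<tau> \<omega> \<le> real k * h n"
  shows "(\<integral>\<omega>. grid_payoff n \<omega> \<partial>N) \<le> bermudan_put (\<mu> (h n)) (exp (- r * h n)) K k x"
proof -
  interpret exercise_grid N F L \<mu> r K x "h n" k by unfold_locales (rule mesh_pos)
  have "nat \<lceil>\<tau> \<omega> / h n\<rceil> \<le> k" if "\<omega> \<in> space N" for \<omega>
    using assms[OF that] mesh_pos[of n] by (simp add: nat_ceiling_le_eq pos_divide_le_eq)
  from expectation_exercise_le[OF stopping_time_grid_ceiling[OF \<tau> mesh_pos] this] show ?thesis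
    by (simp add: grid_payoff_def)
qed

end

lemma ex_stopping_time_bermudan_price:
  assumes \<theta>: "0 < \<theta>" and n: "0 < n"
  shows "\<exists>\<tau>. stopping_time F \<tau> \<and> (\<forall>\<omega>. 0 \<le> \<tau> \<omega> \<and> \<tau> \<omega> \<le> \<theta>) \<and>
    (\<integral>\<omega>. payoff (\<tau> \<omega>) \<omega> \<partial>N) = bermudan_price \<mu> r K \<theta> n x"
proof -
  define h where "h = \<theta> / real n"
  have h: "0 < h" "real n * h = \<theta>" using \<theta> n by (simp_all add: h_def)
  interpret exercise_grid N F L \<mu> r K x h n by unfold_locales (rule h)
  obtain i where i: "stopping_time (\<lambda>k. F (real k * h)) i" and before_end: "\<And>\<omega>. i \<omega> \<le> n"
    and optimal: "(\<integral>\<omega>. payoff (real (i \<omega>) * h) \<omega> \<partial>N) = step.V n x"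
    using ex_optimal_exercise by blast
  have "0 \<le> real (i \<omega>) * h \<and> real (i \<omega>) * h \<le> \<theta>" for \<omega>
    using before_end[of \<omega>] h mult_right_mono[of "real (i \<omega>)" "real n" h] by simp
  then show ?thesis
    using stopping_time_grid_mult[OF i h(1)] optimal unfolding bermudan_price_def h_def by blast
qed

end

locale american_put_model = put_on_levy_process "completion M" F L \<mu> r K x
  for M :: "'a measure" and F L \<mu> r K x +
  fixes T t :: real
  assumes before_maturity: "t < T"
begin

abbreviation american_price :: real where
  "american_price \<equiv> american_put M F (\<lambda>x s \<omega>. x * exp (L s \<omega>)) r K T t x"

definition exercise_times :: "('a \<Rightarrow> real) set" where
  "exercise_times = {\<tau>. stopping_time F \<tau> \<and> (\<forall>\<omega>\<in>space M. 0 \<le> \<tau> \<omega> \<and> \<tau> \<omega> \<le> T - t)}"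

lemma american_price_eq: "american_price = (SUP \<tau>\<in>exercise_times. \<integral>\<omega>. payoff (\<tau> \<omega>) \<omega> \<partial>completion M)"
  by (simp add: american_put_def exercise_times_def payoff_def)

lemma expectation_payoff_bdd_above:
  "bdd_above ((\<lambda>\<tau>. \<integral>\<omega>. payoff (\<tau> \<omega>) \<omega> \<partial>completion M) ` exercise_times)"
proof (rule bdd_aboveI2)
  fix \<tau> assume "\<tau> \<in> exercise_times"
  then show "(\<integral>\<omega>. payoff (\<tau> \<omega>) \<omega> \<partial>completion M) \<le> K"
    by (intro expectation_payoff_le_strike[OF _ _ _ LIMSEQ_inverse_real_of_nat]) (auto simp: exercise_times_def)
qed

theorem bermudan_price_le_american_price:
  assumes "0 < n"
  shows "bermudan_price \<mu> r K (T - t) n x \<le> american_price"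
proof -
  obtain \<tau> where "\<tau> \<in> exercise_times"
    and "(\<integral>\<omega>. payoff (\<tau> \<omega>) \<omega> \<partial>completion M) = bermudan_price \<mu> r K (T - t) n x"
    using ex_stopping_time_bermudan_price[of "T - t" n] before_maturity assms
    by (auto simp: exercise_times_def)
  then show ?thesis
    unfolding american_price_eq by (intro cSUP_upper2[OF expectation_payoff_bdd_above]) auto
qed

theorem bermudan_price_tendsto_american_price:
  "(\<lambda>n. bermudan_price \<mu> r K (T - t) n x) \<longlonglongrightarrow> american_price"
proof (rule order_tendstoI)
  fix c assume "american_price < c"
  then show "eventually (\<lambda>n. bermudan_price \<mu> r K (T - t) n x < c) sequentially"
    using bermudan_price_le_american_price
    by (intro eventually_mono[OF eventually_gt_at_top[of 0]]) (auto intro: le_less_trans)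
next
  fix c assume c: "c < american_price"
  have "exercise_times \<noteq> {}"
    using ex_stopping_time_bermudan_price[of "T - t" 1] before_maturity by (auto simp: exercise_times_def)
  then obtain \<tau> where \<tau>: "\<tau> \<in> exercise_times" and less: "c < (\<integral>\<omega>. payoff (\<tau> \<omega>) \<omega> \<partial>completion M)"
    using c expectation_payoff_bdd_above unfolding american_price_eq by (auto simp: less_cSUP_iff)
  let ?h = "\<lambda>n. (T - t) / real (Suc n)"
  have grid: "stopping_time F \<tau>" "\<And>\<omega>. \<omega> \<in> space (completion M) \<Longrightarrow> 0 \<le> \<tau> \<omega>" "\<And>n. 0 < ?h n" "?h \<longlonglongrightarrow> 0"
    using \<tau> before_maturity LIMSEQ_Suc[OF lim_const_over_n[of "T - t"]] by (auto simp: exercise_times_def)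
  have "eventually (\<lambda>n. c < (\<integral>\<omega>. grid_payoff \<tau> ?h n \<omega> \<partial>completion M)) sequentially"
    using expectation_grid_payoff_tendsto[OF grid] less by (rule order_tendstoD)
  moreover have "(\<integral>\<omega>. grid_payoff \<tau> ?h n \<omega> \<partial>completion M) \<le> bermudan_price \<mu> r K (T - t) (Suc n) x" for n
    using expectation_grid_payoff_le[OF grid, of "Suc n" n] \<tau>
    by (simp add: bermudan_price_def exercise_times_def del: of_nat_Suc bermudan_put.simps)
  ultimately have "eventually (\<lambda>n. c < bermudan_price \<mu> r K (T - t) (Suc n) x) sequentially"
    by (auto elim!: eventually_mono intro: less_le_trans)
  then show "eventually (\<lambda>n. c < bermudan_price \<mu> r K (T - t) n x) sequentially"
    by (subst (asm) eventually_sequentially_Suc)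
qed

end

section \<open>Increments and the usual filtration\<close>

lemma sigma_sets_null_sets_approx:
  assumes G: "G \<subseteq> sets M" and A: "A \<in> sigma_sets (space M) (G \<union> null_sets (completion M))"
  shows "\<exists>A0\<in>sigma_sets (space M) G. (A - A0) \<union> (A0 - A) \<in> null_sets (completion M)"
  using A
proof (induction rule: sigma_sets.induct)
  case (Basic a)
  then show ?case
  proof
    assume "a \<in> G"
    then show ?thesis by (intro bexI[of _ a]) (auto intro: sigma_sets.Basic)
  next
    assume "a \<in> null_sets (completion M)"
    then show ?thesis by (intro bexI[of _ "{}"]) (auto intro: sigma_sets.Empty)
  qed
next
  case Empty
  then show ?case by (intro bexI[of _ "{}"]) (auto intro: sigma_sets.Empty)
next
  case (Compl a)
  then obtain A0 where A0: "A0 \<in> sigma_sets (space M) G" "(a - A0) \<union> (A0 - a) \<in> null_sets (completion M)"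
    by auto
  have "A0 \<in> sets M" using sets.sigma_sets_subset[OF G] A0(1) by auto
  then have sub: "A0 \<subseteq> space M" by (rule sets.sets_into_space)
  have "a - A0 \<subseteq> space M"
    using A0(2) sets.sets_into_space[of _ "completion M"] by (metis null_setsD2 space_completion le_sup_iff)
  then have "((space M - a) - (space M - A0)) \<union> ((space M - A0) - (space M - a)) = (a - A0) \<union> (A0 - a)"
    using sub by auto
  then show ?case using A0 by (intro bexI[of _ "space M - A0"]) (auto intro: sigma_sets.Compl)
next
  case (Union a)
  then obtain A0 where A0: "\<And>i. A0 i \<in> sigma_sets (space M) G"
    and null: "\<And>i. (a i - A0 i) \<union> (A0 i - a i) \<in> null_sets (completion M)"
    by metis
  have "((\<Union>i. a i) - (\<Union>i. A0 i)) \<union> ((\<Union>i. A0 i) - (\<Union>i. a i)) \<subseteq> (\<Union>i. (a i - A0 i) \<union> (A0 i - a i))"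
    by auto
  from null_sets_completion_subset[OF this null_sets_UN[OF null]] show ?case
    using A0 by (intro bexI[of _ "\<Union>i. A0 i"]) (auto intro: sigma_sets.Union)
qed

lemma (in prob_space) indep_vars_last:
  assumes Y: "indep_vars (\<lambda>_. borel) Y {..<Suc n}"
    and A: "A \<in> sets (PiM {..<n} (\<lambda>_. borel))" and D: "D \<in> sets borel"
  shows "prob ({\<omega>\<in>space M. restrict (\<lambda>i. Y i \<omega>) {..<n} \<in> A} \<inter> {\<omega>\<in>space M. Y n \<omega> \<in> D})
    = prob {\<omega>\<in>space M. restrict (\<lambda>i. Y i \<omega>) {..<n} \<in> A} * prob {\<omega>\<in>space M. Y n \<omega> \<in> D}"
proof -
  have "indep_var (PiM {..<n} (\<lambda>_. borel)) (\<lambda>\<omega>. restrict (\<lambda>i. Y i \<omega>) {..<n})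
      (PiM {n} (\<lambda>_. borel)) (\<lambda>\<omega>. restrict (\<lambda>i. Y i \<omega>) {n})"
    using Y by (rule indep_var_restrict) auto
  moreover have "{f\<in>space (PiM {n} (\<lambda>_. borel)). f n \<in> D} \<in> sets (PiM {n} (\<lambda>_. borel))"
    using D by (auto intro!: measurable_sets_Collect[where N=borel] measurable_component_singleton)
  ultimately show ?thesis
    using indep_varD A by (fastforce simp: space_PiM vimage_def Int_def conj_ac)
qed

lemma (in prob_space) distr_uniform_measure_eq_iff:
  fixes Y :: "'a \<Rightarrow> real"
  assumes A: "A \<in> events" "prob A \<noteq> 0" and Y: "random_variable borel Y"
  shows "distr (uniform_measure M A) borel Y = distr M borel Y \<longleftrightarrow>
    (\<forall>D\<in>sets borel. prob (A \<inter> {\<omega>\<in>space M. Y \<omega> \<in> D}) = prob A * prob {\<omega>\<in>space M. Y \<omega> \<in> D})"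
proof -
  have "emeasure M A \<noteq> 0" using A by (simp add: emeasure_eq_measure)
  then interpret Q: prob_space "uniform_measure M A" by (intro prob_space_uniform_measure) auto
  have Y': "Y \<in> borel_measurable (uniform_measure M A)" using Y by simp
  interpret QY: prob_space "distr (uniform_measure M A) borel Y" using Y' by (rule Q.prob_space_distr)
  interpret MY: prob_space "distr M borel Y" using Y by (rule prob_space_distr)
  have "measure (distr (uniform_measure M A) borel Y) D = prob (A \<inter> {\<omega>\<in>space M. Y \<omega> \<in> D}) / prob A"
    and "measure (distr M borel Y) D = prob {\<omega>\<in>space M. Y \<omega> \<in> D}" if D: "D \<in> sets borel" for D
  proof -
    have "Y -` D \<inter> space M = {\<omega>\<in>space M. Y \<omega> \<in> D}" by auto
    then show "measure (distr (uniform_measure M A) borel Y) D = prob (A \<inter> {\<omega>\<in>space M. Y \<omega> \<in> D}) / prob A"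
      "measure (distr M borel Y) D = prob {\<omega>\<in>space M. Y \<omega> \<in> D}"
      using D A Y measurable_sets[OF Y D] \<open>emeasure M A \<noteq> 0\<close>
      by (simp_all add: measure_distr[OF Y'] measure_distr[OF Y] measure_uniform_measure)
  qed
  note law = this
  have "distr (uniform_measure M A) borel Y = distr M borel Y \<longleftrightarrow>
    (\<forall>D\<in>sets borel. measure (distr (uniform_measure M A) borel Y) D = measure (distr M borel Y) D)"
    by (auto intro!: measure_eqI simp: QY.emeasure_eq_measure MY.emeasure_eq_measure)
  then show ?thesis using A(2) by (simp add: law field_simps)
qed

lemma char_distr_tendsto:
  assumes "prob_space N" and [measurable]: "\<And>n. Y n \<in> borel_measurable N" "Y' \<in> borel_measurable N"
    and lim: "\<And>\<omega>. \<omega> \<in> space N \<Longrightarrow> (\<lambda>n. Y n \<omega>) \<longlonglongrightarrow> Y' \<omega>"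
  shows "(\<lambda>n. char (distr N borel (Y n)) t) \<longlonglongrightarrow> char (distr N borel Y') t"
proof -
  interpret prob_space N by fact
  have "(\<lambda>n. CLINT \<omega>|N. iexp (t * Y n \<omega>)) \<longlonglongrightarrow> (CLINT \<omega>|N. iexp (t * Y' \<omega>))"
  proof (rule integral_dominated_convergence[where w="\<lambda>_. 1"])
    show "AE \<omega> in N. (\<lambda>n. iexp (t * Y n \<omega>)) \<longlonglongrightarrow> iexp (t * Y' \<omega>)"
      using lim by (intro AE_I2 tendsto_intros) auto
  qed auto
  then show ?thesis by (simp add: char_def integral_distr)
qed

lemma (in prob_space) indep_event_tendsto:
  fixes Y :: "nat \<Rightarrow> 'a \<Rightarrow> real"
  assumes A: "A \<in> events" and Y: "\<And>n. random_variable borel (Y n)" and Y': "random_variable borel Y'"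
    and lim: "\<And>\<omega>. \<omega> \<in> space M \<Longrightarrow> (\<lambda>n. Y n \<omega>) \<longlonglongrightarrow> Y' \<omega>"
    and indep: "\<And>n D. D \<in> sets borel \<Longrightarrow>
      prob (A \<inter> {\<omega>\<in>space M. Y n \<omega> \<in> D}) = prob A * prob {\<omega>\<in>space M. Y n \<omega> \<in> D}"
    and D: "D \<in> sets borel"
  shows "prob (A \<inter> {\<omega>\<in>space M. Y' \<omega> \<in> D}) = prob A * prob {\<omega>\<in>space M. Y' \<omega> \<in> D}"
proof (cases "prob A = 0")
  case True
  have "prob (A \<inter> {\<omega>\<in>space M. Y' \<omega> \<in> D}) \<le> prob A" using A by (intro finite_measure_mono) auto
  then show ?thesis using True by (simp add: measure_le_0_iff)
next
  case False
  let ?Q = "uniform_measure M A"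
  have "emeasure M A \<noteq> 0" using False by (simp add: emeasure_eq_measure)
  then interpret Q: prob_space ?Q by (intro prob_space_uniform_measure) auto
  have same_law: "distr ?Q borel (Y n) = distr M borel (Y n)" for n
    using distr_uniform_measure_eq_iff[OF A False Y] indep by blast
  have "char (distr ?Q borel Y') = char (distr M borel Y')"
  proof
    fix t
    have "(\<lambda>n. char (distr M borel (Y n)) t) \<longlonglongrightarrow> char (distr ?Q borel Y') t"
      unfolding same_law[symmetric] using Y Y' lim by (intro char_distr_tendsto Q.prob_space_axioms) auto
    moreover have "(\<lambda>n. char (distr M borel (Y n)) t) \<longlonglongrightarrow> char (distr M borel Y') t"
      using Y Y' lim by (intro char_distr_tendsto prob_space_axioms) auto
    ultimately show "char (distr ?Q borel Y') t = char (distr M borel Y') t" by (rule LIMSEQ_unique)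
  qed
  then have "distr ?Q borel Y' = distr M borel Y'"
    using Y' by (intro Levy_uniqueness Q.real_distribution_distr real_distribution_distr) auto
  then show ?thesis using distr_uniform_measure_eq_iff[OF A False Y'] D by blast
qed

locale real_process = prob_space M for M :: "'a measure" +
  fixes X :: "real \<Rightarrow> 'a \<Rightarrow> real"
  assumes process_measurable [measurable]: "X s \<in> borel_measurable M"
begin

lemma nat_gen_subset_events: "nat_gen M X u \<subseteq> events"
  unfolding nat_gen_def by (auto intro: measurable_sets_Collect)

definition augmented :: "real \<Rightarrow> 'a set set" where
  "augmented u = sigma_sets (space M) (nat_gen M X u \<union> null_sets (completion M))"

lemma generators_subset_completion: "nat_gen M X u \<union> null_sets (completion M) \<subseteq> sets (completion M)"
  using nat_gen_subset_events sets_completionI_sets by auto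

lemma generators_subset_Pow: "nat_gen M X u \<union> null_sets (completion M) \<subseteq> Pow (space M)"
  using order_trans[OF generators_subset_completion sets.space_closed] by simp

lemma augmented_subset: "augmented u \<subseteq> sets (completion M)"
  using sets.sigma_sets_subset[OF generators_subset_completion] by (simp add: augmented_def)

lemma sets_usual_filtration: "sets (usual_filtration M X t) = (\<Inter>u\<in>{t<..}. augmented u)"
proof -
  let ?I = "\<Inter>u\<in>{t<..}. augmented u"
  have "?I \<subseteq> augmented (t + 1)" by auto
  also have "\<dots> \<subseteq> Pow (space M)"
    using augmented_subset sets.space_closed[of "completion M"] by auto
  finally have "sets (usual_filtration M X t) = sigma_sets (space M) ?I"
    unfolding usual_filtration_def augmented_def sets_measure_of[OF generators_subset_Pow]
    by (rule sets_measure_of)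
  also have "sigma_sets (space M) ?I = ?I"
  proof (intro equalityI)
    show "?I \<subseteq> sigma_sets (space M) ?I" by auto
    show "sigma_sets (space M) ?I \<subseteq> ?I"
    proof (rule INT_greatest)
      fix u assume u: "u \<in> {t<..}"
      interpret sigma_algebra "space M" "augmented u"
        unfolding augmented_def using generators_subset_Pow by (rule sigma_algebra_sigma_sets)
      show "sigma_sets (space M) ?I \<subseteq> augmented u" using u by (intro sigma_sets_subset) auto
    qed
  qed
  finally show ?thesis .
qed

lemma space_usual_filtration: "space (usual_filtration M X t) = space M"
  unfolding usual_filtration_def by (simp add: space_measure_of_conv)

sublocale usual: filtration "space M" "usual_filtration M X"
  by unfold_locales (auto simp: space_usual_filtration sets_usual_filtration)

lemma subalgebra_usual_filtration: "subalgebra (completion M) (usual_filtration M X t)"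
  unfolding subalgebra_def space_usual_filtration sets_usual_filtration
  using augmented_subset[of "t + 1"] by auto

lemma adapted_usual_filtration:
  assumes "0 \<le> s"
  shows "X s \<in> borel_measurable (usual_filtration M X s)"
proof (rule measurableI)
  fix A :: "real set" assume A: "A \<in> sets borel"
  have "X s -` A \<inter> space M = {\<omega>\<in>space M. X s \<omega> \<in> A}" by auto
  moreover have "{\<omega>\<in>space M. X s \<omega> \<in> A} \<in> nat_gen M X u" if "s < u" for u
    using assms A that unfolding nat_gen_def by (intro CollectI exI[of _ s] exI[of _ A]) auto
  ultimately show "X s -` A \<inter> space (usual_filtration M X s) \<in> sets (usual_filtration M X s)"
    unfolding space_usual_filtration sets_usual_filtration augmented_def by (auto intro: sigma_sets.Basic)
qed auto

definition cylinder_events :: "real \<Rightarrow> 'a set set" where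
  "cylinder_events u =
     {{\<omega>\<in>space M. \<forall>v\<in>J. X v \<omega> \<in> A v} | J A. finite J \<and> J \<subseteq> {0..u} \<and> (\<forall>v. A v \<in> sets borel)}"

lemma cylinder_events_subset_events: "cylinder_events u \<subseteq> events"
  unfolding cylinder_events_def
  by (auto intro!: sets.sets_Collect_finite_All measurable_sets_Collect[OF process_measurable])

lemma nat_gen_subset_cylinder_events: "nat_gen M X u \<subseteq> cylinder_events u"
proof
  fix a assume "a \<in> nat_gen M X u"
  then obtain s A where "a = {\<omega>\<in>space M. X s \<omega> \<in> A}" "s \<in> {0..u}" "A \<in> sets borel"
    by (auto simp: nat_gen_def)
  then show "a \<in> cylinder_events u"
    unfolding cylinder_events_def by (intro CollectI exI[of _ "{s}"] exI[of _ "\<lambda>_. A"]) auto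
qed

lemma Int_stable_cylinder_events: "Int_stable (cylinder_events u)"
proof (rule Int_stableI)
  fix a b assume "a \<in> cylinder_events u" "b \<in> cylinder_events u"
  then obtain J A J' A'
    where a: "a = {\<omega>\<in>space M. \<forall>v\<in>J. X v \<omega> \<in> A v}" "finite J" "J \<subseteq> {0..u}" "\<And>v. A v \<in> sets borel"
      and b: "b = {\<omega>\<in>space M. \<forall>v\<in>J'. X v \<omega> \<in> A' v}" "finite J'" "J' \<subseteq> {0..u}" "\<And>v. A' v \<in> sets borel"
    by (auto simp: cylinder_events_def)
  define C where "C v = (if v \<in> J then A v else UNIV) \<inter> (if v \<in> J' then A' v else UNIV)" for v
  have "a \<inter> b = {\<omega>\<in>space M. \<forall>v\<in>J \<union> J'. X v \<omega> \<in> C v}" using a(1) b(1) by (auto simp: C_def)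
  moreover have "C v \<in> sets borel" for v using a(4) b(4) by (auto simp: C_def)
  ultimately show "a \<inter> b \<in> cylinder_events u"
    unfolding cylinder_events_def using a b by (intro CollectI exI[of _ "J \<union> J'"] exI[of _ C]) auto
qed

end

lemma ex_mono_enumeration:
  fixes J :: "real set"
  assumes "finite J" "J \<subseteq> {0..s}" "0 \<le> s" "s \<le> u"
  obtains t :: "nat \<Rightarrow> real" and n where "mono t" "t 0 = 0" "t n = s" "t (Suc n) = u" "J \<subseteq> t ` {..n}"
proof -
  define l where "l = sorted_list_of_set (insert 0 (insert s J))"
  have set_l: "set l = insert 0 (insert s J)" and sorted: "sorted l"
    using assms(1) by (simp_all add: l_def del: sorted_list_of_set_insert_remove)
  define n where "n = length l - 1"
  have len: "length l = Suc n" using set_l by (cases l) (auto simp: n_def)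
  have range: "l ! i \<in> {0..s}" if "i \<le> n" for i
    using assms(2,3) set_l nth_mem[of i l] that len by auto
  define t where "t i = (if i \<le> n then l ! i else u)" for i
  have "mono t"
    using sorted_nth_mono[OF sorted] range assms(4) len by (fastforce simp: t_def intro!: monoI)
  moreover have image: "t ` {..n} = set l"
    unfolding set_conv_nth len t_def by (auto simp: less_Suc_eq_le)
  moreover have "t 0 = 0"
  proof -
    obtain i where "i \<le> n" "t i = 0" using image set_l by (metis atMost_iff imageE insertI1)
    then have "t 0 \<le> 0" using monoD[OF \<open>mono t\<close>, of 0 i] by simp
    then show ?thesis using range[of 0] by (simp add: t_def)
  qed
  moreover have "t n = s"
  proof -
    obtain i where "i \<le> n" "t i = s" using image set_l by (metis atMost_iff imageE insertCI)
    then have "s \<le> t n" using monoD[OF \<open>mono t\<close>, of i n] by simp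
    then show ?thesis using range[of n] by (simp add: t_def)
  qed
  ultimately show ?thesis using that[of t n] set_l by (auto simp: t_def)
qed

locale real_levy_process = real_process +
  assumes start_zero: "\<omega> \<in> space M \<Longrightarrow> X 0 \<omega> = 0"
    and right_cont: "\<omega> \<in> space M \<Longrightarrow> 0 \<le> s \<Longrightarrow> continuous (at_right s) (\<lambda>u. X u \<omega>)"
    and indep_increments: "0 \<le> t 0 \<Longrightarrow> mono t \<Longrightarrow>
      indep_vars (\<lambda>_. borel) (\<lambda>i \<omega>. X (t (Suc i)) \<omega> - X (t i) \<omega>) {..<n::nat}"
    and stationary_increments: "0 \<le> s \<Longrightarrow> 0 \<le> h \<Longrightarrow>
      distr M borel (\<lambda>\<omega>. X (s + h) \<omega> - X s \<omega>) = distr M borel (X h)"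
begin

lemma cylinder_indep_increment:
  assumes s: "0 \<le> s" "s \<le> u" and a: "a \<in> cylinder_events s" and D: "D \<in> sets borel"
  shows "prob (a \<inter> {\<omega>\<in>space M. X u \<omega> - X s \<omega> \<in> D}) = prob a * prob {\<omega>\<in>space M. X u \<omega> - X s \<omega> \<in> D}"
proof -
  obtain J A where a_eq: "a = {\<omega>\<in>space M. \<forall>v\<in>J. X v \<omega> \<in> A v}"
    and J: "finite J" "J \<subseteq> {0..s}" and A: "\<And>v. A v \<in> sets borel"
    using a by (auto simp: cylinder_events_def)
  obtain t n where t: "mono t" "t 0 = 0" "t n = s" "t (Suc n) = u" and J_t: "J \<subseteq> t ` {..n}"
    using ex_mono_enumeration[OF J s] by blast
  then have "\<forall>v\<in>J. \<exists>k\<le>n. t k = v" by blast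
  then obtain k where k: "\<And>v. v \<in> J \<Longrightarrow> k v \<le> n \<and> t (k v) = v" by metis
  define Y where "Y i \<omega> = X (t (Suc i)) \<omega> - X (t i) \<omega>" for i \<omega>
  have telescope: "X v \<omega> = (\<Sum>i<k v. restrict (\<lambda>i. Y i \<omega>) {..<n} i)" if "v \<in> J" "\<omega> \<in> space M" for v \<omega>
  proof -
    have "(\<Sum>i<k v. restrict (\<lambda>i. Y i \<omega>) {..<n} i) = (\<Sum>i<k v. Y i \<omega>)"
      using k[OF that(1)] by (intro sum.cong) auto
    also have "\<dots> = X (t (k v)) \<omega> - X (t 0) \<omega>" unfolding Y_def by (rule sum_lessThan_telescope)
    finally show ?thesis using k[OF that(1)] that(2) t(2) by (simp add: start_zero)
  qed
  let ?P = "PiM {..<n} (\<lambda>_. borel :: real measure)"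
  define A' where "A' = {f\<in>space ?P. \<forall>v\<in>J. (\<Sum>i<k v. f i) \<in> A v}"
  have "(\<lambda>f. \<Sum>i<k v. f i) \<in> borel_measurable ?P" if "v \<in> J" for v
    using k[OF that] by (intro borel_measurable_sum measurable_component_singleton) auto
  then have A': "A' \<in> sets ?P"
    unfolding A'_def using J(1) A by (intro sets.sets_Collect_finite_All) (auto intro: measurable_sets_Collect)
  have "a = {\<omega>\<in>space M. restrict (\<lambda>i. Y i \<omega>) {..<n} \<in> A'}"
    unfolding a_eq A'_def by (auto simp: telescope space_PiM)
  moreover have "Y n = (\<lambda>\<omega>. X u \<omega> - X s \<omega>)" by (simp add: Y_def t fun_eq_iff)
  moreover have "indep_vars (\<lambda>_. borel) Y {..<Suc n}" unfolding Y_def using t by (intro indep_increments) auto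
  ultimately show ?thesis using indep_vars_last[OF _ A' D, of Y] by simp
qed

lemma past_indep_increment:
  assumes s: "0 \<le> s" "s \<le> u" and a: "a \<in> sigma_sets (space M) (nat_gen M X s)" and D: "D \<in> sets borel"
  shows "prob (a \<inter> {\<omega>\<in>space M. X u \<omega> - X s \<omega> \<in> D}) = prob a * prob {\<omega>\<in>space M. X u \<omega> - X s \<omega> \<in> D}"
proof -
  let ?B = "{{\<omega>\<in>space M. X u \<omega> - X s \<omega> \<in> D}}"
  have "?B \<subseteq> events" using D by (auto intro!: measurable_sets_Collect[where N=borel])
  then have "indep_set (cylinder_events s) ?B"
    using cylinder_events_subset_events cylinder_indep_increment[OF s _ D] by (intro indep_setI) auto
  then have "indep_set (sigma_sets (space M) (cylinder_events s)) (sigma_sets (space M) ?B)"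
    by (rule indep_set_sigma_sets[OF _ Int_stable_cylinder_events]) (simp add: Int_stable_def)
  moreover have "a \<in> sigma_sets (space M) (cylinder_events s)"
    using a sigma_sets_mono'[OF nat_gen_subset_cylinder_events] by blast
  ultimately show ?thesis by (auto intro: indep_setD)
qed

lemma augmented_indep_increment:
  assumes s: "0 \<le> s" "s \<le> u" and A: "A \<in> augmented s" and D: "D \<in> sets borel"
  shows "measure (completion M) (A \<inter> {\<omega>\<in>space M. X u \<omega> - X s \<omega> \<in> D})
    = measure (completion M) A * measure (completion M) {\<omega>\<in>space M. X u \<omega> - X s \<omega> \<in> D}"
proof -
  let ?E = "{\<omega>\<in>space M. X u \<omega> - X s \<omega> \<in> D}"
  have E: "?E \<in> events" using D by (auto intro!: measurable_sets_Collect[where N=borel])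
  obtain A0 where A0: "A0 \<in> sigma_sets (space M) (nat_gen M X s)"
    and null: "(A - A0) \<union> (A0 - A) \<in> null_sets (completion M)"
    using sigma_sets_null_sets_approx[OF nat_gen_subset_events A[unfolded augmented_def]] by blast
  have A0_event: "A0 \<in> events" using A0 sets.sigma_sets_subset[OF nat_gen_subset_events] by auto
  have sets: "A \<in> sets (completion M)" "A0 \<in> sets (completion M)" "?E \<in> sets (completion M)"
    using A augmented_subset A0_event E by (auto intro: sets_completionI_sets)
  have AE: "AE \<omega> in completion M. \<omega> \<in> A \<longleftrightarrow> \<omega> \<in> A0" by (rule AE_I'[OF null]) auto
  have "measure (completion M) (A \<inter> ?E) = measure (completion M) (A0 \<inter> ?E)"
    using AE sets by (intro measure_eq_AE) auto
  moreover have "measure (completion M) A = measure (completion M) A0"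
    using AE sets by (intro measure_eq_AE) auto
  ultimately show ?thesis using past_indep_increment[OF s A0 D] A0_event E by simp
qed

lemma usual_filtration_indep_increment:
  assumes s: "0 \<le> s" and h: "0 < h" and A: "A \<in> sets (usual_filtration M X s)" and D: "D \<in> sets borel"
  shows "measure (completion M) (A \<inter> {\<omega>\<in>space M. X (s + h) \<omega> - X s \<omega> \<in> D})
    = measure (completion M) A * measure (completion M) {\<omega>\<in>space M. X (s + h) \<omega> - X s \<omega> \<in> D}"
proof -
  interpret c: prob_space "completion M" by (rule prob_space_completion)
  define v where "v n = s + h / real (n + 2)" for n
  have v: "s < v n" "v n \<le> s + h" for n using h by (auto simp: v_def field_simps)
  have "(\<lambda>n. s + h / real (n + 2)) \<longlonglongrightarrow> s + 0"
    by (intro tendsto_add tendsto_const LIMSEQ_ignore_initial_segment[OF lim_const_over_n])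
  then have v_lim: "v \<longlonglongrightarrow> s" by (simp add: v_def[abs_def])
  have "(\<lambda>n. X (v n) \<omega>) \<longlonglongrightarrow> X s \<omega>" if "\<omega> \<in> space M" for \<omega>
    using v_lim less_imp_le[OF v(1)] by (rule continuous_at_right_tendsto_compose[OF right_cont[OF that s]])
  then have lim: "(\<lambda>n. X (s + h) \<omega> - X (v n) \<omega>) \<longlonglongrightarrow> X (s + h) \<omega> - X s \<omega>"
    if "\<omega> \<in> space (completion M)" for \<omega>
    using that by (intro tendsto_intros) simp
  have indep: "measure (completion M) (A \<inter> {\<omega>\<in>space (completion M). X (s + h) \<omega> - X (v n) \<omega> \<in> B})
      = measure (completion M) A * measure (completion M) {\<omega>\<in>space (completion M). X (s + h) \<omega> - X (v n) \<omega> \<in> B}"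
    if "B \<in> sets borel" for n B
    using augmented_indep_increment[OF _ v(2) _ that, of n A] A v(1)[of n] s
    by (simp add: sets_usual_filtration)
  have "A \<in> sets (completion M)" using A subalgebra_usual_filtration by (auto simp: subalgebra_def)
  from c.indep_event_tendsto[OF this _ _ lim indep D] show ?thesis
    by (simp add: measurable_completion)
qed

lemma filtered_levy_process_usual_filtration:
  "filtered_levy_process (completion M) (usual_filtration M X) X (\<lambda>h. distr M borel (X h))"
proof -
  interpret c: prob_space "completion M" by (rule prob_space_completion)
  have "filtration (space (completion M)) (usual_filtration M X)" using usual.filtration_axioms by simp
  then show ?thesis
  proof (rule filtered_levy_process.intro[OF c.prob_space_axioms _ filtered_levy_process_axioms.intro])
    fix s h :: real and A and D :: "real set"
    assume s: "0 \<le> s" and h: "0 < h" and A: "A \<in> sets (usual_filtration M X s)" and D: "D \<in> sets borel"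
    have "{\<omega>\<in>space M. X (s + h) \<omega> - X s \<omega> \<in> D} = (\<lambda>\<omega>. X (s + h) \<omega> - X s \<omega>) -` D \<inter> space M" by auto
    then have "measure (completion M) {\<omega>\<in>space M. X (s + h) \<omega> - X s \<omega> \<in> D} = measure (distr M borel (X h)) D"
      using D s h by (simp add: stationary_increments[symmetric] measure_distr)
    then show "measure (completion M) (A \<inter> {\<omega>\<in>space (completion M). X (s + h) \<omega> - X s \<omega> \<in> D})
        = measure (completion M) A * measure (distr M borel (X h)) D"
      using usual_filtration_indep_increment[OF s h A D] by simp
  qed (simp_all add: subalgebra_usual_filtration adapted_usual_filtration start_zero right_cont
      prob_space_distr)
qed

end

lemma real_levy_processI:
  assumes "levy_process M X"
  shows "real_levy_process M X"
proof (intro real_levy_process.intro real_process.intro real_process_axioms.intro real_levy_process_axioms.intro)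
qed (use assms in \<open>simp_all add: levy_process_def\<close>)

lemma (in real_process) filtered_levy_process_brownian_motion:
  assumes B: "brownian_motion M (usual_filtration M X) B"
  shows "filtered_levy_process (completion M) (usual_filtration M X) B
    (\<lambda>h. density lborel (normal_density 0 (sqrt h)))"
proof -
  interpret c: prob_space "completion M" by (rule prob_space_completion)
  have "filtration (space (completion M)) (usual_filtration M X)" using usual.filtration_axioms by simp
  then show ?thesis
  proof (rule filtered_levy_process.intro[OF c.prob_space_axioms _ filtered_levy_process_axioms.intro])
    fix \<omega> and s :: real assume "\<omega> \<in> space (completion M)" "0 \<le> s"
    then have "continuous (at s within {0..}) (\<lambda>u. B u \<omega>)"
      using B by (auto simp: brownian_motion_def continuous_on_eq_continuous_within)
    then show "continuous (at_right s) (\<lambda>u. B u \<omega>)"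
      by (rule continuous_within_subset) (use \<open>0 \<le> s\<close> in auto)
  next
    fix s h :: real and A and D :: "real set"
    assume s: "0 \<le> s" and h: "0 < h" and A: "A \<in> sets (usual_filtration M X s)" and D: "D \<in> sets borel"
    have [measurable]: "B u \<in> borel_measurable (completion M)" for u
      using B by (intro measurable_from_subalg[OF subalgebra_usual_filtration]) (auto simp: brownian_motion_def)
    have "{\<omega>\<in>space M. B (s + h) \<omega> - B s \<omega> \<in> D} = (\<lambda>\<omega>. B (s + h) \<omega> - B s \<omega>) -` D \<inter> space (completion M)"
      by auto
    then have "measure (completion M) {\<omega>\<in>space M. B (s + h) \<omega> - B s \<omega> \<in> D}
        = measure (distr (completion M) borel (\<lambda>\<omega>. B (s + h) \<omega> - B s \<omega>)) D"
      using D by (simp add: measure_distr)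
    also have "\<dots> = measure (density lborel (normal_density 0 (sqrt h))) D"
      using B s h by (auto simp: brownian_motion_def)
    finally show "measure (completion M) (A \<inter> {\<omega>\<in>space (completion M). B (s + h) \<omega> - B s \<omega> \<in> D})
        = measure (completion M) A * measure (density lborel (normal_density 0 (sqrt h))) D"
      using B s h A D by (auto simp: brownian_motion_def)
  qed (use B in \<open>simp_all add: brownian_motion_def subalgebra_usual_filtration prob_space_normal_density\<close>)
qed

lemma (in filtered_levy_process) filtered_levy_process_affine:
  "filtered_levy_process N F (\<lambda>s \<omega>. c * s + a * L s \<omega>) (\<lambda>h. distr (\<mu> h) borel (\<lambda>y. c * h + a * y))"
proof (rule filtered_levy_process.intro[OF prob_space_axioms filtration_axioms filtered_levy_process_axioms.intro])
  fix s :: real assume "0 \<le> s"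
  then have [measurable]: "L s \<in> borel_measurable (F s)" by (rule adapted)
  show "(\<lambda>\<omega>. c * s + a * L s \<omega>) \<in> borel_measurable (F s)" by measurable
next
  fix \<omega> and s :: real assume "\<omega> \<in> space N" "0 \<le> s"
  then show "continuous (at_right s) (\<lambda>u. c * u + a * L u \<omega>)" by (intro continuous_intros right_cont)
next
  fix h :: real assume "0 < h"
  then show "prob_space (distr (\<mu> h) borel (\<lambda>y. c * h + a * y))"
    by (intro prob_space.prob_space_distr prob_space_increment)
      (simp_all add: sets_increment cong: measurable_cong_sets)
next
  fix s h :: real and A and D :: "real set"
  assume s: "0 \<le> s" and h: "0 < h" and A: "A \<in> sets (F s)" and D: "D \<in> sets borel"
  let ?D = "(\<lambda>y. c * h + a * y) -` D"
  have "?D \<in> sets borel" using measurable_sets[of "\<lambda>y. c * h + a * y" borel borel D] D by simp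
  moreover have "{\<omega>\<in>space N. c * (s + h) + a * L (s + h) \<omega> - (c * s + a * L s \<omega>) \<in> D}
      = {\<omega>\<in>space N. L (s + h) \<omega> - L s \<omega> \<in> ?D}" by (auto simp: algebra_simps)
  moreover have "measure (distr (\<mu> h) borel (\<lambda>y. c * h + a * y)) D = measure (\<mu> h) ?D"
    using D sets_eq_imp_space_eq[OF sets_increment[of h]]
    by (subst measure_distr) (simp_all add: sets_increment cong: measurable_cong_sets)
  ultimately show "measure N (A \<inter> {\<omega>\<in>space N. c * (s + h) + a * L (s + h) \<omega> - (c * s + a * L s \<omega>) \<in> D})
      = measure N A * measure (distr (\<mu> h) borel (\<lambda>y. c * h + a * y)) D"
    using increment[OF s h A, of ?D] by metis
qed (simp_all add: subalg start_zero)

section \<open>Normal distributions and convolutions\<close>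

abbreviation normal_distribution :: "real \<Rightarrow> real \<Rightarrow> real measure" where
  "normal_distribution m s \<equiv> density lborel (normal_density m s)"

lemma real_distributionI:
  "prob_space N \<Longrightarrow> sets N = sets borel \<Longrightarrow> real_distribution N"
  using sets_eq_imp_space_eq[of N borel] by (simp add: real_distribution_def real_distribution_axioms_def)

lemma real_distribution_normal: "0 < s \<Longrightarrow> real_distribution (normal_distribution m s)"
  by (intro real_distributionI prob_space_normal_density) auto

lemma distr_normal_affine:
  assumes "0 < s" "a \<noteq> 0"
  shows "distr (normal_distribution m s) borel (\<lambda>y. b + a * y) = normal_distribution (b + a * m) (\<bar>a\<bar> * s)"
proof -
  interpret prob_space "normal_distribution m s" using assms(1) by (rule prob_space_normal_density)
  have "distributed (normal_distribution m s) lborel (\<lambda>y. y) (normal_density m s)"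
    unfolding distributed_def by (auto intro!: distr_id2)
  from normal_density_affine[OF this assms]
  have "distr (normal_distribution m s) lborel (\<lambda>y. b + a * y) = normal_distribution (b + a * m) (\<bar>a\<bar> * s)"
    by (simp add: distributed_def)
  then show ?thesis by (metis distr_cong sets_lborel)
qed

lemma char_normal_distribution:
  assumes "0 < s"
  shows "char (normal_distribution m s) u = iexp (u * m) * complex_of_real (exp (- ((u * s)\<^sup>2) / 2))"
proof -
  have "normal_distribution m s = distr std_normal_distribution borel (\<lambda>y. m + s * y)"
    using distr_normal_affine[of 1 s 0 m] assms by simp
  then have "char (normal_distribution m s) u = (CLINT y|std_normal_distribution. iexp (u * m) * iexp (u * s * y))"
    by (simp add: char_def integral_distr exp_add[symmetric] algebra_simps)
  also have "\<dots> = iexp (u * m) * char std_normal_distribution (u * s)"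
    unfolding char_def by (rule integral_mult_right_zero)
  finally show ?thesis by (simp add: char_std_normal_distribution)
qed

lemma has_bochner_integral_exp_normal:
  assumes "0 < s"
  shows "has_bochner_integral (normal_distribution m s) (\<lambda>y. exp (a * y)) (exp (a * m + a\<^sup>2 * s\<^sup>2 / 2))"
proof -
  have "normal_density m s y * exp (a * y) = exp (a * m + a\<^sup>2 * s\<^sup>2 / 2) * normal_density (m + a * s\<^sup>2) s y" for y
  proof -
    have "- (y - m)\<^sup>2 / (2 * s\<^sup>2) + a * y
        = a * m + a\<^sup>2 * s\<^sup>2 / 2 + - (y - (m + a * s\<^sup>2))\<^sup>2 / (2 * s\<^sup>2)"
      using assms by (simp add: field_simps) (simp add: eval_nat_numeral algebra_simps)
    then show ?thesis by (simp add: normal_density_def mult_exp_exp)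
  qed
  moreover have "has_bochner_integral lborel (normal_density (m + a * s\<^sup>2) s) 1"
    using assms by (simp add: has_bochner_integral_iff integrable_normal_density integral_normal_density)
  ultimately have "has_bochner_integral lborel (\<lambda>y. normal_density m s y *\<^sub>R exp (a * y))
      (exp (a * m + a\<^sup>2 * s\<^sup>2 / 2))"
    using has_bochner_integral_mult_right[of _ lborel "normal_density (m + a * s\<^sup>2) s" 1] by simp
  then show ?thesis by (intro has_bochner_integral_density) (auto simp: assms less_imp_le)
qed

lemma not_AE_normal_nonneg:
  assumes "0 < s"
  shows "\<not> (AE y in normal_distribution m s. 0 \<le> y)"
proof
  assume "AE y in normal_distribution m s. 0 \<le> y"
  then have "AE y in lborel. 0 \<le> (y :: real)"
    using assms by (subst (asm) AE_density) (auto simp: normal_density_pos)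
  then have "emeasure lborel {..<0::real} = 0"
    by (subst (asm) AE_iff_measurable[where N="{..<0}"]) auto
  moreover have "emeasure lborel {-1<..<0::real} \<le> emeasure lborel {..<0::real}"
    by (intro emeasure_mono) auto
  ultimately show False by simp
qed

lemma real_distribution_convolution:
  assumes "real_distribution M" "real_distribution N"
  shows "real_distribution (M \<star> N)"
proof -
  interpret M: real_distribution M by fact
  interpret N: real_distribution N by fact
  interpret P: pair_prob_space M N by unfold_locales
  show ?thesis unfolding convolution_def by (intro P.real_distribution_distr) simp
qed

lemma integral_convolution:
  fixes f :: "real \<Rightarrow> 'b::{banach, second_countable_topology}"
  assumes "real_distribution M" "real_distribution N"
    and [measurable]: "f \<in> borel_measurable borel" and bound: "\<And>x. norm (f x) \<le> B"
  shows "integral\<^sup>L (M \<star> N) f = (\<integral>x. \<integral>y. f (x + y) \<partial>N \<partial>M)"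
proof -
  interpret M: real_distribution M by fact
  interpret N: real_distribution N by fact
  interpret P: pair_prob_space M N by unfold_locales
  have "integrable (M \<Otimes>\<^sub>M N) (\<lambda>z. f (case z of (x, y) \<Rightarrow> x + y))"
    by (rule P.integrable_const_bound[where B=B]) (auto simp: bound)
  from P.integral_fst'[OF this] show ?thesis
    unfolding convolution_def by (subst integral_distr) auto
qed

lemma char_convolution:
  assumes "real_distribution M" "real_distribution N"
  shows "char (M \<star> N) t = char M t * char N t"
proof -
  have "char (M \<star> N) t = (CLINT x|M. CLINT y|N. iexp (t * (x + y)))"
    unfolding char_def using assms by (intro integral_convolution[where B=1]) auto
  also have "\<dots> = char M t * char N t"
    unfolding char_def by (simp add: distrib_left exp_add of_real_add)
  finally show ?thesis .
qed

lemma convolution_expectation_exp: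
  assumes "real_distribution M" "real_distribution N" and M: "integrable M exp" and N: "integrable N exp"
  shows "integrable (M \<star> N) exp" "integral\<^sup>L (M \<star> N) exp = integral\<^sup>L M exp * integral\<^sup>L N exp"
proof -
  interpret M: real_distribution M by fact
  interpret N: real_distribution N by fact
  have "(\<integral>\<^sup>+y. ennreal (exp y) \<partial>(M \<star> N)) = (\<integral>\<^sup>+x. \<integral>\<^sup>+y. ennreal (exp x) * ennreal (exp y) \<partial>N \<partial>M)"
    by (subst nn_integral_convolution)
      (auto simp: M.finite_measure_axioms N.finite_measure_axioms exp_add ennreal_mult)
  also have "\<dots> = ennreal (integral\<^sup>L M exp * integral\<^sup>L N exp)"
    using nn_integral_eq_integral[OF M] nn_integral_eq_integral[OF N]
    by (simp add: nn_integral_cmult nn_integral_multc ennreal_mult integral_nonneg)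
  finally have "has_bochner_integral (M \<star> N) exp (integral\<^sup>L M exp * integral\<^sup>L N exp)"
    by (intro has_bochner_integral_nn_integral) (auto simp: integral_nonneg)
  then show "integrable (M \<star> N) exp" "integral\<^sup>L (M \<star> N) exp = integral\<^sup>L M exp * integral\<^sup>L N exp"
    by (simp_all add: has_bochner_integral_iff)
qed

section \<open>Laws of pure jump processes\<close>

fun conv_power :: "real measure \<Rightarrow> nat \<Rightarrow> real measure" where
  "conv_power U 0 = return borel 0"
| "conv_power U (Suc n) = (U \<star> conv_power U n)"

definition submultiplicative_weight :: "(real \<Rightarrow> real) \<Rightarrow> bool" where
  "submultiplicative_weight g \<longleftrightarrow> continuous_on UNIV g \<and> (\<forall>y. 0 \<le> g y) \<and> g 0 = 1 \<and> (\<forall>x y. g (x + y) \<le> g x * g y)"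

lemma submultiplicative_weight_measurable: "submultiplicative_weight g \<Longrightarrow> g \<in> borel_measurable borel"
  by (simp add: submultiplicative_weight_def borel_measurable_continuous_onI)

lemma real_distribution_conv_power:
  assumes "real_distribution U"
  shows "real_distribution (conv_power U n)"
proof (induction n)
  case 0
  show ?case by (auto intro!: real_distributionI prob_space_return)
qed (simp add: assms real_distribution_convolution)

lemma char_conv_power: "real_distribution U \<Longrightarrow> char (conv_power U n) t = char U t ^ n"
  by (induction n)
    (simp_all add: char_def[of "return borel 0"] integral_return char_convolution real_distribution_conv_power)

lemma nn_integral_conv_power_le:
  assumes U: "real_distribution U" and g: "submultiplicative_weight g"
  shows "(\<integral>\<^sup>+y. ennreal (g y) \<partial>conv_power U n) \<le> (\<integral>\<^sup>+y. ennreal (g y) \<partial>U) ^ n"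
proof (induction n)
  case 0
  show ?case
    using g submultiplicative_weight_measurable[OF g]
    by (simp add: nn_integral_return submultiplicative_weight_def)
next
  case (Suc n)
  interpret U: real_distribution U by (rule U)
  interpret c: real_distribution "conv_power U n" by (rule real_distribution_conv_power[OF U])
  note [measurable] = submultiplicative_weight_measurable[OF g]
  have "ennreal (g (x + y)) \<le> ennreal (g x) * ennreal (g y)" for x y
    using g by (auto simp: submultiplicative_weight_def ennreal_mult[symmetric] intro!: ennreal_leI)
  then have "(\<integral>\<^sup>+y. ennreal (g y) \<partial>conv_power U (Suc n))
      \<le> (\<integral>\<^sup>+x. \<integral>\<^sup>+y. ennreal (g x) * ennreal (g y) \<partial>conv_power U n \<partial>U)"
    by (simp add: nn_integral_convolution U.finite_measure_axioms c.finite_measure_axioms nn_integral_mono)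
  also have "\<dots> = (\<integral>\<^sup>+y. ennreal (g y) \<partial>U) * (\<integral>\<^sup>+y. ennreal (g y) \<partial>conv_power U n)"
    by (simp add: nn_integral_cmult nn_integral_multc)
  also have "\<dots> \<le> (\<integral>\<^sup>+y. ennreal (g y) \<partial>U) ^ Suc n"
    using mult_left_mono[OF Suc.IH] by simp
  finally show ?case .
qed

lemma poisson_generating_sums:
  fixes z :: "'a::{real_normed_field, banach}"
  assumes "0 < c"
  shows "(\<lambda>n. of_real (pmf (poisson_pmf c) n) * z ^ n) sums exp (of_real c * (z - 1))"
proof -
  have "(\<lambda>n. of_real (exp (- c)) * ((of_real c * z) ^ n /\<^sub>R fact n)) sums (of_real (exp (- c)) * exp (of_real c * z))"
    by (intro sums_mult exp_converges)
  also have "of_real (exp (- c)) * exp (of_real c * z) = exp (of_real c * (z - 1))"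
    by (simp add: exp_of_real[symmetric] exp_add[symmetric] algebra_simps)
  also have "(\<lambda>n. of_real (exp (- c)) * ((of_real c * z) ^ n /\<^sub>R fact n))
      = (\<lambda>n. of_real (pmf (poisson_pmf c) n) * z ^ n)"
    using assms by (simp add: fun_eq_iff power_mult_distrib scaleR_conv_of_real field_simps)
  finally show ?thesis .
qed

lemma nn_integral_poisson_power:
  assumes "0 < c" "0 \<le> a"
  shows "(\<integral>\<^sup>+n. ennreal a ^ n \<partial>measure_pmf (poisson_pmf c)) = ennreal (exp (c * (a - 1)))"
proof -
  have "(\<integral>\<^sup>+n. ennreal a ^ n \<partial>measure_pmf (poisson_pmf c)) = (\<Sum>n. ennreal (pmf (poisson_pmf c) n * a ^ n))"
    using assms by (simp add: nn_integral_measure_pmf nn_integral_count_space_nat ennreal_mult ennreal_power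
        del: pmf_poisson)
  also have "\<dots> = ennreal (exp (c * (a - 1)))"
    using poisson_generating_sums[OF assms(1), of a] assms
    by (intro suminf_ennreal_eq) (auto simp del: pmf_poisson)
  finally show ?thesis .
qed

lemma integral_poisson_power:
  fixes z :: complex
  assumes "0 < c" "norm z \<le> 1"
  shows "integral\<^sup>L (measure_pmf (poisson_pmf c)) (\<lambda>n. z ^ n) = exp (of_real c * (z - 1))"
proof -
  have "integrable (measure_pmf (poisson_pmf c)) (\<lambda>n. z ^ n)"
    using assms(2) by (intro measure_pmf.integrable_const_bound[where B=1]) (auto simp: norm_power power_le_one)
  then have "integrable (count_space UNIV) (\<lambda>n. pmf (poisson_pmf c) n *\<^sub>R z ^ n)"
    by (simp add: measure_pmf_eq_density integrable_density del: pmf_poisson)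
  from sums_integral_count_space_nat[OF this]
  have "(\<lambda>n. of_real (pmf (poisson_pmf c) n) * z ^ n) sums integral\<^sup>L (measure_pmf (poisson_pmf c)) (\<lambda>n. z ^ n)"
    by (simp add: measure_pmf_eq_density integral_density scaleR_conv_of_real del: pmf_poisson)
  then show ?thesis using poisson_generating_sums[OF assms(1), of z] by (rule sums_unique2)
qed

definition compound_poisson :: "real \<Rightarrow> real measure \<Rightarrow> real measure" where
  "compound_poisson c U = measure_pmf (poisson_pmf c) \<bind> conv_power U"

context
  fixes U :: "real measure" and c :: real
  assumes U: "real_distribution U" and c: "0 < c"
begin

lemma conv_power_kernel: "conv_power U \<in> measurable (measure_pmf (poisson_pmf c)) (subprob_algebra borel)"
proof -
  interpret real_distribution "conv_power U n" for n by (rule real_distribution_conv_power[OF U])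
  show ?thesis by (auto simp: space_subprob_algebra intro: prob_space_imp_subprob_space prob_space_axioms)
qed

lemma real_distribution_compound_poisson: "real_distribution (compound_poisson c U)"
proof (rule real_distributionI)
  show "prob_space (compound_poisson c U)"
    unfolding compound_poisson_def using real_distribution_conv_power[OF U]
    by (intro measure_pmf.prob_space_bind[OF _ conv_power_kernel]) (auto simp: real_distribution_def)
  show "sets (compound_poisson c U) = sets borel"
    unfolding compound_poisson_def using real_distribution_conv_power[OF U]
    by (intro sets_bind) (auto simp: real_distribution.events_eq_borel)
qed

lemma char_compound_poisson: "char (compound_poisson c U) u = exp (of_real c * (char U u - 1))"
proof -
  interpret U: real_distribution U by (rule U)
  interpret C: real_distribution "compound_poisson c U" by (rule real_distribution_compound_poisson)
  interpret P: real_distribution "conv_power U n" for n by (rule real_distribution_conv_power[OF U])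
  have bounded: "norm (char (conv_power U n) u) \<le> 1" for n by (rule P.cmod_char_le_1)
  have part: "f (char (compound_poisson c U) u) = f (\<integral>n. char (conv_power U n) u \<partial>measure_pmf (poisson_pmf c))"
    if f: "bounded_linear f" "\<And>z. \<bar>f z\<bar> \<le> norm z" for f :: "complex \<Rightarrow> real"
  proof -
    have "f (char (compound_poisson c U) u) = (\<integral>y. f (iexp (u * y)) \<partial>compound_poisson c U)"
      unfolding char_def using f(1) by (intro integral_bounded_linear[symmetric] C.integrable_iexp) auto
    also have "\<dots> = (\<integral>n. (\<integral>y. f (iexp (u * y)) \<partial>conv_power U n) \<partial>measure_pmf (poisson_pmf c))"
      unfolding compound_poisson_def
    proof (rule integral_bind[OF _ _ conv_power_kernel, where B=1 and B'=1])
      show "(\<lambda>y. f (iexp (u * y))) \<in> borel_measurable borel"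
        using borel_measurable_continuous_onI[OF linear_continuous_on[OF f(1)]] by measurable
      show "\<bar>f (iexp (u * y))\<bar> \<le> 1" for y using f(2)[of "iexp (u * y)"] by simp
      show "finite_measure (measure_pmf (poisson_pmf c))" by unfold_locales
      show "AE n in measure_pmf (poisson_pmf c). emeasure (conv_power U n) (space (conv_power U n)) \<le> ennreal 1"
        using P.emeasure_space_1 by simp
    qed
    also have "\<dots> = (\<integral>n. f (char (conv_power U n) u) \<partial>measure_pmf (poisson_pmf c))"
      unfolding char_def using f(1) by (subst integral_bounded_linear) (auto intro: P.integrable_iexp)
    also have "\<dots> = f (\<integral>n. char (conv_power U n) u \<partial>measure_pmf (poisson_pmf c))"
      using f(1) bounded by (intro integral_bounded_linear measure_pmf.integrable_const_bound[where B=1]) auto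
    finally show ?thesis .
  qed
  have "char (compound_poisson c U) u = (\<integral>n. char (conv_power U n) u \<partial>measure_pmf (poisson_pmf c))"
    using part[OF bounded_linear_Re abs_Re_le_cmod] part[OF bounded_linear_Im abs_Im_le_cmod]
    by (rule complex_eqI)
  also have "\<dots> = exp (of_real c * (char U u - 1))"
    unfolding char_conv_power[OF U] by (intro integral_poisson_power c U.cmod_char_le_1)
  finally show ?thesis .
qed

lemma compound_poisson_weight_le:
  assumes g: "submultiplicative_weight g" and int: "integrable U g"
  shows "(\<integral>\<^sup>+y. ennreal (g y) \<partial>compound_poisson c U) \<le> ennreal (exp (c * (integral\<^sup>L U g - 1)))"
proof -
  have nonneg: "0 \<le> g y" for y using g by (simp add: submultiplicative_weight_def)
  have "(\<integral>\<^sup>+y. ennreal (g y) \<partial>compound_poisson c U)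
      = (\<integral>\<^sup>+n. \<integral>\<^sup>+y. ennreal (g y) \<partial>conv_power U n \<partial>measure_pmf (poisson_pmf c))"
    unfolding compound_poisson_def using submultiplicative_weight_measurable[OF g]
    by (intro nn_integral_bind[OF _ conv_power_kernel]) simp
  also have "\<dots> \<le> (\<integral>\<^sup>+n. (\<integral>\<^sup>+y. ennreal (g y) \<partial>U) ^ n \<partial>measure_pmf (poisson_pmf c))"
    by (intro nn_integral_mono nn_integral_conv_power_le U g)
  also have "(\<integral>\<^sup>+y. ennreal (g y) \<partial>U) = ennreal (integral\<^sup>L U g)"
    using int nonneg by (intro nn_integral_eq_integral) auto
  also have "(\<integral>\<^sup>+n. ennreal (integral\<^sup>L U g) ^ n \<partial>measure_pmf (poisson_pmf c))
      = ennreal (exp (c * (integral\<^sup>L U g - 1)))"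
    using c nonneg by (intro nn_integral_poisson_power integral_nonneg) auto
  finally show ?thesis .
qed

end

text \<open>The integral bound records the moments that survive the passage to weak limits.\<close>

definition pure_jump_law :: "real measure \<Rightarrow> real \<Rightarrow> real measure \<Rightarrow> bool" where
  "pure_jump_law \<nu> h \<rho> \<longleftrightarrow> real_distribution \<rho> \<and>
     (\<forall>u. char \<rho> u = exp (complex_of_real h * (CLINT y|\<nu>. iexp (u * y) - 1))) \<and>
     (\<forall>g. submultiplicative_weight g \<longrightarrow> integrable \<nu> (\<lambda>y. g y - 1) \<longrightarrow>
        integrable \<rho> g \<and> integral\<^sup>L \<rho> g \<le> exp (h * (\<integral>y. g y - 1 \<partial>\<nu>)))"

lemma
  assumes "pure_jump_law \<nu> h \<rho>"
  shows real_distribution_pure_jump_law: "real_distribution \<rho>"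
    and char_pure_jump_law: "char \<rho> u = exp (complex_of_real h * (CLINT y|\<nu>. iexp (u * y) - 1))"
    and integrable_weight_pure_jump_law: "submultiplicative_weight g \<Longrightarrow> integrable \<nu> (\<lambda>y. g y - 1) \<Longrightarrow> integrable \<rho> g"
    and integral_weight_pure_jump_law: "submultiplicative_weight g \<Longrightarrow> integrable \<nu> (\<lambda>y. g y - 1) \<Longrightarrow>
      integral\<^sup>L \<rho> g \<le> exp (h * (\<integral>y. g y - 1 \<partial>\<nu>))"
  using assms unfolding pure_jump_law_def by blast+

lemma submultiplicative_weight_exp: "submultiplicative_weight exp"
  by (simp add: submultiplicative_weight_def exp_add continuous_on_exp)

lemma submultiplicative_weight_max_exp: "submultiplicative_weight (\<lambda>y. max 1 (exp y))"
proof -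
  have "max 1 (exp (x + y)) \<le> max 1 (exp x) * max 1 (exp y)" for x y :: real
  proof (rule max.boundedI)
    show "1 \<le> max 1 (exp x) * max 1 (exp y)"
      using mult_mono[of 1 "max 1 (exp x)" 1 "max 1 (exp y)"] by simp
    show "exp (x + y) \<le> max 1 (exp x) * max 1 (exp y)" unfolding exp_add by (intro mult_mono) auto
  qed
  then show ?thesis by (auto simp: submultiplicative_weight_def intro!: continuous_intros)
qed

lemma submultiplicative_weight_min_exp: "submultiplicative_weight (\<lambda>y. 2 - min 1 (exp y))"
proof -
  have "2 - min 1 (exp (x + y)) \<le> (2 - min 1 (exp x)) * (2 - min 1 (exp y))" for x y :: real
  proof -
    define a b where "a = min 1 (exp x)" and "b = min 1 (exp y)"
    have "a * b \<le> min 1 (exp (x + y))"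
      unfolding exp_add a_def b_def by (intro min.boundedI mult_mono mult_le_one) auto
    moreover have "0 \<le> 2 * ((1 - a) * (1 - b))" by (simp add: a_def b_def)
    moreover have "(2 - a) * (2 - b) = 2 * ((1 - a) * (1 - b)) + 2 - a * b" by (simp add: algebra_simps)
    ultimately show ?thesis unfolding a_def[symmetric] b_def[symmetric] by linarith
  qed
  then show ?thesis by (auto simp: submultiplicative_weight_def intro!: continuous_intros)
qed

lemma submultiplicative_weight_truncated_abs:
  assumes "0 < R"
  shows "submultiplicative_weight (\<lambda>y. 1 + min 1 (\<bar>y\<bar> / R))"
proof -
  have "1 + min 1 (\<bar>x + y\<bar> / R) \<le> (1 + min 1 (\<bar>x\<bar> / R)) * (1 + min 1 (\<bar>y\<bar> / R))" for x y
  proof -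
    have "\<bar>x + y\<bar> / R \<le> \<bar>x\<bar> / R + \<bar>y\<bar> / R"
      using assms by (simp add: add_divide_distrib[symmetric] divide_right_mono)
    moreover have nonneg: "0 \<le> \<bar>x\<bar> / R" "0 \<le> \<bar>y\<bar> / R" using assms by auto
    ultimately have "min 1 (\<bar>x + y\<bar> / R) \<le> min 1 (\<bar>x\<bar> / R) + min 1 (\<bar>y\<bar> / R)" by linarith
    also have "\<dots> \<le> min 1 (\<bar>x\<bar> / R) + min 1 (\<bar>y\<bar> / R) + min 1 (\<bar>x\<bar> / R) * min 1 (\<bar>y\<bar> / R)"
      using nonneg by simp
    finally show ?thesis by (simp add: algebra_simps)
  qed
  then show ?thesis using assms
    by (auto simp: submultiplicative_weight_def intro!: continuous_intros add_nonneg_nonneg)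
qed

lemma pure_jump_law_null:
  assumes "AE y in \<nu>. False"
  shows "pure_jump_law \<nu> h (return borel 0)"
proof -
  interpret r: prob_space "return borel (0::real)" by (rule prob_space_return) simp
  have r: "real_distribution (return borel (0::real))" by (auto intro!: real_distributionI prob_space_return)
  have null: "(CLINT y|\<nu>. iexp (u * y) - 1) = 0" "(\<integral>y. g y - 1 \<partial>\<nu>) = 0" for u and g :: "real \<Rightarrow> real"
    using assms by (auto intro!: integral_eq_zero_AE)
  have "integrable (return borel 0) g \<and> integral\<^sup>L (return borel 0) g = 1" if "submultiplicative_weight g" for g
    using that submultiplicative_weight_measurable[OF that]
    by (auto simp: integral_return submultiplicative_weight_def AE_return
        intro!: r.integrable_const_bound[where B="norm (g 0)"])
  then show ?thesis using r unfolding pure_jump_law_def null by (simp add: char_def integral_return)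
qed

lemma pure_jump_law_compound_poisson:
  assumes "finite_measure \<nu>" and [measurable_cong]: "sets \<nu> = sets borel" and h: "0 < h"
    and m: "0 < m" "m = measure \<nu> (space \<nu>)"
  shows "pure_jump_law \<nu> h (compound_poisson (h * m) (density \<nu> (\<lambda>_. ennreal (1 / m))))"
proof -
  interpret finite_measure \<nu> by fact
  define U where "U = density \<nu> (\<lambda>_. ennreal (1 / m))"
  have "emeasure U (space U) = 1"
    using m by (simp add: U_def emeasure_density nn_integral_cmult_indicator emeasure_eq_measure
        ennreal_mult[symmetric] flip: ennreal_1)
  then have U: "real_distribution U"
    using assms(2) by (intro real_distributionI prob_spaceI) (simp_all add: U_def)
  interpret U: real_distribution U by (rule U)
  have hm: "0 < h * m" using h m by simp
  have U_integral: "integrable U f \<longleftrightarrow> integrable \<nu> f" "integral\<^sup>L U f = (1 / m) *\<^sub>R integral\<^sup>L \<nu> f"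
    if "f \<in> borel_measurable borel" for f :: "real \<Rightarrow> 'b::{banach, second_countable_topology}"
    using that m(1) integrable_scaleR_right[of m \<nu> "\<lambda>y. (1 / m) *\<^sub>R f y"] unfolding U_def
    by (auto simp: integrable_density integral_density)
  show ?thesis
    unfolding pure_jump_law_def U_def[symmetric]
  proof (intro conjI allI impI)
    show "real_distribution (compound_poisson (h * m) U)" by (rule real_distribution_compound_poisson[OF U hm])
    fix u
    have "integrable \<nu> (\<lambda>y. iexp (u * y))"
      by (rule U_integral(1)[THEN iffD1]) (simp_all add: U.integrable_iexp)
    then have "complex_of_real (h * m) * (char U u - 1) = complex_of_real h * (CLINT y|\<nu>. iexp (u * y) - 1)"
      using m by (simp add: char_def U_integral scaleR_conv_of_real algebra_simps)
    then show "char (compound_poisson (h * m) U) u = exp (complex_of_real h * (CLINT y|\<nu>. iexp (u * y) - 1))"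
      by (simp only: char_compound_poisson[OF U hm])
  next
    fix g assume g: "submultiplicative_weight g" and "integrable \<nu> (\<lambda>y. g y - 1)"
    from Bochner_Integration.integrable_add[OF this(2), of "\<lambda>_. 1"] have int: "integrable \<nu> g" by simp
    note [measurable] = submultiplicative_weight_measurable[OF g]
    interpret C: real_distribution "compound_poisson (h * m) U"
      by (rule real_distribution_compound_poisson[OF U hm])
    have rate: "h * m * (integral\<^sup>L U g - 1) = h * (\<integral>y. g y - 1 \<partial>\<nu>)"
      using int m by (simp add: U_integral algebra_simps)
    have "(\<integral>\<^sup>+y. ennreal (g y) \<partial>compound_poisson (h * m) U) \<le> ennreal (exp (h * (\<integral>y. g y - 1 \<partial>\<nu>)))"
      using compound_poisson_weight_le[OF U hm g] U_integral(1)[of g] int unfolding rate by simp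
    then show "integrable (compound_poisson (h * m) U) g"
      "integral\<^sup>L (compound_poisson (h * m) U) g \<le> exp (h * (\<integral>y. g y - 1 \<partial>\<nu>))"
      using g by (auto intro!: integrableI_nonneg intro: le_less_trans
          simp: submultiplicative_weight_def integral_eq_nn_integral enn2real_leI)
  qed
qed

lemma ex_pure_jump_law_finite:
  assumes "finite_measure \<nu>" "sets \<nu> = sets borel" "0 < h"
  shows "\<exists>\<rho>. pure_jump_law \<nu> h \<rho>"
proof (cases "measure \<nu> (space \<nu>) = 0")
  case True
  interpret finite_measure \<nu> by fact
  have "AE y in \<nu>. False" using True by (intro AE_I'[of "space \<nu>"]) (auto simp: emeasure_eq_measure)
  then show ?thesis by (blast intro: pure_jump_law_null)
next
  case False
  then show ?thesis
    using pure_jump_law_compound_poisson[OF assms] by (auto simp: zero_less_measure_iff)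
qed

lemma integrable_of_truncations:
  fixes g :: "'a \<Rightarrow> real"
  assumes "finite_measure M" and [measurable]: "g \<in> borel_measurable M" and nonneg: "\<And>y. 0 \<le> g y"
    and truncations_le: "\<And>k::nat. (\<integral>y. min (g y) (real k) \<partial>M) \<le> c"
  shows "integrable M g" "integral\<^sup>L M g \<le> c"
proof -
  interpret finite_measure M by fact
  have int: "integrable M (\<lambda>y. min (g y) (real k))" for k
    using nonneg by (intro integrable_const_bound[where B="real k"]) auto
  have "incseq (\<lambda>k. \<integral>y. min (g y) (real k) \<partial>M)"
    by (intro incseq_SucI integral_mono int) auto
  then obtain l where l: "(\<lambda>k. \<integral>y. min (g y) (real k) \<partial>M) \<longlonglongrightarrow> l"
    using incseq_convergent truncations_le by metis
  have "(\<lambda>k. min (g y) (real k)) \<longlonglongrightarrow> g y" for y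
  proof (rule tendsto_eventually)
    obtain k0 where k0: "g y \<le> real k0" using real_arch_simple by blast
    show "eventually (\<lambda>k. min (g y) (real k) = g y) sequentially"
      by (rule eventually_sequentiallyI[of k0]) (use k0 in auto)
  qed
  then have "has_bochner_integral M g l"
    by (intro has_bochner_integral_monotone_convergence[OF int _ _ l]) (auto simp: mono_def)
  moreover have "l \<le> c" using l truncations_le by (intro LIMSEQ_le_const2[OF l]) auto
  ultimately show "integrable M g" "integral\<^sup>L M g \<le> c" by (auto simp: has_bochner_integral_iff)
qed

locale finite_variation_levy_measure =
  fixes \<nu> :: "real measure"
  assumes levy_measure: "levy_measure \<nu>"
    and exp_mom: "integrable \<nu> (\<lambda>y. indicator {y. \<bar>y\<bar> \<ge> 1} y * exp y)"
    and fin_var: "integrable \<nu> (\<lambda>y. indicator {y. \<bar>y\<bar> \<le> 1} y * \<bar>y\<bar>)"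
begin

lemma sets_\<nu> [measurable_cong]: "sets \<nu> = sets borel"
  using levy_measure by (simp add: levy_measure_def)

lemma integrable_min_abs: "integrable \<nu> (\<lambda>y. min 1 \<bar>y\<bar>)"
proof (rule Bochner_Integration.integrable_bound)
  show "integrable \<nu> (\<lambda>y. indicator {y. \<bar>y\<bar> \<le> 1} y * \<bar>y\<bar> + min 1 (y\<^sup>2))"
    using fin_var levy_measure by (intro Bochner_Integration.integrable_add) (auto simp: levy_measure_def)
  have "min 1 \<bar>y\<bar> \<le> indicator {y. \<bar>y\<bar> \<le> 1} y * \<bar>y\<bar> + min 1 (y\<^sup>2)" for y :: real
  proof (cases "\<bar>y\<bar> \<le> 1")
    case False
    then have "1 \<le> y\<^sup>2" using power_mono[of 1 "\<bar>y\<bar>" 2] by simp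
    then show ?thesis by (simp add: False)
  qed simp
  then show "AE y in \<nu>. norm (min 1 \<bar>y\<bar>) \<le> norm (indicator {y. \<bar>y\<bar> \<le> 1} y * \<bar>y\<bar> + min 1 (y\<^sup>2))"
    by (intro AE_I2) (auto simp: abs_of_nonneg)
qed measurable

lemma integrable_of_bound_near_zero:
  fixes f :: "real \<Rightarrow> 'b::{banach, second_countable_topology}"
  assumes [measurable]: "f \<in> borel_measurable borel" and "\<And>y. norm (f y) \<le> C * min 1 \<bar>y\<bar>"
  shows "integrable \<nu> f"
proof (rule Bochner_Integration.integrable_bound)
  show "integrable \<nu> (\<lambda>y. C * min 1 \<bar>y\<bar>)" using integrable_min_abs by simp
  show "AE y in \<nu>. norm (f y) \<le> norm (C * min 1 \<bar>y\<bar>)"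
    using assms(2) by (intro AE_I2) (auto intro: order_trans[OF _ abs_ge_self])
qed measurable

lemma integrable_exp_minus_one: "integrable \<nu> (\<lambda>y. exp y - 1)"
proof (rule Bochner_Integration.integrable_bound)
  show "integrable \<nu> (\<lambda>y. 3 * min 1 \<bar>y\<bar> + indicator {y. \<bar>y\<bar> \<ge> 1} y * exp y)"
    using exp_mom integrable_min_abs by (intro Bochner_Integration.integrable_add) auto
  have "\<bar>exp y - 1\<bar> \<le> 3 * min 1 \<bar>y\<bar> + indicator {y. \<bar>y\<bar> \<ge> 1} y * exp y" for y :: real
  proof (cases "\<bar>y\<bar> < 1")
    case True
    have "\<bar>exp y - 1\<bar> \<le> 3 * \<bar>y\<bar>"
    proof (cases "0 \<le> y")
      case True
      have "exp y \<le> 1 + y + y\<^sup>2" using \<open>\<bar>y\<bar> < 1\<close> True by (intro exp_bound) auto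
      moreover have "y\<^sup>2 \<le> y" using \<open>\<bar>y\<bar> < 1\<close> True by (simp add: power2_eq_square mult_left_le)
      ultimately show ?thesis using True by auto
    next
      case False
      have "1 + y \<le> exp y" "exp y < 1" using False by auto
      then show ?thesis using False by linarith
    qed
    then show ?thesis using True by (simp add: indicator_def)
  next
    case False
    have "\<bar>exp y - 1\<bar> \<le> exp y + 1" by (simp add: abs_if add_nonneg_nonneg)
    then show ?thesis using False by (simp add: indicator_def)
  qed
  then show "AE y in \<nu>. norm (exp y - 1) \<le> norm (3 * min 1 \<bar>y\<bar> + indicator {y. \<bar>y\<bar> \<ge> 1} y * exp y)"
    by (intro AE_I2) (auto simp: abs_of_nonneg)
qed measurable

lemma integrable_iexp_minus_one: "integrable \<nu> (\<lambda>y. iexp (u * y) - 1)"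
proof (rule integrable_of_bound_near_zero[where C="2 + \<bar>u\<bar>"])
  fix y :: real
  show "norm (iexp (u * y) - 1) \<le> (2 + \<bar>u\<bar>) * min 1 \<bar>y\<bar>"
  proof (cases "1 \<le> \<bar>y\<bar>")
    case True
    have "norm (iexp (u * y) - 1) \<le> norm (iexp (u * y)) + norm (1::complex)" by (rule norm_triangle_ineq4)
    then show ?thesis using True by simp
  next
    case False
    have "norm (iexp (u * y) - 1) \<le> \<bar>u * y\<bar>" using iexp_approx1[of "u * y" 0] by simp
    also have "\<dots> \<le> (2 + \<bar>u\<bar>) * \<bar>y\<bar>" by (simp add: abs_mult mult_right_mono)
    finally show ?thesis using False by simp
  qed
qed simp

definition jumps_above :: "nat \<Rightarrow> real measure" where
  "jumps_above n = density \<nu> (\<lambda>y. ennreal (indicator {y. 1 / real (Suc n) \<le> \<bar>y\<bar>} y))"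

lemma sets_jumps_above [measurable_cong]: "sets (jumps_above n) = sets borel"
  by (simp add: jumps_above_def sets_\<nu>)

lemma finite_measure_jumps_above: "finite_measure (jumps_above n)"
proof
  let ?E = "{y. 1 / real (Suc n) \<le> \<bar>y\<bar>}"
  have "{y\<in>space \<nu>. 1 / real (Suc n) \<le> min 1 \<bar>y\<bar>} = ?E"
    using sets_eq_imp_space_eq[OF sets_\<nu>] by auto
  then have "emeasure \<nu> ?E \<le> ennreal (1 / (1 / real (Suc n)) * (\<integral>y. min 1 \<bar>y\<bar> \<partial>\<nu>))"
    using integral_Markov_inequality[OF integrable_min_abs, of "1 / real (Suc n)"] by simp
  moreover have "emeasure (jumps_above n) (space (jumps_above n)) = emeasure \<nu> ?E"
    using sets_eq_imp_space_eq[OF sets_\<nu>]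
    by (simp add: jumps_above_def emeasure_density ennreal_indicator del: of_nat_Suc)
  ultimately show "emeasure (jumps_above n) (space (jumps_above n)) \<noteq> \<infinity>" by (auto simp: top_unique)
qed

lemma
  fixes f :: "real \<Rightarrow> 'b::{banach, second_countable_topology}"
  assumes f: "integrable \<nu> f"
  shows integrable_jumps_above: "integrable (jumps_above n) f"
    and integral_jumps_above: "integral\<^sup>L (jumps_above n) f
      = (\<integral>y. indicator {y. 1 / real (Suc n) \<le> \<bar>y\<bar>} y *\<^sub>R f y \<partial>\<nu>)"
  using integrable_mult_indicator[OF _ f, of "{y. 1 / real (Suc n) \<le> \<bar>y\<bar>}"] borel_measurable_integrable[OF f]
  by (simp_all add: jumps_above_def integrable_density integral_density sets_\<nu> del: of_nat_Suc)

lemma integral_jumps_above_le: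
  fixes f :: "real \<Rightarrow> real"
  assumes "integrable \<nu> f" "\<And>y. 0 \<le> f y"
  shows "integral\<^sup>L (jumps_above n) f \<le> integral\<^sup>L \<nu> f"
  unfolding integral_jumps_above[OF assms(1)]
  by (rule integral_mono'[OF assms(1)]) (auto simp: indicator_def assms(2))

lemma tendsto_integral_jumps_above:
  fixes f :: "real \<Rightarrow> 'b::{banach, second_countable_topology}"
  assumes f: "integrable \<nu> f"
  shows "(\<lambda>n. integral\<^sup>L (jumps_above n) f) \<longlonglongrightarrow> integral\<^sup>L \<nu> f"
proof -
  let ?E = "\<lambda>n. {y. 1 / real (Suc n) \<le> \<bar>y\<bar>}"
  have "AE y in \<nu>. y \<noteq> 0"
    using levy_measure by (intro AE_I[where N="{0}"]) (auto simp: levy_measure_def)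
  then have "AE y in \<nu>. (\<lambda>n. indicator (?E n) y *\<^sub>R f y) \<longlonglongrightarrow> f y"
  proof eventually_elim
    case (elim y)
    have "eventually (\<lambda>n. 1 / real (Suc n) < \<bar>y\<bar>) sequentially"
      using elim by (intro order_tendstoD(2)[OF LIMSEQ_Suc[OF lim_1_over_n]]) simp
    then have "eventually (\<lambda>n. indicator (?E n) y *\<^sub>R f y = f y) sequentially"
      by eventually_elim (simp del: of_nat_Suc)
    then show ?case by (rule tendsto_eventually)
  qed
  then show ?thesis
    unfolding integral_jumps_above[OF f] using f borel_measurable_integrable[OF f]
    by (intro integral_dominated_convergence[where w="\<lambda>y. norm (f y)"]) (auto simp: indicator_def)
qed

lemma tendsto_integral_truncated_abs: "(\<lambda>k. \<integral>y. min 1 (\<bar>y\<bar> / real (Suc k)) \<partial>\<nu>) \<longlonglongrightarrow> 0"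
proof -
  have "(\<lambda>k. \<integral>y. min 1 (\<bar>y\<bar> / real (Suc k)) \<partial>\<nu>) \<longlonglongrightarrow> (\<integral>y. 0 \<partial>\<nu>)"
  proof (rule integral_dominated_convergence[where w="\<lambda>y. min 1 \<bar>y\<bar>"])
    have "(\<lambda>k. min 1 (\<bar>y\<bar> / real (Suc k))) \<longlonglongrightarrow> min 1 0" for y :: real
      by (intro tendsto_min tendsto_const LIMSEQ_Suc[OF lim_const_over_n])
    then show "AE y in \<nu>. (\<lambda>k. min 1 (\<bar>y\<bar> / real (Suc k))) \<longlonglongrightarrow> 0" by simp
    have "\<bar>y\<bar> / real (Suc k) \<le> \<bar>y\<bar>" for y k
      using divide_left_mono[of 1 "real (Suc k)" "\<bar>y\<bar>"] by simp
    then show "AE y in \<nu>. norm (min 1 (\<bar>y\<bar> / real (Suc k))) \<le> min 1 \<bar>y\<bar>" for k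
      by (intro AE_I2) (auto simp: min_def intro: order_trans)
  qed (auto simp: integrable_min_abs)
  then show ?thesis by simp
qed

lemma pure_jump_law_tail_le:
  assumes \<rho>: "pure_jump_law (jumps_above n) h \<rho>" and h: "0 \<le> h" and R: "0 < R"
    and int: "integrable \<nu> (\<lambda>y. min 1 (\<bar>y\<bar> / R))"
  shows "measure \<rho> {y. R \<le> \<bar>y\<bar>} \<le> exp (h * (\<integral>y. min 1 (\<bar>y\<bar> / R) \<partial>\<nu>)) - 1"
proof -
  let ?g = "\<lambda>y. 1 + min 1 (\<bar>y\<bar> / R)"
  interpret real_distribution \<rho> by (rule real_distribution_pure_jump_law[OF \<rho>])
  have "integrable (jumps_above n) (\<lambda>y. ?g y - 1)" using integrable_jumps_above[OF int] by simp
  note weight = submultiplicative_weight_truncated_abs[OF R] this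
  have "integrable \<rho> ?g" by (rule integrable_weight_pure_jump_law[OF \<rho> weight])
  from Bochner_Integration.integrable_diff[OF this, of "\<lambda>_. 1"]
  have int_\<rho>: "integrable \<rho> (\<lambda>y. min 1 (\<bar>y\<bar> / R))" by simp
  have "measure \<rho> {y\<in>space \<rho>. 1 \<le> min 1 (\<bar>y\<bar> / R)} \<le> (\<integral>y. min 1 (\<bar>y\<bar> / R) \<partial>\<rho>) / 1"
    using R by (intro integral_Markov_inequality_measure[OF int_\<rho> sets.empty_sets]) auto
  also have "{y\<in>space \<rho>. 1 \<le> min 1 (\<bar>y\<bar> / R)} = {y. R \<le> \<bar>y\<bar>}" using R by (auto simp: le_divide_eq)
  also have "(\<integral>y. min 1 (\<bar>y\<bar> / R) \<partial>\<rho>) / 1 = integral\<^sup>L \<rho> ?g - 1"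
    using int_\<rho> prob_space by simp
  also have "integral\<^sup>L \<rho> ?g \<le> exp (h * (\<integral>y. min 1 (\<bar>y\<bar> / R) \<partial>jumps_above n))"
    using integral_weight_pure_jump_law[OF \<rho> weight] by simp
  also have "\<dots> \<le> exp (h * (\<integral>y. min 1 (\<bar>y\<bar> / R) \<partial>\<nu>))"
    using R h by (auto intro!: mult_left_mono integral_jumps_above_le int)
  finally show ?thesis by simp
qed

lemma tight_pure_jump_laws:
  assumes \<rho>: "\<And>n. pure_jump_law (jumps_above n) h (\<rho> n)" and h: "0 \<le> h"
  shows "tight \<rho>"
  unfolding tight_def
proof (intro conjI allI impI)
  show dist: "real_distribution (\<rho> n)" for n by (rule real_distribution_pure_jump_law[OF \<rho>])
  fix \<epsilon> :: real assume "0 < \<epsilon>"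
  let ?J = "\<lambda>k. \<integral>y. min 1 (\<bar>y\<bar> / real (Suc k)) \<partial>\<nu>"
  have "(\<lambda>k. exp (h * ?J k) - 1) \<longlonglongrightarrow> exp (h * 0) - 1"
    by (intro tendsto_intros tendsto_integral_truncated_abs)
  then have "eventually (\<lambda>k. exp (h * ?J k) - 1 < \<epsilon>) sequentially"
    using \<open>0 < \<epsilon>\<close> by (intro order_tendstoD(2)) auto
  then obtain k where k: "exp (h * ?J k) - 1 < \<epsilon>" by (auto simp: eventually_sequentially)
  let ?R = "real (Suc k)"
  have int: "integrable \<nu> (\<lambda>y. min 1 (\<bar>y\<bar> / ?R))"
  proof (rule integrable_of_bound_near_zero[where C=1])
    fix y :: real
    show "norm (min 1 (\<bar>y\<bar> / ?R)) \<le> 1 * min 1 \<bar>y\<bar>"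
      using divide_left_mono[of 1 ?R "\<bar>y\<bar>"] by (auto simp: min_def)
  qed simp
  have "1 - \<epsilon> < measure (\<rho> n) {-?R<..?R}" for n
  proof -
    interpret real_distribution "\<rho> n" by (rule dist)
    have "1 - measure (\<rho> n) {y. ?R \<le> \<bar>y\<bar>} = measure (\<rho> n) (space (\<rho> n) - {y. ?R \<le> \<bar>y\<bar>})"
      by (rule prob_compl[symmetric]) simp
    also have "\<dots> \<le> measure (\<rho> n) {-?R<..?R}" by (intro finite_measure_mono) auto
    finally show ?thesis using pure_jump_law_tail_le[OF \<rho> h _ int, of n] k by simp
  qed
  then show "\<exists>a b. a < b \<and> (\<forall>n. 1 - \<epsilon> < measure (\<rho> n) {a<..b})"
    by (intro exI[of _ "-?R"] exI[of _ ?R]) simp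
qed

lemma pure_jump_law_weak_limit:
  assumes \<pi>: "\<And>n. pure_jump_law (jumps_above (s n)) h (\<pi> n)" and s: "strict_mono s"
    and \<rho>: "real_distribution \<rho>" and conv: "weak_conv_m \<pi> \<rho>"
  shows "pure_jump_law \<nu> h \<rho>"
proof -
  interpret real_distribution \<rho> by (rule \<rho>)
  note \<pi>_dist = real_distribution_pure_jump_law[OF \<pi>]
  have lim: "(\<lambda>n. integral\<^sup>L (jumps_above (s n)) f) \<longlonglongrightarrow> integral\<^sup>L \<nu> f"
    if "integrable \<nu> f" for f :: "real \<Rightarrow> 'b::{banach, second_countable_topology}"
    using LIMSEQ_subseq_LIMSEQ[OF tendsto_integral_jumps_above[OF that] s] by (simp add: comp_def)
  show ?thesis
    unfolding pure_jump_law_def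
  proof (intro conjI allI impI)
    show "real_distribution \<rho>" by (rule \<rho>)
    show "char \<rho> u = exp (complex_of_real h * (CLINT y|\<nu>. iexp (u * y) - 1))" for u
    proof (rule LIMSEQ_unique)
      show "(\<lambda>n. char (\<pi> n) u) \<longlonglongrightarrow> char \<rho> u" by (rule levy_continuity1[OF \<pi>_dist \<rho> conv])
      show "(\<lambda>n. char (\<pi> n) u) \<longlonglongrightarrow> exp (complex_of_real h * (CLINT y|\<nu>. iexp (u * y) - 1))"
        unfolding char_pure_jump_law[OF \<pi>] by (intro tendsto_intros lim integrable_iexp_minus_one)
    qed
    fix g assume g: "submultiplicative_weight g" and int: "integrable \<nu> (\<lambda>y. g y - 1)"
    note weight = g integrable_jumps_above[OF int]
    have cont: "isCont g y" and nonneg: "0 \<le> g y" for y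
      using g by (simp_all add: submultiplicative_weight_def continuous_on_eq_continuous_at)
    have truncated: "(\<integral>y. min (g y) (real k) \<partial>\<rho>) \<le> exp (h * (\<integral>y. g y - 1 \<partial>\<nu>))" for k :: nat
    proof (rule LIMSEQ_le)
      have "isCont (\<lambda>y. min (g y) (real k)) y" "norm (min (g y) (real k)) \<le> real k" for y
        using cont[of y] nonneg[of y] by (simp_all add: isCont_def tendsto_min)
      then show "(\<lambda>n. \<integral>y. min (g y) (real k) \<partial>\<pi> n) \<longlonglongrightarrow> (\<integral>y. min (g y) (real k) \<partial>\<rho>)"
        by (rule weak_conv_imp_integral_bdd_continuous_conv[OF \<pi>_dist \<rho> conv])
      show "(\<lambda>n. exp (h * (\<integral>y. g y - 1 \<partial>jumps_above (s n)))) \<longlonglongrightarrow> exp (h * (\<integral>y. g y - 1 \<partial>\<nu>))"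
        by (intro tendsto_intros lim int)
      have "(\<integral>y. min (g y) (real k) \<partial>\<pi> n) \<le> integral\<^sup>L (\<pi> n) g" for n
        using nonneg by (intro integral_mono' integrable_weight_pure_jump_law[OF \<pi> weight]) auto
      then show "\<exists>n0. \<forall>n\<ge>n0. (\<integral>y. min (g y) (real k) \<partial>\<pi> n) \<le> exp (h * (\<integral>y. g y - 1 \<partial>jumps_above (s n)))"
        using order_trans[OF _ integral_weight_pure_jump_law[OF \<pi> weight]] by blast
    qed
    have "g \<in> borel_measurable \<rho>" using submultiplicative_weight_measurable[OF g] by simp
    from integrable_of_truncations[OF finite_measure_axioms this nonneg truncated]
    show "integrable \<rho> g" "integral\<^sup>L \<rho> g \<le> exp (h * (\<integral>y. g y - 1 \<partial>\<nu>))" .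
  qed
qed

theorem ex_pure_jump_law:
  assumes h: "0 < h"
  shows "\<exists>\<rho>. pure_jump_law \<nu> h \<rho>"
proof -
  have "\<forall>n. \<exists>\<rho>. pure_jump_law (jumps_above n) h \<rho>"
    using ex_pure_jump_law_finite finite_measure_jumps_above sets_jumps_above h by blast
  then obtain \<pi> where \<pi>: "\<And>n. pure_jump_law (jumps_above n) h (\<pi> n)" by metis
  obtain s \<rho> where s: "strict_mono s" and \<rho>: "real_distribution \<rho>" and "weak_conv_m (\<pi> \<circ> id \<circ> s) \<rho>"
    using tight_imp_convergent_subsubsequence[OF tight_pure_jump_laws[OF \<pi> less_imp_le[OF h]] strict_mono_id]
    by blast
  then have "weak_conv_m (\<lambda>n. \<pi> (s n)) \<rho>" by (simp add: comp_def)
  from pure_jump_law_weak_limit[OF \<pi> s \<rho> this] show ?thesis by blast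
qed

definition up_rate :: real where "up_rate = (\<integral>y. max 0 (exp y - 1) \<partial>\<nu>)"

definition down_rate :: real where "down_rate = (\<integral>y. max 0 (1 - exp y) \<partial>\<nu>)"

definition jump_drift :: real where "jump_drift = up_rate - down_rate"

lemma up_rate_nonneg: "0 \<le> up_rate" and down_rate_nonneg: "0 \<le> down_rate"
  unfolding up_rate_def down_rate_def by simp_all

lemma integrable_up: "integrable \<nu> (\<lambda>y. max 0 (exp y - 1))"
  and integrable_down: "integrable \<nu> (\<lambda>y. max 0 (1 - exp y))"
  by (rule Bochner_Integration.integrable_bound[OF integrable_exp_minus_one]; auto)+

lemma integral_exp_minus_one: "(\<integral>y. exp y - 1 \<partial>\<nu>) = jump_drift"
proof -
  have "(\<integral>y. exp y - 1 \<partial>\<nu>) = (\<integral>y. max 0 (exp y - 1) - max 0 (1 - exp y) \<partial>\<nu>)"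
    by (intro Bochner_Integration.integral_cong) auto
  then show ?thesis
    using integrable_up integrable_down by (simp add: jump_drift_def up_rate_def down_rate_def)
qed

lemma levy_exponent_eq:
  assumes "\<sigma>\<^sup>2 / 2 + \<gamma> + (\<integral>y. exp y - 1 - y * indicator {y. \<bar>y\<bar> \<le> 1} y \<partial>\<nu>) = 0"
  shows "levy_exponent \<sigma> \<gamma> \<nu> u = \<i> * complex_of_real (u * (- \<sigma>\<^sup>2 / 2 - jump_drift))
    - complex_of_real (\<sigma>\<^sup>2 * u\<^sup>2 / 2) + (CLINT y|\<nu>. iexp (u * y) - 1)"
proof -
  have small: "integrable \<nu> (\<lambda>y. y * indicator {y. \<bar>y\<bar> \<le> 1} y)"
    by (rule Bochner_Integration.integrable_bound[OF fin_var]) (auto simp: indicator_def)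
  define s where "s = (\<integral>y. y * indicator {y. \<bar>y\<bar> \<le> 1} y \<partial>\<nu>)"
  have \<gamma>: "\<gamma> = s - \<sigma>\<^sup>2 / 2 - jump_drift"
    using assms Bochner_Integration.integral_diff[OF integrable_exp_minus_one small]
    by (simp add: s_def integral_exp_minus_one)
  have int: "integrable \<nu> (\<lambda>y. \<i> * complex_of_real (u * y * indicator {y. \<bar>y\<bar> \<le> 1} y))"
    using small by (intro integrable_mult_right integrable_of_real) (simp add: mult.assoc)
  have "(CLINT y|\<nu>. \<i> * complex_of_real (u * y * indicator {y. \<bar>y\<bar> \<le> 1} y)) = \<i> * complex_of_real (u * s)"
    unfolding s_def by (simp add: mult.assoc del: of_real_mult)
  then have "(CLINT y|\<nu>. iexp (u * y) - 1 - \<i> * complex_of_real (u * y * indicator {y. \<bar>y\<bar> \<le> 1} y))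
     = (CLINT y|\<nu>. iexp (u * y) - 1) - \<i> * complex_of_real (u * s)"
    using Bochner_Integration.integral_diff[OF integrable_iexp_minus_one int, of u] by simp
  then show ?thesis unfolding levy_exponent_def \<gamma> by (simp add: algebra_simps)
qed

definition jump_law :: "real \<Rightarrow> real measure" where
  "jump_law h = (SOME \<rho>. pure_jump_law \<nu> h \<rho>)"

lemma pure_jump_law_jump_law: "0 < h \<Longrightarrow> pure_jump_law \<nu> h (jump_law h)"
  unfolding jump_law_def using ex_pure_jump_law by (rule someI_ex)

definition jump_deviation :: "real \<Rightarrow> real" where
  "jump_deviation h = exp (h * up_rate) + exp (h * down_rate) - 2"

lemma jump_deviation_nonneg:
  assumes "0 \<le> h"
  shows "0 \<le> jump_deviation h"
proof -
  have "1 \<le> exp (h * up_rate)" "1 \<le> exp (h * down_rate)"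
    using assms up_rate_nonneg down_rate_nonneg by simp_all
  then show ?thesis unfolding jump_deviation_def by linarith
qed

context
  fixes h :: real
  assumes h: "0 < h"
begin

interpretation jump: real_distribution "jump_law h"
  by (rule real_distribution_pure_jump_law[OF pure_jump_law_jump_law[OF h]])

lemma integrable_exp_jump_law: "integrable (jump_law h) exp"
  and expectation_exp_jump_law_le: "integral\<^sup>L (jump_law h) exp \<le> exp (h * jump_drift)"
  using integrable_weight_pure_jump_law[OF pure_jump_law_jump_law[OF h] submultiplicative_weight_exp]
    integral_weight_pure_jump_law[OF pure_jump_law_jump_law[OF h] submultiplicative_weight_exp]
  by (simp_all add: integrable_exp_minus_one integral_exp_minus_one)

lemma integrable_min_exp_jump_law: "integrable (jump_law h) (\<lambda>y. min 1 (exp y))"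
  by (rule jump.integrable_const_bound[where B=1]) auto

lemma expectation_max_exp_jump_law_le: "(\<integral>y. max 1 (exp y) \<partial>jump_law h) \<le> exp (h * up_rate)"
proof -
  have eq: "max 1 (exp y) - 1 = max 0 (exp y - 1)" for y :: real by auto
  show ?thesis
    using integral_weight_pure_jump_law[OF pure_jump_law_jump_law[OF h] submultiplicative_weight_max_exp] integrable_up
    by (simp add: eq up_rate_def)
qed

lemma expectation_min_exp_jump_law_ge: "2 - exp (h * down_rate) \<le> (\<integral>y. min 1 (exp y) \<partial>jump_law h)"
proof -
  have eq: "2 - min 1 (exp y) - 1 = max 0 (1 - exp y)" for y :: real by auto
  have "(\<integral>y. 2 - min 1 (exp y) \<partial>jump_law h) \<le> exp (h * down_rate)"
    using integral_weight_pure_jump_law[OF pure_jump_law_jump_law[OF h] submultiplicative_weight_min_exp] integrable_down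
    by (simp add: eq down_rate_def)
  then show ?thesis using integrable_min_exp_jump_law jump.prob_space by simp
qed

lemma
  shows integrable_abs_exp_jump_law: "integrable (jump_law h) (\<lambda>y. \<bar>exp y - 1\<bar>)"
    and expectation_abs_exp_jump_law_le: "(\<integral>y. \<bar>exp y - 1\<bar> \<partial>jump_law h) \<le> jump_deviation h"
proof -
  have eq: "(\<lambda>y. \<bar>exp y - 1\<bar>) = (\<lambda>y. max 1 (exp y) - min 1 (exp y :: real))" by auto
  have int: "integrable (jump_law h) (\<lambda>y. max 1 (exp y))"
    using integrable_exp_jump_law by (intro integrable_max) auto
  show "integrable (jump_law h) (\<lambda>y. \<bar>exp y - 1\<bar>)"
    unfolding eq using int integrable_min_exp_jump_law by simp
  show "(\<integral>y. \<bar>exp y - 1\<bar> \<partial>jump_law h) \<le> jump_deviation h"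
    unfolding eq
    using int integrable_min_exp_jump_law expectation_max_exp_jump_law_le expectation_min_exp_jump_law_ge
    by (simp add: jump_deviation_def)
qed

end

end

section \<open>The exponential Levy model and the Black-Scholes model\<close>

lemma antimono_convex_le_expectation_exp:
  fixes f :: "real \<Rightarrow> real"
  assumes "prob_space \<rho>" and exp: "integrable \<rho> exp" "integral\<^sup>L \<rho> exp \<le> c"
    and f: "convex_on {0..} f" "antimono_on {0..} f"
    and int: "integrable \<rho> (\<lambda>y. f (x * exp y))" and x: "0 \<le> x"
  shows "f (x * c) \<le> (\<integral>y. f (x * exp y) \<partial>\<rho>)"
proof (cases "x = 0")
  case True
  interpret prob_space \<rho> by fact
  show ?thesis using True prob_space by simp
next
  case False
  then have pos: "0 < x" using x by simp
  interpret prob_space \<rho> by fact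
  have "0 \<le> c" using order_trans[OF _ exp(2), of 0] by simp
  then have "f (x * c) \<le> f (\<integral>y. x * exp y \<partial>\<rho>)"
    using exp x by (intro monotone_onD[OF f(2)]) (auto intro!: mult_left_mono mult_nonneg_nonneg)
  also have "\<dots> \<le> (\<integral>y. f (x * exp y) \<partial>\<rho>)"
  proof (rule jensens_inequality)
    show "integrable \<rho> (\<lambda>y. x * exp y)" using exp by simp
    show "AE y in \<rho>. x * exp y \<in> {0<..}" using pos by simp
    show "convex_on {0<..} f" by (rule convex_on_subset[OF f(1)]) auto
    show "{0<..} = {0<..<0} \<or> {0<..} = {0::real<..} \<or> {0<..} = {..<0} \<or> {0<..} = (UNIV :: real set)" by simp
  qed (rule int)
  finally show ?thesis .
qed

lemma lipschitz_expectation_exp_le: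
  fixes f :: "real \<Rightarrow> real"
  assumes "prob_space \<rho>" and f: "1-lipschitz_on {0..} f" and int: "integrable \<rho> (\<lambda>y. f (x * exp y))"
    and dev: "integrable \<rho> (\<lambda>y. \<bar>exp y - 1\<bar>)" "(\<integral>y. \<bar>exp y - 1\<bar> \<partial>\<rho>) \<le> e"
    and x: "0 \<le> x" and c: "0 \<le> c"
  shows "(\<integral>y. f (x * exp y) \<partial>\<rho>) \<le> f (x * c) + x * (e + \<bar>c - 1\<bar>)"
proof -
  interpret prob_space \<rho> by fact
  have "(\<integral>y. f (x * exp y) \<partial>\<rho>) \<le> (\<integral>y. f (x * c) + x * (\<bar>exp y - 1\<bar> + \<bar>c - 1\<bar>) \<partial>\<rho>)"
  proof (rule integral_mono[OF int])
    show "integrable \<rho> (\<lambda>y. f (x * c) + x * (\<bar>exp y - 1\<bar> + \<bar>c - 1\<bar>))" using dev by simp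
    fix y
    have "f (x * exp y) - f (x * c) \<le> \<bar>x * exp y - x * c\<bar>"
      using lipschitz_onD[OF f, of "x * exp y" "x * c"] x c by (simp add: dist_real_def abs_le_iff)
    also have "\<dots> = x * \<bar>exp y - c\<bar>" using x by (simp add: right_diff_distrib[symmetric] abs_mult)
    also have "\<dots> \<le> x * (\<bar>exp y - 1\<bar> + \<bar>c - 1\<bar>)" using x by (intro mult_left_mono) auto
    finally show "f (x * exp y) \<le> f (x * c) + x * (\<bar>exp y - 1\<bar> + \<bar>c - 1\<bar>)" by simp
  qed
  also have "\<dots> = f (x * c) + x * ((\<integral>y. \<bar>exp y - 1\<bar> \<partial>\<rho>) + \<bar>c - 1\<bar>)" using dev prob_space by simp
  also have "\<dots> \<le> f (x * c) + x * (e + \<bar>c - 1\<bar>)" using dev x by (intro add_left_mono mult_left_mono) auto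
  finally show ?thesis .
qed

lemma eventually_le_mult_of_deriv:
  fixes f :: "real \<Rightarrow> real"
  assumes "(f has_real_derivative l) (at 0)" "l < c" "f 0 = 0"
  shows "eventually (\<lambda>h. f h \<le> c * h) (at_right 0)"
proof -
  have "((\<lambda>h. f h - c * h) has_real_derivative l - c) (at 0)"
    using assms(1) by (auto intro!: derivative_eq_intros)
  then obtain d where "0 < d" "\<And>h. 0 < h \<Longrightarrow> h < d \<Longrightarrow> f h - c * h < 0"
    using DERIV_neg_dec_right[of "\<lambda>h. f h - c * h" "l - c" 0] assms by auto
  then show ?thesis by (auto simp: eventually_at_right[of 0 1] less_imp_le intro!: exI[of _ d])
qed

locale exp_levy_market = finite_variation_levy_measure \<nu> for \<nu> :: "real measure" +
  fixes M :: "'a measure" and X B :: "real \<Rightarrow> 'a \<Rightarrow> real" and \<sigma> \<gamma> r \<delta> K T :: real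
  assumes triplet: "levy_triplet M X \<sigma> \<gamma> \<nu>"
    and BM: "brownian_motion M (usual_filtration M X) B"
    and mart: "\<sigma>\<^sup>2 / 2 + \<gamma> + (\<integral>y. exp y - 1 - y * indicator {y. \<bar>y\<bar> \<le> 1} y \<partial>\<nu>) = 0"
    and \<sigma>_pos: "0 < \<sigma>" and K_pos: "0 < K" and r_pos: "0 < r" and \<delta>_nonneg: "0 \<le> \<delta>"
begin

sublocale real_levy_process M X
  using triplet by (intro real_levy_processI) (simp add: levy_triplet_def)

definition levy_law :: "real \<Rightarrow> real measure" where
  "levy_law h = distr (distr M borel (X h)) borel (\<lambda>y. (r - \<delta>) * h + y)"

definition bs_law :: "real \<Rightarrow> real measure" where
  "bs_law h = distr (normal_distribution 0 (sqrt h)) borel (\<lambda>y. (r - \<delta> - \<sigma>\<^sup>2 / 2) * h + \<sigma> * y)"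

definition diffusion_law :: "real \<Rightarrow> real measure" where
  "diffusion_law h = normal_distribution ((r - \<delta> - \<sigma>\<^sup>2 / 2 - jump_drift) * h) (\<sigma> * sqrt h)"

definition diffusion_rate :: "nat \<Rightarrow> real" where
  "diffusion_rate j = real j * (r - \<delta> - \<sigma>\<^sup>2 / 2 - jump_drift) + (real j)\<^sup>2 * \<sigma>\<^sup>2 / 2"

context
  fixes h :: real
  assumes h: "0 < h"
begin

lemma real_distribution_diffusion_law: "real_distribution (diffusion_law h)"
  unfolding diffusion_law_def using \<sigma>_pos h by (intro real_distribution_normal) simp

lemma real_distribution_jump_law: "real_distribution (jump_law h)"
  by (rule real_distribution_pure_jump_law[OF pure_jump_law_jump_law[OF h]])

lemma bs_law_eq_normal: "bs_law h = normal_distribution ((r - \<delta> - \<sigma>\<^sup>2 / 2) * h) (\<sigma> * sqrt h)"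
  unfolding bs_law_def using \<sigma>_pos h by (subst distr_normal_affine) auto

lemma bs_law_eq_distr_diffusion: "bs_law h = distr (diffusion_law h) borel (\<lambda>y. h * jump_drift + y)"
  unfolding bs_law_eq_normal diffusion_law_def using \<sigma>_pos h
    distr_normal_affine[of "\<sigma> * sqrt h" 1 "(r - \<delta> - \<sigma>\<^sup>2 / 2 - jump_drift) * h" "h * jump_drift"]
  by (simp add: algebra_simps)

lemma moment_diffusion_law: "has_bochner_integral (diffusion_law h) (\<lambda>y. exp y ^ j) (exp (h * diffusion_rate j))"
proof -
  have "(\<sigma> * sqrt h)\<^sup>2 = \<sigma>\<^sup>2 * h" using h by (simp add: power_mult_distrib)
  then have rate: "h * diffusion_rate j
      = real j * ((r - \<delta> - \<sigma>\<^sup>2 / 2 - jump_drift) * h) + (real j)\<^sup>2 * (\<sigma> * sqrt h)\<^sup>2 / 2"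
    unfolding diffusion_rate_def by (simp only:) (simp add: algebra_simps)
  show ?thesis
    unfolding rate diffusion_law_def exp_of_nat_mult[symmetric]
    using \<sigma>_pos h by (intro has_bochner_integral_exp_normal) simp
qed

lemma integrable_exp_diffusion_law: "integrable (diffusion_law h) exp"
  and expectation_exp_diffusion_law: "integral\<^sup>L (diffusion_law h) exp = exp (h * diffusion_rate 1)"
  using moment_diffusion_law[of 1] by (simp_all add: has_bochner_integral_iff)

lemma integrable_exp_bs_law: "integrable (bs_law h) exp"
  and expectation_exp_bs_law: "integral\<^sup>L (bs_law h) exp = exp ((r - \<delta>) * h)"
proof -
  have "(\<sigma> * sqrt h)\<^sup>2 = \<sigma>\<^sup>2 * h" using h by (simp add: power_mult_distrib)
  then have "has_bochner_integral (bs_law h) exp (exp ((r - \<delta>) * h))"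
    using has_bochner_integral_exp_normal[of "\<sigma> * sqrt h" "(r - \<delta> - \<sigma>\<^sup>2 / 2) * h" 1] \<sigma>_pos h
    by (simp add: bs_law_eq_normal algebra_simps)
  then show "integrable (bs_law h) exp" "integral\<^sup>L (bs_law h) exp = exp ((r - \<delta>) * h)"
    by (simp_all add: has_bochner_integral_iff)
qed

lemma char_levy_law: "char (levy_law h) u = char (diffusion_law h) u * char (jump_law h) u"
proof -
  have \<sigma>h: "0 < \<sigma> * sqrt h" using \<sigma>_pos h by simp
  have sq: "(u * (\<sigma> * sqrt h))\<^sup>2 = h * (\<sigma>\<^sup>2 * u\<^sup>2)" using h by (simp add: power_mult_distrib algebra_simps)
  have "char (levy_law h) u = (CLINT y|distr M borel (X h). iexp (u * ((r - \<delta>) * h)) * iexp (u * y))"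
    unfolding char_def levy_law_def by (subst integral_distr) (auto simp: exp_add[symmetric] algebra_simps)
  also have "\<dots> = iexp (u * ((r - \<delta>) * h)) * char (distr M borel (X h)) u"
    unfolding char_def by (rule integral_mult_right_zero)
  also have "\<dots> = iexp (u * ((r - \<delta>) * h)) * exp (complex_of_real h * levy_exponent \<sigma> \<gamma> \<nu> u)"
    using triplet h by (simp add: levy_triplet_def)
  also have "\<dots> = char (diffusion_law h) u * char (jump_law h) u"
    unfolding char_pure_jump_law[OF pure_jump_law_jump_law[OF h]] diffusion_law_def
      char_normal_distribution[OF \<sigma>h] sq levy_exponent_eq[OF mart] exp_of_real[symmetric] exp_add[symmetric]
    by (simp add: algebra_simps)
  finally show ?thesis .
qed

lemma real_distribution_levy_law: "real_distribution (levy_law h)"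
proof -
  interpret law: real_distribution "distr M borel (X h)" by (rule real_distribution_distr) simp
  show ?thesis unfolding levy_law_def by (rule law.real_distribution_distr) simp
qed

lemma levy_law_eq_convolution: "levy_law h = (diffusion_law h \<star> jump_law h)"
  using char_levy_law char_convolution[OF real_distribution_diffusion_law real_distribution_jump_law]
  by (intro Levy_uniqueness real_distribution_levy_law real_distribution_convolution
      real_distribution_diffusion_law real_distribution_jump_law) (simp add: fun_eq_iff)

lemma integrable_exp_levy_law: "integrable (levy_law h) exp"
  and expectation_exp_levy_law_le: "integral\<^sup>L (levy_law h) exp \<le> exp ((r - \<delta>) * h)"
proof -
  note convolution = convolution_expectation_exp[OF real_distribution_diffusion_law real_distribution_jump_law
      integrable_exp_diffusion_law integrable_exp_jump_law[OF h]]
  show "integrable (levy_law h) exp" unfolding levy_law_eq_convolution by (rule convolution)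
  have "integral\<^sup>L (levy_law h) exp \<le> exp (h * diffusion_rate 1) * exp (h * jump_drift)"
    unfolding levy_law_eq_convolution convolution(2) expectation_exp_diffusion_law
    by (intro mult_left_mono expectation_exp_jump_law_le h) simp
  then show "integral\<^sup>L (levy_law h) exp \<le> exp ((r - \<delta>) * h)"
    by (simp add: diffusion_rate_def exp_add[symmetric] algebra_simps)
qed

context
  fixes f :: "real \<Rightarrow> real" and C x :: real
  assumes f_measurable [measurable]: "f \<in> borel_measurable borel"
    and f_bounded: "\<And>v. 0 \<le> v \<Longrightarrow> \<bar>f v\<bar> \<le> C" and x_nonneg: "0 \<le> x"
begin

interpretation diffusion: real_distribution "diffusion_law h" by (rule real_distribution_diffusion_law)
interpretation jump: real_distribution "jump_law h" by (rule real_distribution_jump_law)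
interpretation P: pair_prob_space "diffusion_law h" "jump_law h" by unfold_locales

lemma integrable_jump_law_bounded: "integrable (jump_law h) (\<lambda>y. f (x * exp g * exp y))"
  using f_bounded x_nonneg by (intro jump.integrable_const_bound[where B=C] AE_I2) auto

lemma integrable_diffusion_law_bounded: "0 \<le> c \<Longrightarrow> integrable (diffusion_law h) (\<lambda>g. f (x * exp g * c))"
  using f_bounded x_nonneg by (intro diffusion.integrable_const_bound[where B=C] AE_I2) auto

lemma integrable_expectation_jump_law: "integrable (diffusion_law h) (\<lambda>g. \<integral>y. f (x * exp g * exp y) \<partial>jump_law h)"
proof -
  have "integrable (diffusion_law h \<Otimes>\<^sub>M jump_law h) (\<lambda>(g, y). f (x * exp g * exp y))"
    using f_bounded x_nonneg by (intro P.integrable_const_bound[where B=C] AE_I2) auto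
  from P.integrable_fst'[OF this] show ?thesis by simp
qed

lemma expectation_levy_law:
  "(\<integral>y. f (x * exp y) \<partial>levy_law h) = (\<integral>g. \<integral>y. f (x * exp g * exp y) \<partial>jump_law h \<partial>diffusion_law h)"
  unfolding levy_law_eq_convolution using f_bounded x_nonneg
  by (subst integral_convolution[OF real_distribution_diffusion_law real_distribution_jump_law, where B=C])
    (auto simp: exp_add mult.assoc)

lemma expectation_bs_law:
  "(\<integral>y. f (x * exp y) \<partial>bs_law h) = (\<integral>g. f (x * exp g * exp (h * jump_drift)) \<partial>diffusion_law h)"
  unfolding bs_law_eq_distr_diffusion by (subst integral_distr) (auto simp: exp_add ac_simps)

lemma expectation_bs_law_le_levy_law:
  assumes "convex_on {0..} f" "antimono_on {0..} f"
  shows "(\<integral>y. f (x * exp y) \<partial>bs_law h) \<le> (\<integral>y. f (x * exp y) \<partial>levy_law h)"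
  unfolding expectation_bs_law expectation_levy_law
proof (intro integral_mono integrable_diffusion_law_bounded integrable_expectation_jump_law)
  fix g
  show "f (x * exp g * exp (h * jump_drift)) \<le> (\<integral>y. f (x * exp g * exp y) \<partial>jump_law h)"
    using assms x_nonneg
    by (intro antimono_convex_le_expectation_exp jump.prob_space_axioms integrable_exp_jump_law[OF h]
        expectation_exp_jump_law_le[OF h] integrable_jump_law_bounded) auto
qed simp

lemma expectation_levy_law_le_bs_law:
  assumes f_lip: "1-lipschitz_on {0..} f"
  shows "(\<integral>y. f (x * exp y) \<partial>levy_law h) \<le> (\<integral>y. f (x * exp y) \<partial>bs_law h)
    + exp (h * diffusion_rate 1) * (jump_deviation h + \<bar>exp (h * jump_drift) - 1\<bar>) * x"
proof -
  let ?e = "jump_deviation h + \<bar>exp (h * jump_drift) - 1\<bar>"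
  have "(\<integral>y. f (x * exp y) \<partial>levy_law h)
      \<le> (\<integral>g. f (x * exp g * exp (h * jump_drift)) + x * ?e * exp g \<partial>diffusion_law h)"
    unfolding expectation_levy_law
  proof (intro integral_mono integrable_expectation_jump_law Bochner_Integration.integrable_add
      integrable_diffusion_law_bounded integrable_mult_right integrable_exp_diffusion_law)
    fix g
    have "(\<integral>y. f (x * exp g * exp y) \<partial>jump_law h) \<le> f (x * exp g * exp (h * jump_drift)) + x * exp g * ?e"
      using x_nonneg
      by (intro lipschitz_expectation_exp_le f_lip jump.prob_space_axioms integrable_jump_law_bounded
          integrable_abs_exp_jump_law[OF h] expectation_abs_exp_jump_law_le[OF h]) auto
    then show "(\<integral>y. f (x * exp g * exp y) \<partial>jump_law h) \<le> f (x * exp g * exp (h * jump_drift)) + x * ?e * exp g"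
      by (simp add: ac_simps)
  qed simp
  also have "\<dots> = (\<integral>y. f (x * exp y) \<partial>bs_law h) + x * ?e * exp (h * diffusion_rate 1)"
    unfolding expectation_bs_law
    using integrable_diffusion_law_bounded[of "exp (h * jump_drift)"] integrable_exp_diffusion_law
    by (simp add: expectation_exp_diffusion_law)
  finally show ?thesis by (simp add: ac_simps)
qed

end

end

lemma bermudan_model_real_distribution:
  "real_distribution m \<Longrightarrow> 0 < h \<Longrightarrow> bermudan_model m (exp (- r * h)) K"
  using r_pos K_pos by (auto simp: bermudan_model_def bermudan_model_axioms_def real_distribution_def
      real_distribution_axioms_def)

lemma real_distribution_bs_law: "0 < h \<Longrightarrow> real_distribution (bs_law h)"
  using \<sigma>_pos by (simp add: bs_law_eq_normal real_distribution_normal)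

lemmas bermudan_model_levy_law = bermudan_model_real_distribution[OF real_distribution_levy_law]
lemmas bermudan_model_bs_law = bermudan_model_real_distribution[OF real_distribution_bs_law]

lemma discounted_growth_le_1: "0 \<le> h \<Longrightarrow> exp (- r * h) * exp ((r - \<delta>) * h) \<le> 1"
  using \<delta>_nonneg by (simp add: exp_add[symmetric] left_diff_distrib)

lemma bermudan_put_bs_le_levy:
  assumes h: "0 < h" and x: "0 \<le> x"
  shows "bermudan_put (bs_law h) (exp (- r * h)) K n x \<le> bermudan_put (levy_law h) (exp (- r * h)) K n x"
proof (rule bermudan_put_mono_law[OF bermudan_model_bs_law[OF h h] bermudan_model_levy_law[OF h h] _ x])
  interpret bs: bermudan_model "bs_law h" "exp (- r * h)" K by (rule bermudan_model_bs_law[OF h h])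
  fix n and x :: real assume "0 \<le> x"
  then show "(\<integral>y. bs.V n (x * exp y) \<partial>bs_law h) \<le> (\<integral>y. bs.V n (x * exp y) \<partial>levy_law h)"
    by (intro expectation_bs_law_le_levy_law[OF h, where C=K] bs.borel_measurable_bermudan_put
        bs.abs_bermudan_put_le bs.convex_on_bermudan_put bs.antimono_on_bermudan_put)
qed

definition jump_error :: "real \<Rightarrow> real" where
  "jump_error h = exp (- r * h) * (exp (h * diffusion_rate 1) * (jump_deviation h + \<bar>exp (h * jump_drift) - 1\<bar>))"

lemma bermudan_put_levy_le_bs:
  assumes h: "0 < h" and \<epsilon>: "jump_error h \<le> \<epsilon>" and x: "0 \<le> x"
  shows "bermudan_put (levy_law h) (exp (- r * h)) K n x
    \<le> bermudan_put (bs_law h) (exp (- r * h)) K n x + real n * \<epsilon> * x"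
proof (rule bermudan_put_le_add_error[OF bermudan_model_levy_law[OF h h] bermudan_model_bs_law[OF h h]
      integrable_exp_bs_law[OF h] _ _ _ x])
  show "exp (- r * h) * integral\<^sup>L (bs_law h) exp \<le> 1"
    unfolding expectation_exp_bs_law[OF h] using h by (intro discounted_growth_le_1) simp
  have "0 \<le> jump_error h" using jump_deviation_nonneg[of h] h by (simp add: jump_error_def)
  then show "0 \<le> \<epsilon>" using \<epsilon> by simp
  interpret levy: bermudan_model "levy_law h" "exp (- r * h)" K by (rule bermudan_model_levy_law[OF h h])
  fix n and x :: real assume x: "0 \<le> x"
  have "exp (- r * h) * integral\<^sup>L (levy_law h) exp \<le> exp (- r * h) * exp ((r - \<delta>) * h)"
    by (intro mult_left_mono expectation_exp_levy_law_le h) simp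
  also have "\<dots> \<le> 1" using h by (intro discounted_growth_le_1) simp
  finally have mean: "exp (- r * h) * integral\<^sup>L (levy_law h) exp \<le> 1" .
  have "(\<integral>y. levy.V n (x * exp y) \<partial>levy_law h) \<le> (\<integral>y. levy.V n (x * exp y) \<partial>bs_law h)
      + exp (h * diffusion_rate 1) * (jump_deviation h + \<bar>exp (h * jump_drift) - 1\<bar>) * x"
    by (intro expectation_levy_law_le_bs_law[OF h levy.borel_measurable_bermudan_put levy.abs_bermudan_put_le x]
        levy.lipschitz_on_bermudan_put integrable_exp_levy_law h mean)
  from mult_left_mono[OF this, of "exp (- r * h)"]
  have "exp (- r * h) * (\<integral>y. levy.V n (x * exp y) \<partial>levy_law h)
      \<le> exp (- r * h) * (\<integral>y. levy.V n (x * exp y) \<partial>bs_law h) + jump_error h * x"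
    by (simp add: jump_error_def algebra_simps)
  also have "\<dots> \<le> exp (- r * h) * (\<integral>y. levy.V n (x * exp y) \<partial>bs_law h) + \<epsilon> * x"
    using \<epsilon> x by (intro add_left_mono mult_right_mono)
  finally show "exp (- r * h) * (\<integral>y. levy.V n (x * exp y) \<partial>levy_law h)
      \<le> exp (- r * h) * (\<integral>y. levy.V n (x * exp y) \<partial>bs_law h) + \<epsilon> * x" .
qed

lemma ex_jump_error_le: "\<exists>C>0. eventually (\<lambda>h. jump_error h \<le> C * h) (at_right 0)"
proof (intro exI conjI)
  define C where "C = up_rate + down_rate + \<bar>jump_drift\<bar> + 1"
  show "0 < C" using up_rate_nonneg down_rate_nonneg by (simp add: C_def)
  define f where "f h = exp (- r * h) * (exp (h * diffusion_rate 1)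
    * (jump_deviation h + (exp (h * \<bar>jump_drift\<bar>) - 1)))" for h
  have "(f has_real_derivative up_rate + down_rate + \<bar>jump_drift\<bar>) (at 0)"
    unfolding f_def jump_deviation_def by (auto intro!: derivative_eq_intros)
  moreover have "up_rate + down_rate + \<bar>jump_drift\<bar> < C" "f 0 = 0"
    by (simp_all add: C_def f_def jump_deviation_def)
  ultimately have "eventually (\<lambda>h. f h \<le> C * h) (at_right 0)" by (rule eventually_le_mult_of_deriv)
  then show "eventually (\<lambda>h. jump_error h \<le> C * h) (at_right 0)"
    using eventually_at_right_less[of 0]
  proof eventually_elim
    case (elim h)
    have "\<bar>exp (h * jump_drift) - 1\<bar> \<le> exp \<bar>h * jump_drift\<bar> - 1"
    proof (rule abs_leI)
      show "- (exp (h * jump_drift) - 1) \<le> exp \<bar>h * jump_drift\<bar> - 1"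
        using exp_ge_add_one_self[of "h * jump_drift"] exp_ge_add_one_self[of "\<bar>h * jump_drift\<bar>"] by linarith
    qed simp
    then have "jump_error h \<le> f h" using elim by (simp add: jump_error_def f_def abs_mult)
    then show ?case using elim by simp
  qed
qed

definition levy_put :: "real \<Rightarrow> real \<Rightarrow> real" where
  "levy_put = american_put M (usual_filtration M X) (\<lambda>x s \<omega>. x * exp ((r - \<delta>) * s + X s \<omega>)) r K T"

definition bs_put :: "real \<Rightarrow> real \<Rightarrow> real" where
  "bs_put = american_put M (usual_filtration M X)
     (\<lambda>x s \<omega>. x * exp ((r - \<delta> - \<sigma>\<^sup>2 / 2) * s + \<sigma> * B s \<omega>)) r K T"

context
  fixes t x :: real
  assumes t: "t < T" and x: "0 \<le> x"
begin

interpretation levy: american_put_model M "usual_filtration M X" "\<lambda>s \<omega>. (r - \<delta>) * s + X s \<omega>" levy_law r K x T t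
  unfolding american_put_model_def american_put_model_axioms_def put_on_levy_process_def
    put_on_levy_process_axioms_def levy_law_def
  using filtered_levy_process.filtered_levy_process_affine[OF filtered_levy_process_usual_filtration,
      of "r - \<delta>" 1] t x r_pos K_pos by simp

interpretation bs: american_put_model M "usual_filtration M X"
    "\<lambda>s \<omega>. (r - \<delta> - \<sigma>\<^sup>2 / 2) * s + \<sigma> * B s \<omega>" bs_law r K x T t
  unfolding american_put_model_def american_put_model_axioms_def put_on_levy_process_def
    put_on_levy_process_axioms_def bs_law_def
  using filtered_levy_process.filtered_levy_process_affine[OF filtered_levy_process_brownian_motion[OF BM],
      of "r - \<delta> - \<sigma>\<^sup>2 / 2" \<sigma>] t x r_pos K_pos by simp

lemma tendsto_levy_put: "(\<lambda>n. bermudan_price levy_law r K (T - t) n x) \<longlonglongrightarrow> levy_put t x"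
  using levy.bermudan_price_tendsto_american_price by (simp add: levy_put_def)

lemma tendsto_bs_put: "(\<lambda>n. bermudan_price bs_law r K (T - t) n x) \<longlonglongrightarrow> bs_put t x"
  using bs.bermudan_price_tendsto_american_price by (simp add: bs_put_def)

lemma bermudan_price_le_bs_put: "0 < n \<Longrightarrow> bermudan_price bs_law r K (T - t) n x \<le> bs_put t x"
  using bs.bermudan_price_le_american_price by (simp add: bs_put_def)

lemma bs_put_le_levy_put: "bs_put t x \<le> levy_put t x"
proof (rule LIMSEQ_le[OF tendsto_bs_put tendsto_levy_put])
  show "\<exists>n0. \<forall>n\<ge>n0. bermudan_price bs_law r K (T - t) n x \<le> bermudan_price levy_law r K (T - t) n x"
  proof (intro exI[of _ 1] allI impI)
    fix n :: nat assume "1 \<le> n"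
    then show "bermudan_price bs_law r K (T - t) n x \<le> bermudan_price levy_law r K (T - t) n x"
      unfolding bermudan_price_def using t x by (intro bermudan_put_bs_le_levy) auto
  qed
qed

end

lemma bs_put_strike_pos:
  assumes t: "t < T"
  shows "0 < bs_put t K"
proof -
  have h: "0 < T - t" using t by simp
  interpret bs: bermudan_model "bs_law (T - t)" "exp (- r * (T - t))" K by (rule bermudan_model_bs_law[OF h h])
  let ?I = "\<integral>y. bs.V 0 (K * exp y) \<partial>bs_law (T - t)"
  have "?I \<noteq> 0"
  proof
    assume "?I = 0"
    then have "AE y in bs_law (T - t). bs.V 0 (K * exp y) = 0"
      using integral_nonneg_eq_0_iff_AE[OF bs.integrable_continuation, of K 0] K_pos
      by (simp add: bermudan_put_nonneg)
    then have "AE y in bs_law (T - t). 0 \<le> y"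
    proof eventually_elim
      case (elim y)
      then have "K * 1 \<le> K * exp y" by simp
      then show ?case using K_pos by (simp only: mult_le_cancel_left_pos one_le_exp_iff)
    qed
    then show False using not_AE_normal_nonneg \<sigma>_pos h unfolding bs_law_eq_normal[OF h] by simp
  qed
  moreover have "0 \<le> ?I" by (intro integral_nonneg_AE) (simp add: bermudan_put_nonneg)
  ultimately have "0 < ?I" by linarith
  then have "0 < bs.V (Suc 0) K" by (simp add: less_max_iff_disj)
  also have "\<dots> \<le> bs_put t K"
    using bermudan_price_le_bs_put[OF t, of K 1] K_pos by (simp add: bermudan_price_def)
  finally show ?thesis .
qed

lemma filterlim_mesh: "0 < \<theta> \<Longrightarrow> filterlim (\<lambda>n. \<theta> / real n) (at_right 0) sequentially"
  using lim_const_over_n[of \<theta>]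
  by (auto simp: filterlim_at intro!: eventually_mono[OF eventually_gt_at_top[of 0]])

lemma ex_levy_bermudan_price_le_bs_put:
  "\<exists>C>0. \<forall>t<T. eventually
    (\<lambda>n. \<forall>v\<ge>0. bermudan_price levy_law r K (T - t) n v \<le> bs_put t v + C * (T - t) * v) sequentially"
proof -
  obtain C where C: "0 < C" and err: "eventually (\<lambda>h. jump_error h \<le> C * h) (at_right 0)"
    using ex_jump_error_le by blast
  have "eventually (\<lambda>n. \<forall>v\<ge>0. bermudan_price levy_law r K (T - t) n v \<le> bs_put t v + C * (T - t) * v) sequentially"
    if t: "t < T" for t
  proof -
    have "0 < T - t" using t by simp
    from eventually_compose_filterlim[OF err filterlim_mesh[OF this]] eventually_gt_at_top[of 0]
    show ?thesis
    proof eventually_elim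
      case (elim n)
      show ?case
      proof (intro allI impI)
        fix v :: real assume v: "0 \<le> v"
        have "bermudan_price levy_law r K (T - t) n v
            \<le> bermudan_price bs_law r K (T - t) n v + real n * (C * ((T - t) / real n)) * v"
          unfolding bermudan_price_def using elim t v by (intro bermudan_put_levy_le_bs) auto
        also have "bermudan_price bs_law r K (T - t) n v \<le> bs_put t v"
          using t v elim(2) by (rule bermudan_price_le_bs_put)
        also have "real n * (C * ((T - t) / real n)) = C * (T - t)" using elim(2) by simp
        finally show "bermudan_price levy_law r K (T - t) n v \<le> bs_put t v + C * (T - t) * v" by simp
      qed
    qed
  qed
  then show ?thesis using C by blast
qed

end

section \<open>A quadratic barrier\<close>

definition barrier :: "real \<Rightarrow> real \<Rightarrow> real \<Rightarrow> real \<Rightarrow> real \<Rightarrow> real" where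
  "barrier K \<beta> z x v = K - min v x + \<beta> * (max 0 (min v x - z))\<^sup>2"

lemma borel_measurable_barrier [measurable]: "barrier K \<beta> z x \<in> borel_measurable borel"
  unfolding barrier_def by measurable

lemma abs_barrier_le:
  assumes "0 \<le> \<beta>" "0 \<le> z" "0 \<le> x" "x \<le> K" "0 \<le> v"
  shows "\<bar>barrier K \<beta> z x v\<bar> \<le> K + \<beta> * K\<^sup>2"
proof -
  have "(max 0 (min v x - z))\<^sup>2 \<le> K\<^sup>2" using assms by (intro power_mono) auto
  then have "\<beta> * (max 0 (min v x - z))\<^sup>2 \<le> \<beta> * K\<^sup>2" using assms by (intro mult_left_mono) auto
  moreover have "0 \<le> \<beta> * (max 0 (min v x - z))\<^sup>2" using assms by simp
  ultimately show ?thesis using assms by (auto simp: barrier_def)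
qed

lemma payoff_le_barrier:
  assumes "0 \<le> \<beta>" "x \<le> K"
  shows "max 0 (K - v) \<le> barrier K \<beta> z x v"
proof -
  have "0 \<le> \<beta> * (max 0 (min v x - z))\<^sup>2" "K - v \<le> K - min v x" "0 \<le> K - min v x" using assms by auto
  then show ?thesis unfolding barrier_def by linarith
qed

lemma square_excess_jump_le:
  fixes a b x z K :: real
  assumes "0 \<le> a" "0 \<le> z" "x \<le> K" "0 \<le> K"
  shows "(max 0 (min (a * b) x - z))\<^sup>2 \<le> (max 0 (min a x - z))\<^sup>2 + 2 * K * (a * \<bar>b - 1\<bar>)"
proof -
  define p q where "p = max 0 (min (a * b) x - z)" and "q = max 0 (min a x - z)"
  have pq: "0 \<le> p" "p \<le> K" "0 \<le> q" "q \<le> K" using assms by (auto simp: p_def q_def)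
  have "\<bar>p - q\<bar> \<le> \<bar>a * b - a\<bar>" by (auto simp: p_def q_def max_def min_def)
  also have "a * b - a = a * (b - 1)" by (simp add: right_diff_distrib)
  also have "\<bar>a * (b - 1)\<bar> = a * \<bar>b - 1\<bar>" by (simp only: abs_mult abs_of_nonneg[OF assms(1)])
  finally have diff: "\<bar>p - q\<bar> \<le> a * \<bar>b - 1\<bar>" .
  have "p\<^sup>2 - q\<^sup>2 = (p + q) * (p - q)" by (simp add: power2_eq_square algebra_simps)
  also have "\<dots> \<le> (p + q) * \<bar>p - q\<bar>" using pq by (intro mult_left_mono) auto
  also have "\<dots> \<le> (2 * K) * (a * \<bar>b - 1\<bar>)" using pq diff by (intro mult_mono) auto
  finally show ?thesis by (simp add: p_def q_def)
qed

lemma square_excess_growth_le: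
  fixes w u x z :: real
  shows "(max 0 (min (w * u) x - z))\<^sup>2
    \<le> (max 0 (w - z))\<^sup>2 + 2 * max 0 (w - z) * w * (u - 1) + w\<^sup>2 * (u - 1)\<^sup>2"
proof -
  define a where "a = w * u"
  have a: "a - w = w * (u - 1)" by (simp add: a_def algebra_simps)
  have "(max 0 (min a x - z))\<^sup>2 \<le> (max 0 (a - z))\<^sup>2" by (intro power_mono) auto
  also have "\<dots> \<le> (max 0 (w - z))\<^sup>2 + 2 * max 0 (w - z) * (a - w) + (a - w)\<^sup>2"
  proof (cases "z \<le> w")
    case True
    then have "(max 0 (w - z))\<^sup>2 + 2 * max 0 (w - z) * (a - w) + (a - w)\<^sup>2 = (a - z)\<^sup>2"
      by (simp add: max_def power2_eq_square algebra_simps)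
    then show ?thesis by (auto simp: max_def)
  next
    case False
    then have "(max 0 (a - z))\<^sup>2 \<le> (a - w)\<^sup>2" by (auto simp: max_def intro!: power_mono)
    then show ?thesis using False by simp
  qed
  finally show ?thesis unfolding a by (simp add: a_def power_mult_distrib mult.assoc)
qed

text \<open>The fourth power makes the continuous part contribute \<open>O(h\<^sup>2)\<close> to the overshoot beyond \<open>x\<close>.\<close>

lemma overshoot_le:
  fixes w u x x0 :: real
  assumes x0: "0 < x0" "x0 < x" and w: "w \<le> x0" and u: "0 \<le> u"
  shows "max 0 (w * u - x) \<le> x0 / (x / x0 - 1) ^ 3 * (u - 1) ^ 4"
proof -
  define d where "d = x / x0 - 1"
  have d: "0 < d" using x0 by (simp add: d_def)
  show ?thesis
  proof (cases "w * u \<le> x")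
    case True
    then show ?thesis using x0 d by (simp add: d_def)
  next
    case False
    have wu: "w * u \<le> x0 * u" using w u by (rule mult_right_mono)
    then have "x < x0 * u" using False by simp
    then have du: "d \<le> u - 1" using x0 by (simp add: d_def field_simps)
    then have "1 \<le> (u - 1) ^ 3 / d ^ 3" using power_mono[OF du, of 3] d by (simp add: le_divide_eq)
    then have cube: "u - 1 \<le> (u - 1) * ((u - 1) ^ 3 / d ^ 3)"
      using du d mult_left_mono[of 1 "(u - 1) ^ 3 / d ^ 3" "u - 1"] by simp
    have "w * u - x \<le> x0 * (u - 1)" using wu x0 by (simp add: algebra_simps)
    also have "\<dots> \<le> x0 * ((u - 1) * ((u - 1) ^ 3 / d ^ 3))" using cube x0 by (intro mult_left_mono) auto
    also have "\<dots> = x0 / d ^ 3 * (u - 1) ^ 4" by (simp add: eval_nat_numeral field_simps)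
    finally show ?thesis using x0 d by (simp add: d_def)
  qed
qed

lemma mult_min_minus_excess_le:
  fixes a b x :: real
  assumes "0 \<le> a" "0 \<le> x"
  shows "a * min 1 b - max 0 (a - x) \<le> min (a * b) x"
proof -
  have "a * min 1 b = min a (a * b)" using assms by (simp add: min_mult_distrib_left)
  then show ?thesis by (auto simp: min_def max_def)
qed

lemma barrier_growth_jump_le:
  fixes K \<beta> z x x0 w u b :: real
  assumes \<beta>: "0 \<le> \<beta>" and z: "0 \<le> z" and x0: "0 < x0" "x0 < x" "x \<le> K"
    and w: "0 \<le> w" "w \<le> x0" and u: "0 \<le> u"
  shows "barrier K \<beta> z x (w * u * b) \<le> K - w * u * min 1 b + x0 / (x / x0 - 1) ^ 3 * (u - 1) ^ 4
    + \<beta> * ((max 0 (w - z))\<^sup>2 + 2 * max 0 (w - z) * w * (u - 1) + w\<^sup>2 * (u - 1)\<^sup>2 + 2 * K * (w * u * \<bar>b - 1\<bar>))"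
proof -
  have "w * u * min 1 b - max 0 (w * u - x) \<le> min (w * u * b) x"
    using w u x0 by (intro mult_min_minus_excess_le) auto
  moreover note overshoot_le[OF x0(1,2) w(2) u]
  moreover have "(max 0 (min (w * u * b) x - z))\<^sup>2 \<le> (max 0 (w - z))\<^sup>2 + 2 * max 0 (w - z) * w * (u - 1)
      + w\<^sup>2 * (u - 1)\<^sup>2 + 2 * K * (w * u * \<bar>b - 1\<bar>)"
    using square_excess_jump_le[of "w * u" z x K b] square_excess_growth_le[of w u x z] z w u x0 by simp
  from mult_left_mono[OF this \<beta>]
  have "\<beta> * (max 0 (min (w * u * b) x - z))\<^sup>2 \<le> \<beta> * ((max 0 (w - z))\<^sup>2 + 2 * max 0 (w - z) * w * (u - 1)
      + w\<^sup>2 * (u - 1)\<^sup>2 + 2 * K * (w * u * \<bar>b - 1\<bar>))" .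
  ultimately show ?thesis unfolding barrier_def by linarith
qed

context exp_levy_market
begin

definition growth_moment :: "nat \<Rightarrow> real \<Rightarrow> real" where
  "growth_moment k h = (\<integral>g. (exp g - 1) ^ k \<partial>diffusion_law h)"

lemma
  assumes h: "0 < h"
  shows integrable_exp_minus_one_power: "integrable (diffusion_law h) (\<lambda>g. (exp g - 1) ^ k)"
    and growth_moment_eq: "growth_moment k h
      = (\<Sum>j\<le>k. real (k choose j) * (-1) ^ (k - j) * exp (h * diffusion_rate j))"
proof -
  have "(exp g - 1) ^ k = (\<Sum>j\<le>k. real (k choose j) * (-1) ^ (k - j) * exp g ^ j)" for g :: real
    using binomial_ring[of "exp g" "-1" k] by (simp add: ac_simps)
  then have "has_bochner_integral (diffusion_law h) (\<lambda>g. (exp g - 1) ^ k)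
      (\<Sum>j\<le>k. real (k choose j) * (-1) ^ (k - j) * exp (h * diffusion_rate j))"
    by (simp only:) (intro has_bochner_integral_sum has_bochner_integral_mult_right moment_diffusion_law h)
  then show "integrable (diffusion_law h) (\<lambda>g. (exp g - 1) ^ k)"
    "growth_moment k h = (\<Sum>j\<le>k. real (k choose j) * (-1) ^ (k - j) * exp (h * diffusion_rate j))"
    by (simp_all add: has_bochner_integral_iff growth_moment_def)
qed

lemma growth_moments:
  assumes "0 < h"
  shows "growth_moment 1 h = exp (h * diffusion_rate 1) - 1"
    and "growth_moment 2 h = exp (h * diffusion_rate 2) - 2 * exp (h * diffusion_rate 1) + 1"
    and "growth_moment 4 h = exp (h * diffusion_rate 4) - 4 * exp (h * diffusion_rate 3)
      + 6 * exp (h * diffusion_rate 2) - 4 * exp (h * diffusion_rate 1) + 1"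
  unfolding growth_moment_eq[OF assms] by (simp_all add: eval_nat_numeral diffusion_rate_def)

context
  fixes h \<beta> z x0 x w :: real
  assumes h: "0 < h" and \<beta>: "0 \<le> \<beta>" and z: "0 \<le> z" and x0: "0 < x0" "x0 < x" "x \<le> K" and w: "0 \<le> w" "w \<le> x0"
begin

interpretation diffusion: real_distribution "diffusion_law h" by (rule real_distribution_diffusion_law[OF h])
interpretation jump: real_distribution "jump_law h" by (rule real_distribution_jump_law[OF h])

private lemma barrier_bounded: "0 \<le> v \<Longrightarrow> \<bar>barrier K \<beta> z x v\<bar> \<le> K + \<beta> * K\<^sup>2"
  using \<beta> z x0 by (intro abs_barrier_le) auto

lemma expectation_jump_law_barrier_le:
  "(\<integral>y. barrier K \<beta> z x (w * exp g * exp y) \<partial>jump_law h)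
    \<le> K - w * exp g * (2 - exp (h * down_rate)) + x0 / (x / x0 - 1) ^ 3 * (exp g - 1) ^ 4
      + \<beta> * ((max 0 (w - z))\<^sup>2 + 2 * max 0 (w - z) * w * (exp g - 1) + w\<^sup>2 * (exp g - 1)\<^sup>2
        + 2 * K * (w * exp g * jump_deviation h))"
proof -
  define bound where "bound a b = K - w * exp g * a + x0 / (x / x0 - 1) ^ 3 * (exp g - 1) ^ 4
    + \<beta> * ((max 0 (w - z))\<^sup>2 + 2 * max 0 (w - z) * w * (exp g - 1) + w\<^sup>2 * (exp g - 1)\<^sup>2
      + 2 * K * (w * exp g * b))" for a b :: real
  note int = integrable_min_exp_jump_law[OF h] integrable_abs_exp_jump_law[OF h]
  have "(\<integral>y. barrier K \<beta> z x (w * exp g * exp y) \<partial>jump_law h)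
      \<le> (\<integral>y. bound (min 1 (exp y)) \<bar>exp y - 1\<bar> \<partial>jump_law h)"
  proof (rule integral_mono)
    show "integrable (jump_law h) (\<lambda>y. barrier K \<beta> z x (w * exp g * exp y))"
      by (rule integrable_jump_law_bounded[OF h borel_measurable_barrier barrier_bounded w(1)])
    show "integrable (jump_law h) (\<lambda>y. bound (min 1 (exp y)) \<bar>exp y - 1\<bar>)"
      unfolding bound_def using int by simp
    show "barrier K \<beta> z x (w * exp g * exp y) \<le> bound (min 1 (exp y)) \<bar>exp y - 1\<bar>" for y
      unfolding bound_def by (rule barrier_growth_jump_le[OF \<beta> z x0 w]) simp
  qed
  also have "\<dots> = bound (\<integral>y. min 1 (exp y) \<partial>jump_law h) (\<integral>y. \<bar>exp y - 1\<bar> \<partial>jump_law h)"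
    unfolding bound_def using int jump.prob_space by simp
  also have "\<dots> \<le> bound (2 - exp (h * down_rate)) (jump_deviation h)"
    unfolding bound_def
    using w \<beta> K_pos expectation_min_exp_jump_law_ge[OF h] expectation_abs_exp_jump_law_le[OF h]
    by (intro add_mono diff_mono mult_left_mono order_refl) auto
  finally show ?thesis unfolding bound_def .
qed

lemma expectation_levy_law_barrier_le:
  "(\<integral>y. barrier K \<beta> z x (w * exp y) \<partial>levy_law h)
    \<le> K - w * exp (h * diffusion_rate 1) * (2 - exp (h * down_rate)) + x0 / (x / x0 - 1) ^ 3 * growth_moment 4 h
      + \<beta> * ((max 0 (w - z))\<^sup>2 + 2 * max 0 (w - z) * w * growth_moment 1 h + w\<^sup>2 * growth_moment 2 h
        + 2 * K * (w * exp (h * diffusion_rate 1) * jump_deviation h))"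
proof -
  have int: "integrable (diffusion_law h) exp" "integrable (diffusion_law h) (\<lambda>g. exp g - 1)"
    "integrable (diffusion_law h) (\<lambda>g. (exp g - 1)\<^sup>2)" "integrable (diffusion_law h) (\<lambda>g. (exp g - 1) ^ 4)"
    using integrable_exp_diffusion_law[OF h] integrable_exp_minus_one_power[OF h, of 1]
      integrable_exp_minus_one_power[OF h] by simp_all
  have "(\<integral>y. barrier K \<beta> z x (w * exp y) \<partial>levy_law h)
      = (\<integral>g. \<integral>y. barrier K \<beta> z x (w * exp g * exp y) \<partial>jump_law h \<partial>diffusion_law h)"
    by (rule expectation_levy_law[OF h borel_measurable_barrier barrier_bounded w(1)])
  also have "\<dots> \<le> (\<integral>g. K - w * exp g * (2 - exp (h * down_rate)) + x0 / (x / x0 - 1) ^ 3 * (exp g - 1) ^ 4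
      + \<beta> * ((max 0 (w - z))\<^sup>2 + 2 * max 0 (w - z) * w * (exp g - 1) + w\<^sup>2 * (exp g - 1)\<^sup>2
        + 2 * K * (w * exp g * jump_deviation h)) \<partial>diffusion_law h)"
    by (intro integral_mono expectation_jump_law_barrier_le Bochner_Integration.integrable_add
        Bochner_Integration.integrable_diff integrable_mult_right integrable_mult_left int diffusion.integrable_const
        integrable_expectation_jump_law[OF h borel_measurable_barrier barrier_bounded w(1)])
  also have "\<dots> = K - w * exp (h * diffusion_rate 1) * (2 - exp (h * down_rate))
      + x0 / (x / x0 - 1) ^ 3 * growth_moment 4 h
      + \<beta> * ((max 0 (w - z))\<^sup>2 + 2 * max 0 (w - z) * w * growth_moment 1 h + w\<^sup>2 * growth_moment 2 h
        + 2 * K * (w * exp (h * diffusion_rate 1) * jump_deviation h))"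
    unfolding growth_moment_def using int diffusion.prob_space
    by (simp add: expectation_exp_diffusion_law[OF h])
  finally show ?thesis .
qed

end

definition strike_decay :: "real \<Rightarrow> real \<Rightarrow> real" where
  "strike_decay D h = exp (- r * h) * (K + D * growth_moment 4 h) - K"

definition price_decay :: "real \<Rightarrow> real" where
  "price_decay h = 1 - exp (- r * h) * exp (h * diffusion_rate 1) * (2 - exp (h * down_rate))"

definition quadratic_growth :: "real \<Rightarrow> real" where
  "quadratic_growth h = 2 * (exp (h * \<bar>diffusion_rate 1\<bar>) - 1) + growth_moment 2 h
    + 2 * exp (h * diffusion_rate 1) * jump_deviation h"

definition quadratic_rate :: real where
  "quadratic_rate = 2 * \<bar>diffusion_rate 1\<bar> + \<sigma>\<^sup>2 + 2 * (up_rate + down_rate)"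

lemma eventually_strike_decay_le:
  assumes "- r * K < c"
  shows "eventually (\<lambda>h. strike_decay D h \<le> c * h) (at_right 0)"
proof -
  let ?m = "\<lambda>h. exp (h * diffusion_rate 4) - 4 * exp (h * diffusion_rate 3)
      + 6 * exp (h * diffusion_rate 2) - 4 * exp (h * diffusion_rate 1) + 1"
  have "((\<lambda>h. exp (- r * h) * (K + D * ?m h) - K) has_real_derivative - r * K) (at 0)"
    by (auto intro!: derivative_eq_intros) (simp add: diffusion_rate_def algebra_simps)
  then have "eventually (\<lambda>h. exp (- r * h) * (K + D * ?m h) - K \<le> c * h) (at_right 0)"
    using assms by (rule eventually_le_mult_of_deriv) simp
  then show ?thesis
    using eventually_at_right_less[of 0]
    by eventually_elim (simp only: strike_decay_def growth_moments)
qed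

lemma eventually_price_decay_le:
  assumes "\<delta> + up_rate < c"
  shows "eventually (\<lambda>h. price_decay h \<le> c * h) (at_right 0)"
proof (rule eventually_le_mult_of_deriv[OF _ assms])
  show "(price_decay has_real_derivative \<delta> + up_rate) (at 0)"
    unfolding price_decay_def
    by (auto intro!: derivative_eq_intros) (simp add: diffusion_rate_def jump_drift_def algebra_simps)
qed (simp add: price_decay_def)

lemma eventually_quadratic_growth_le:
  assumes "quadratic_rate < c"
  shows "eventually (\<lambda>h. quadratic_growth h \<le> c * h) (at_right 0)"
proof -
  let ?f = "\<lambda>h. 2 * (exp (h * \<bar>diffusion_rate 1\<bar>) - 1)
    + (exp (h * diffusion_rate 2) - 2 * exp (h * diffusion_rate 1) + 1)
    + 2 * exp (h * diffusion_rate 1) * jump_deviation h"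
  have "(?f has_real_derivative quadratic_rate) (at 0)"
    unfolding jump_deviation_def
    by (auto intro!: derivative_eq_intros) (simp add: quadratic_rate_def diffusion_rate_def algebra_simps)
  then have "eventually (\<lambda>h. ?f h \<le> c * h) (at_right 0)"
    using assms by (rule eventually_le_mult_of_deriv) (simp add: jump_deviation_def)
  then show ?thesis
    using eventually_at_right_less[of 0]
    by eventually_elim (simp only: quadratic_growth_def growth_moments)
qed

lemma discounted_barrier_le:
  assumes h: "0 < h" and \<beta>: "0 \<le> \<beta>" and z: "0 \<le> z" and x0: "0 < x0" "x0 < x" "x \<le> K" and w: "0 \<le> w" "w \<le> x0"
  shows "exp (- r * h) * (\<integral>y. barrier K \<beta> z x (w * exp y) \<partial>levy_law h)
    \<le> barrier K \<beta> z x w + strike_decay (x0 / (x / x0 - 1) ^ 3) h + w * price_decay h + \<beta> * K\<^sup>2 * quadratic_growth h"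
proof -
  define m D where "m = max 0 (w - z)" and "D = x0 / (x / x0 - 1) ^ 3"
  let ?E = "exp (h * diffusion_rate 1)"
  have wK: "w \<le> K" and m: "0 \<le> m" "m \<le> K" using w x0 z by (auto simp: m_def)
  have dev: "0 \<le> jump_deviation h" using h by (intro jump_deviation_nonneg) simp
  have "0 \<le> growth_moment 2 h" by (simp add: growth_moment_def)
  have growth: "growth_moment 1 h \<le> exp (h * \<bar>diffusion_rate 1\<bar>) - 1"
    unfolding growth_moments(1)[OF h] using h by simp
  have "m * w * growth_moment 1 h \<le> K\<^sup>2 * (exp (h * \<bar>diffusion_rate 1\<bar>) - 1)"
  proof -
    have "m * w * growth_moment 1 h \<le> m * w * (exp (h * \<bar>diffusion_rate 1\<bar>) - 1)"
      using m w growth by (intro mult_left_mono) auto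
    also have "\<dots> \<le> K\<^sup>2 * (exp (h * \<bar>diffusion_rate 1\<bar>) - 1)"
      unfolding power2_eq_square using m w wK K_pos h by (intro mult_right_mono mult_mono) auto
    finally show ?thesis .
  qed
  moreover have "w\<^sup>2 * growth_moment 2 h \<le> K\<^sup>2 * growth_moment 2 h"
    using w wK \<open>0 \<le> growth_moment 2 h\<close> by (intro mult_right_mono power_mono)
  moreover have "K * w * (?E * jump_deviation h) \<le> K\<^sup>2 * (?E * jump_deviation h)"
    unfolding power2_eq_square using w wK K_pos dev by (intro mult_right_mono mult_left_mono) auto
  ultimately have quadratic: "2 * m * w * growth_moment 1 h + w\<^sup>2 * growth_moment 2 h
      + 2 * K * w * ?E * jump_deviation h \<le> K\<^sup>2 * quadratic_growth h"
    unfolding quadratic_growth_def by (simp add: algebra_simps)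
  have "0 \<le> quadratic_growth h"
    unfolding quadratic_growth_def using h dev \<open>0 \<le> growth_moment 2 h\<close> by (intro add_nonneg_nonneg) auto
  have "exp (- r * h) * (\<integral>y. barrier K \<beta> z x (w * exp y) \<partial>levy_law h)
      \<le> exp (- r * h) * (K - w * ?E * (2 - exp (h * down_rate)) + D * growth_moment 4 h
        + \<beta> * (m\<^sup>2 + K\<^sup>2 * quadratic_growth h))"
    using expectation_levy_law_barrier_le[OF h \<beta> z x0 w, folded m_def D_def] mult_left_mono[OF quadratic \<beta>]
    by (intro mult_left_mono) (simp_all add: algebra_simps)
  also have "\<dots> = K - w + strike_decay D h + w * price_decay h + exp (- r * h) * (\<beta> * (m\<^sup>2 + K\<^sup>2 * quadratic_growth h))"
    by (simp add: strike_decay_def price_decay_def algebra_simps)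
  also have "\<dots> \<le> K - w + strike_decay D h + w * price_decay h + 1 * (\<beta> * (m\<^sup>2 + K\<^sup>2 * quadratic_growth h))"
    using h r_pos \<beta> \<open>0 \<le> quadratic_growth h\<close> by (intro add_left_mono mult_right_mono) auto
  also have "\<dots> = barrier K \<beta> z x w + strike_decay D h + w * price_decay h + \<beta> * K\<^sup>2 * quadratic_growth h"
    using w x0 by (simp add: barrier_def m_def algebra_simps)
  finally show ?thesis unfolding D_def .
qed

lemma ex_barrier_decay_nonpos:
  assumes dplus: "0 < r - \<delta> - up_rate"
  shows "\<exists>\<beta>>0. \<forall>D. eventually (\<lambda>h. \<forall>w. 0 \<le> w \<longrightarrow> w \<le> K \<longrightarrow>
    strike_decay D h + w * price_decay h + \<beta> * K\<^sup>2 * quadratic_growth h \<le> 0) (at_right 0)"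
proof (intro exI conjI allI)
  define d q where "d = r - \<delta> - up_rate" and "q = quadratic_rate + 1"
  have d: "0 < d" using dplus by (simp add: d_def)
  have q: "0 < q"
    unfolding q_def quadratic_rate_def using up_rate_nonneg down_rate_nonneg
    by (intro add_nonneg_pos add_nonneg_nonneg) auto
  define \<beta> where "\<beta> = d / (4 * K * q)"
  show \<beta>: "0 < \<beta>" unfolding \<beta>_def using d K_pos q by (intro divide_pos_pos) auto
  have slope: "\<beta> * K\<^sup>2 * q = K * d / 4" using K_pos q by (simp add: \<beta>_def power2_eq_square)
  fix D
  have "- r * K < - r * K + K * d / 4" "\<delta> + up_rate < \<delta> + up_rate + d / 4" "quadratic_rate < q"
    using d K_pos by (simp_all add: q_def)
  from eventually_strike_decay_le[OF this(1), of D] eventually_price_decay_le[OF this(2)]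
    eventually_quadratic_growth_le[OF this(3)] eventually_at_right_less[of 0]
  show "eventually (\<lambda>h. \<forall>w. 0 \<le> w \<longrightarrow> w \<le> K \<longrightarrow>
      strike_decay D h + w * price_decay h + \<beta> * K\<^sup>2 * quadratic_growth h \<le> 0) (at_right 0)"
  proof eventually_elim
    case (elim h)
    show ?case
    proof (intro allI impI)
      fix w assume w: "0 \<le> w" "w \<le> K"
      have "w * price_decay h \<le> w * ((\<delta> + up_rate + d / 4) * h)" using elim w by (intro mult_left_mono)
      also have "\<dots> \<le> K * ((\<delta> + up_rate + d / 4) * h)"
        using w elim d \<delta>_nonneg up_rate_nonneg by (intro mult_right_mono) auto
      finally have price: "w * price_decay h \<le> K * ((\<delta> + up_rate + d / 4) * h)" .
      have "\<beta> * K\<^sup>2 * quadratic_growth h \<le> \<beta> * K\<^sup>2 * (q * h)" using elim \<beta> by (intro mult_left_mono) auto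
      also have "\<dots> = K * d / 4 * h" by (simp add: slope[symmetric])
      finally have "strike_decay D h + w * price_decay h + \<beta> * K\<^sup>2 * quadratic_growth h
          \<le> (- r * K + K * d / 4) * h + K * ((\<delta> + up_rate + d / 4) * h) + K * d / 4 * h"
        using elim price by linarith
      also have "\<dots> = - (K * d * h) / 4" by (simp add: d_def field_simps)
      also have "\<dots> \<le> 0" using K_pos d elim by simp
      finally show "strike_decay D h + w * price_decay h + \<beta> * K\<^sup>2 * quadratic_growth h \<le> 0" .
    qed
  qed
qed

lemma ex_barrier_supersolution:
  assumes dplus: "0 < r - \<delta> - up_rate"
  shows "\<exists>\<beta>>0. \<forall>z x0 x. 0 \<le> z \<longrightarrow> 0 < x0 \<longrightarrow> x0 < x \<longrightarrow> x \<le> K \<longrightarrow>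
    eventually (\<lambda>h. \<forall>w. 0 \<le> w \<longrightarrow> w \<le> x0 \<longrightarrow>
      exp (- r * h) * (\<integral>y. barrier K \<beta> z x (w * exp y) \<partial>levy_law h) \<le> barrier K \<beta> z x w) (at_right 0)"
proof -
  obtain \<beta> where \<beta>: "0 < \<beta>" and decay: "\<And>D. eventually (\<lambda>h. \<forall>w. 0 \<le> w \<longrightarrow> w \<le> K \<longrightarrow>
      strike_decay D h + w * price_decay h + \<beta> * K\<^sup>2 * quadratic_growth h \<le> 0) (at_right 0)"
    using ex_barrier_decay_nonpos[OF dplus] by blast
  have "eventually (\<lambda>h. \<forall>w. 0 \<le> w \<longrightarrow> w \<le> x0 \<longrightarrow>
      exp (- r * h) * (\<integral>y. barrier K \<beta> z x (w * exp y) \<partial>levy_law h) \<le> barrier K \<beta> z x w) (at_right 0)"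
    if z: "0 \<le> z" and x0: "0 < x0" "x0 < x" "x \<le> K" for z x0 x
    using decay[of "x0 / (x / x0 - 1) ^ 3"] eventually_at_right_less[of 0]
  proof eventually_elim
    case (elim h)
    show ?case
    proof (intro allI impI)
      fix w assume w: "0 \<le> w" "w \<le> x0"
      then have "strike_decay (x0 / (x / x0 - 1) ^ 3) h + w * price_decay h + \<beta> * K\<^sup>2 * quadratic_growth h \<le> 0"
        using elim(1) x0 by simp
      then show "exp (- r * h) * (\<integral>y. barrier K \<beta> z x (w * exp y) \<partial>levy_law h) \<le> barrier K \<beta> z x w"
        using discounted_barrier_le[OF elim(2) less_imp_le[OF \<beta>] z x0 w] by linarith
    qed
  qed
  then show ?thesis using \<beta> by blast
qed

section \<open>Critical prices\<close>

lemma bermudan_put_levy_le_payoff: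
  assumes h: "0 < h" and \<beta>: "0 < \<beta>" and z: "0 \<le> z" and x0: "0 < x0" "x0 < x" "x < b" "b \<le> K"
    and super: "\<And>w. 0 \<le> w \<Longrightarrow> w \<le> x0 \<Longrightarrow>
      exp (- r * h) * (\<integral>y. barrier K \<beta> z x (w * exp y) \<partial>levy_law h) \<le> barrier K \<beta> z x w"
    and near: "\<And>v. 0 \<le> v \<Longrightarrow> v < b \<Longrightarrow> bermudan_put (levy_law h) (exp (- r * h)) K n v \<le> K - v + \<beta> * s\<^sup>2"
    and s: "0 \<le> s" "z + s \<le> x0"
  shows "bermudan_put (levy_law h) (exp (- r * h)) K n z \<le> K - z"
proof -
  interpret levy: bermudan_model "levy_law h" "exp (- r * h)" K by (rule bermudan_model_levy_law[OF h h])
  have between: "levy.V n w \<le> barrier K \<beta> z x w" if w: "x0 \<le> w" "w \<le> x" for w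
  proof -
    have "levy.V n w \<le> K - w + \<beta> * s\<^sup>2" using w x0 by (intro near) auto
    also have "\<beta> * s\<^sup>2 \<le> \<beta> * (w - z)\<^sup>2" using w s \<beta> by (intro mult_left_mono power_mono) auto
    also have "K - w + \<beta> * (w - z)\<^sup>2 = barrier K \<beta> z x w" using w s by (simp add: barrier_def)
    finally show ?thesis by simp
  qed
  have beyond: "levy.V n w \<le> barrier K \<beta> z x w" if w: "x0 \<le> w" for w
  proof (cases "w \<le> x")
    case True
    then show ?thesis using between w by simp
  next
    case False
    have "levy.V n w \<le> levy.V n x"
      using False x0 by (intro monotone_onD[OF levy.antimono_on_bermudan_put]) auto
    also have "\<dots> \<le> barrier K \<beta> z x x" using x0 by (intro between) auto
    also have "\<dots> = barrier K \<beta> z x w" using False by (simp add: barrier_def)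
    finally show ?thesis .
  qed
  have "integrable (levy_law h) (\<lambda>y. barrier K \<beta> z x (w * exp y))" if "0 \<le> w" for w
    using abs_barrier_le[of \<beta> z x K] \<beta> z x0 that
    by (intro levy.integrable_const_bound[where B="K + \<beta> * K\<^sup>2"]) auto
  moreover have "max 0 (K - w) \<le> barrier K \<beta> z x w" for w using \<beta> x0 by (intro payoff_le_barrier) auto
  ultimately have "levy.V n z \<le> barrier K \<beta> z x z"
    using z by (intro levy.bermudan_put_le_supersolution[OF _ _ super beyond]) auto
  also have "\<dots> = K - z" using x0 s by (simp add: barrier_def)
  finally show ?thesis .
qed

lemma ex_exercise_region:
  assumes dplus: "0 < r - \<delta> - up_rate"
  shows "\<exists>C>0. \<forall>t<T. \<forall>z b. 0 \<le> z \<longrightarrow> z + C * sqrt (T - t) < b \<longrightarrow> b \<le> K \<longrightarrow>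
    (\<forall>v. 0 \<le> v \<longrightarrow> v < b \<longrightarrow> bs_put t v \<le> K - v) \<longrightarrow> levy_put t z \<le> K - z"
proof -
  obtain C1 where C1: "0 < C1" and error: "\<And>t. t < T \<Longrightarrow>
      eventually (\<lambda>n. \<forall>v\<ge>0. bermudan_price levy_law r K (T - t) n v \<le> bs_put t v + C1 * (T - t) * v) sequentially"
    using ex_levy_bermudan_price_le_bs_put by blast
  obtain \<beta> where \<beta>: "0 < \<beta>" and super: "\<And>z x0 x. 0 \<le> z \<Longrightarrow> 0 < x0 \<Longrightarrow> x0 < x \<Longrightarrow> x \<le> K \<Longrightarrow>
      eventually (\<lambda>h. \<forall>w. 0 \<le> w \<longrightarrow> w \<le> x0 \<longrightarrow>
        exp (- r * h) * (\<integral>y. barrier K \<beta> z x (w * exp y) \<partial>levy_law h) \<le> barrier K \<beta> z x w) (at_right 0)"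
    using ex_barrier_supersolution[OF dplus] by blast
  define C where "C = sqrt (C1 * K / \<beta>)"
  have C: "0 < C" "\<beta> * C\<^sup>2 = C1 * K" unfolding C_def using C1 K_pos \<beta> by simp_all
  have "levy_put t z \<le> K - z"
    if t: "t < T" and z: "0 \<le> z" and zb: "z + C * sqrt (T - t) < b" and b: "b \<le> K"
      and exercise: "\<And>v. 0 \<le> v \<Longrightarrow> v < b \<Longrightarrow> bs_put t v \<le> K - v" for t z b
  proof (rule tendsto_upperbound[OF tendsto_levy_put[OF t z]])
    have \<theta>: "0 < T - t" using t by simp
    define s where "s = C * sqrt (T - t)"
    have s: "0 < s" "\<beta> * s\<^sup>2 = C1 * K * (T - t)"
      using C \<theta> by (simp_all add: s_def power_mult_distrib mult.assoc[symmetric])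
    define x0 x where "x0 = (2 * (z + s) + b) / 3" and "x = (z + s + 2 * b) / 3"
    have x0: "0 < x0" "x0 < x" "x < b" "z + s \<le> x0" using zb s z by (auto simp: x0_def x_def s_def)
    have "x \<le> K" using x0 b by simp
    from eventually_compose_filterlim[OF super[OF z x0(1,2) this] filterlim_mesh[OF \<theta>]] error[OF t]
      eventually_gt_at_top[of 0]
    show "eventually (\<lambda>n. bermudan_price levy_law r K (T - t) n z \<le> K - z) sequentially"
    proof eventually_elim
      case (elim n)
      have near: "bermudan_price levy_law r K (T - t) n v \<le> K - v + \<beta> * s\<^sup>2" if v: "0 \<le> v" "v < b" for v
      proof -
        have "C1 * (T - t) * v \<le> C1 * (T - t) * K" using C1 \<theta> v b by (intro mult_left_mono) auto
        then show ?thesis using elim(2) exercise[OF v] v(1) s(2) by (force simp: ac_simps)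
      qed
      show ?case
        unfolding bermudan_price_def
        by (rule bermudan_put_levy_le_payoff[OF _ \<beta> z x0(1-3) b _ near[unfolded bermudan_price_def] _ x0(4)])
          (use elim \<theta> s in auto)
    qed
  qed simp
  then show ?thesis using C(1) by blast
qed

end

lemma critical_price_le:
  assumes "0 \<le> x" "max 0 (K - x) < P t x"
  shows "critical_price P K t \<le> x"
  unfolding critical_price_def using assms by (intro cInf_lower bdd_belowI[of _ 0]) auto

lemma critical_price_ge:
  assumes "0 \<le> x" "max 0 (K - x) < P t x" and "\<And>z. 0 \<le> z \<Longrightarrow> z < b \<Longrightarrow> P t z \<le> max 0 (K - z)"
  shows "b \<le> critical_price P K t"
  unfolding critical_price_def
proof (rule cInf_greatest)
  fix z assume "z \<in> {x. 0 \<le> x \<and> P t x > max 0 (K - x)}"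
  then show "b \<le> z" using assms(3)[of z] by (intro leI) auto
qed (use assms in auto)

lemma (in exp_levy_market) ex_critical_price_gap_le:
  assumes "0 < r - \<delta> - up_rate"
  shows "\<exists>C>0. \<forall>t<T. critical_price levy_put K t \<le> critical_price bs_put K t \<and>
    critical_price bs_put K t - critical_price levy_put K t \<le> C * sqrt (T - t)"
proof -
  obtain C where C: "0 < C" and region: "\<And>t z b. t < T \<Longrightarrow> 0 \<le> z \<Longrightarrow> z + C * sqrt (T - t) < b \<Longrightarrow> b \<le> K \<Longrightarrow>
      (\<And>v. 0 \<le> v \<Longrightarrow> v < b \<Longrightarrow> bs_put t v \<le> K - v) \<Longrightarrow> levy_put t z \<le> K - z"
    using ex_exercise_region[OF assms] by metis
  have "critical_price levy_put K t \<le> critical_price bs_put K t \<and>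
      critical_price bs_put K t - critical_price levy_put K t \<le> C * sqrt (T - t)" if t: "t < T" for t
  proof
    let ?b = "critical_price bs_put K t"
    have bs_strike: "max 0 (K - K) < bs_put t K" using bs_put_strike_pos[OF t] by simp
    then have levy_strike: "max 0 (K - K) < levy_put t K" using bs_put_le_levy_put[OF t, of K] K_pos by simp
    have exercise: "bs_put t v \<le> max 0 (K - v)" if "0 \<le> v" "v < ?b" for v
      using critical_price_le[of v K bs_put t] that by (intro leI) auto
    have b: "?b \<le> K" using bs_strike K_pos by (intro critical_price_le) auto
    show "critical_price levy_put K t \<le> ?b"
    proof (rule critical_price_ge[where P=bs_put and x=K])
      fix v assume v: "0 \<le> v" "v < critical_price levy_put K t"
      have "bs_put t v \<le> levy_put t v" using t v(1) by (rule bs_put_le_levy_put)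
      also have "\<dots> \<le> max 0 (K - v)" using critical_price_le[of v K levy_put t] v by (intro leI) auto
      finally show "bs_put t v \<le> max 0 (K - v)" .
    qed (use K_pos bs_strike in auto)
    have "?b - C * sqrt (T - t) \<le> critical_price levy_put K t"
    proof (rule critical_price_ge[where P=levy_put and x=K])
      fix z assume z: "0 \<le> z" "z < ?b - C * sqrt (T - t)"
      have "bs_put t v \<le> K - v" if "0 \<le> v" "v < ?b" for v using exercise[OF that] that b by simp
      then have "levy_put t z \<le> K - z" using z b by (intro region[OF t]) auto
      then show "levy_put t z \<le> max 0 (K - z)" by simp
    qed (use K_pos levy_strike in auto)
    then show "?b - critical_price levy_put K t \<le> C * sqrt (T - t)" by simp
  qed
  then show ?thesis using C by blast
qed

theorem theorem4p1:
  fixes M :: "'a measure" and X B :: "real \<Rightarrow> 'a \<Rightarrow> real" and \<nu> :: "real measure"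
    and \<sigma> \<gamma> T K r \<delta> :: real
  assumes triplet: "levy_triplet M X \<sigma> \<gamma> \<nu>"
    and BM: "brownian_motion M (usual_filtration M X) B"
    and T: "T > 0" and K: "K > 0" and r: "r > 0" and \<delta>: "\<delta> \<ge> 0"
    and exp_mom: "integrable \<nu> (\<lambda>y. indicator {y. \<bar>y\<bar> \<ge> 1} y * exp y)"
    and mart: "\<sigma>\<^sup>2 / 2 + \<gamma> + (\<integral>y. exp y - 1 - y * indicator {y. \<bar>y\<bar> \<le> 1} y \<partial>\<nu>) = 0"
    and \<sigma>: "\<sigma> > 0"
    and fin_var: "integrable \<nu> (\<lambda>y. indicator {y. \<bar>y\<bar> \<le> 1} y * \<bar>y\<bar>)"
    and dplus: "r - \<delta> - (\<integral>y. max 0 (exp y - 1) \<partial>\<nu>) > 0"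
  shows "\<exists>C>0. eventually (\<lambda>t.
           let P = american_put M (usual_filtration M X)
                     (\<lambda>x s \<omega>. x * exp ((r - \<delta>) * s + X s \<omega>)) r K T;
               PBS = american_put M (usual_filtration M X)
                     (\<lambda>x s \<omega>. x * exp ((r - \<delta> - \<sigma>\<^sup>2 / 2) * s + \<sigma> * B s \<omega>)) r K T;
               d = critical_price PBS K t - critical_price P K t
           in 0 \<le> d \<and> d \<le> C * sqrt (T - t)) (at_left T)"
proof -
  interpret exp_levy_market \<nu> M X B \<sigma> \<gamma> r \<delta> K T
    using triplet BM mart \<sigma> K r \<delta> exp_mom fin_var
    by unfold_locales (auto simp: levy_triplet_def)
  have "0 < r - \<delta> - up_rate" using dplus by (simp add: up_rate_def)
  from ex_critical_price_gap_le[OF this] obtain C where "0 < C"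
    and gap: "\<And>t. t < T \<Longrightarrow> critical_price levy_put K t \<le> critical_price bs_put K t \<and>
      critical_price bs_put K t - critical_price levy_put K t \<le> C * sqrt (T - t)" by blast
  have "eventually (\<lambda>t. t < T) (at_left T)" by (simp add: eventually_at_filter)
  then show ?thesis
    unfolding Let_def levy_put_def[symmetric] bs_put_def[symmetric]
    using \<open>0 < C\<close> gap by (intro exI[of _ C] conjI) (auto elim: eventually_mono)
qed

end
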